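(* The following are equivalent over $\mathsf{ACA}_0$: (1) $\Pi^1_1$ comprehension (the scheme $\exists Z \forall n (n \in Z \leftrightarrow \varphi(n))$ for all $\Pi^1_1$ formulas $\varphi$ of $\mathrm{L}_2$ in which $Z$ is not free, with parameters allowed). (2) For every $X \subseteq \mathbb{N}$, the truth set $C(X)$ of the $X$-computable entailment relation exists.
   Context: $\mathrm{L}_2$ is the language of second order arithmetic: two-sorted, with number variables, set variables, and symbols $0, 1, +, \cdot, <, \in$. $\mathsf{ACA}_0$ is the $\mathrm{L}_2$-theory consisting of the basic axioms (those of Peano arithmetic without induction), the single induction axiom $\forall X((0 \in X \wedge \forall n(n \in X \to n+1 \in X)) \to \forall n(n \in X))$, and the comprehension scheme $\exists X \forall n(n \in X \leftrightarrow \varphi(n))$ for all arithmetical formulas $\varphi$ (with parameters, $X$ not free in $\varphi$). $\mathbb{N}$ denotes the internal natural numbers of the theory. The following definitions are made in $\mathsf{ACA}_0$. Countable coded models: a set $W \subseteq \mathbb{N}$ codes the countable $\omega$-model $M$ whose sets are $(W)_n = \{ i : (i,n) \in W \}$, $n \in \mathbb{N}$ (with $(i,n)$ a standard pairing function); $Y \in M$ means $\exists n\,(Y = (W)_n)$. Countable Turing ideals: $W$ codes a countable Turing ideal $M$ containing $X$ (i.e. $X \in M$) iff (i) for all $m,n$ there is $k$ with $(W)_k = (W)_m \oplus (W)_n$, where $A \oplus B = \{2x : x \in A\} \cup \{2y+1 : y \in B\}$; (ii) for all $m$, if $Y \leq_{\mathbf{T}} (W)_m$ then there is $k$ with $(W)_k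 = Y$; (iii) there is $k$ with $(W)_k = X$. Valuation functions: for a (code for a) sentence $\varphi$, $\mathrm{Sub}_M(\varphi)$ is the set of (codes for) sentences obtained from subformulas of $\varphi$ by substituting parameters from $M$ (natural numbers for free number variables, indices $n$ of sets $(W)_n$ for free set variables). A valuation function for $\varphi$ is a function $f : \mathrm{Sub}_M(\varphi) \to \{0,1\}$ obeying the Tarski truth clauses for $M$: it gives atomic sentences their correct truth values (with number quantifiers ranging over $\mathbb{N}$, set quantifiers ranging over the sets $(W)_n$, and the constant for $X$ interpreted as $X$), and commutes with connectives and quantifiers. $X$-computable entailment: let $X \subseteq \mathbb{N}$ and let $\ulcorner\varphi\urcorner$ be a Gödel code for a sentence $\varphi$ of $\mathrm{L}_2$ extended with a constant symbol for $X$. We say $\varphi$ is $X$-computably entailed, $\ulcorner\varphi\urcorner \in C(X)$, if for every code $W$ for a countable Turing ideal $M$ with $X \in M$, and every valuation function $f : \mathrm{Sub}_M(\varphi) \to \{0,1\}$, we have $f(\ulcorner\varphi\urcorner) = 1$. "$C(X)$ exists" means that there is a set whose elements are exactly the codes $\ulcorner\varphi\urcorner$ of $X$-computably entailed sentences. *)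

theory Defs
  imports Main
begin

section \<open>The language of second order arithmetic\<close>

datatype tm = NVar nat | Zero | One | Plus tm tm | Times tm tm

text \<open>Number variables and set variables are two separate families, each indexed by \<^typ>\<open>nat\<close>.
  As usual, equality is primitive for numbers only.\<close>

datatype fm =
    Eq tm tm
  | Less tm tm
  | Mem tm nat
  | Neg fm
  | Conj fm fm
  | AllN nat fm
  | AllS nat fm

abbreviation Imp :: "fm \<Rightarrow> fm \<Rightarrow> fm" where "Imp p q \<equiv> Neg (Conj p (Neg q))"
abbreviation Disj :: "fm \<Rightarrow> fm \<Rightarrow> fm" where "Disj p q \<equiv> Neg (Conj (Neg p) (Neg q))"
abbreviation Iff :: "fm \<Rightarrow> fm \<Rightarrow> fm" where "Iff p q \<equiv> Conj (Imp p q) (Imp q p)"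
abbreviation ExS :: "nat \<Rightarrow> fm \<Rightarrow> fm" where "ExS X p \<equiv> Neg (AllS X (Neg p))"

primrec fvS :: "fm \<Rightarrow> nat set" where
  "fvS (Eq s t) = {}"
| "fvS (Less s t) = {}"
| "fvS (Mem t X) = {X}"
| "fvS (Neg p) = fvS p"
| "fvS (Conj p q) = fvS p \<union> fvS q"
| "fvS (AllN n p) = fvS p"
| "fvS (AllS X p) = fvS p - {X}"

primrec arithmetical :: "fm \<Rightarrow> bool" where
  "arithmetical (Eq s t) \<longleftrightarrow> True"
| "arithmetical (Less s t) \<longleftrightarrow> True"
| "arithmetical (Mem t X) \<longleftrightarrow> True"
| "arithmetical (Neg p) \<longleftrightarrow> arithmetical p"
| "arithmetical (Conj p q) \<longleftrightarrow> arithmetical p \<and> arithmetical q"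
| "arithmetical (AllN n p) \<longleftrightarrow> arithmetical p"
| "arithmetical (AllS X p) \<longleftrightarrow> False"

definition Pi11 :: "fm \<Rightarrow> bool" where
  "Pi11 p \<longleftrightarrow> (\<exists>X q. arithmetical q \<and> p = AllS X q)"


section \<open>Structures and satisfaction\<close>

text \<open>The numbers of a structure are all elements of \<^typ>\<open>'a\<close>; its sets form an arbitrary family
  of subsets of \<^typ>\<open>'a\<close> (general, or Henkin, semantics).\<close>

record 'a L2_structure =
  nzero :: 'a    (\<open>\<zero>\<index>\<close>)
  none :: 'a     (\<open>\<one>\<index>\<close>)
  nplus :: "'a \<Rightarrow> 'a \<Rightarrow> 'a"   (infixl \<open>\<oplus>\<index>\<close> 65)
  ntimes :: "'a \<Rightarrow> 'a \<Rightarrow> 'a"  (infixl \<open>\<otimes>\<index>\<close> 70)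
  nless :: "'a \<Rightarrow> 'a \<Rightarrow> bool" (infix \<open>\<prec>\<index>\<close> 50)
  sets :: "'a set set"

primrec tval :: "'a L2_structure \<Rightarrow> (nat \<Rightarrow> 'a) \<Rightarrow> tm \<Rightarrow> 'a" where
  "tval M e (NVar n) = e n"
| "tval M e Zero = \<zero>\<^bsub>M\<^esub>"
| "tval M e One = \<one>\<^bsub>M\<^esub>"
| "tval M e (Plus s t) = tval M e s \<oplus>\<^bsub>M\<^esub> tval M e t"
| "tval M e (Times s t) = tval M e s \<otimes>\<^bsub>M\<^esub> tval M e t"

primrec sat :: "'a L2_structure \<Rightarrow> (nat \<Rightarrow> 'a) \<Rightarrow> (nat \<Rightarrow> 'a set) \<Rightarrow> fm \<Rightarrow> bool" where
  "sat M e E (Eq s t) \<longleftrightarrow> tval M e s = tval M e t"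
| "sat M e E (Less s t) \<longleftrightarrow> tval M e s \<prec>\<^bsub>M\<^esub> tval M e t"
| "sat M e E (Mem t X) \<longleftrightarrow> tval M e t \<in> E X"
| "sat M e E (Neg p) \<longleftrightarrow> \<not> sat M e E p"
| "sat M e E (Conj p q) \<longleftrightarrow> sat M e E p \<and> sat M e E q"
| "sat M e E (AllN n p) \<longleftrightarrow> (\<forall>x. sat M (e(n := x)) E p)"
| "sat M e E (AllS X p) \<longleftrightarrow> (\<forall>A\<in>sets M. sat M e (E(X := A)) p)"

text \<open>Free variables of axioms act as parameters: they are read universally.\<close>

definition models :: "'a L2_structure \<Rightarrow> fm set \<Rightarrow> bool"  (infix \<open>\<Turnstile>\<close> 50) where
  "M \<Turnstile> T \<longleftrightarrow> (\<forall>p\<in>T. \<forall>e E. (\<forall>X. E X \<in> sets M) \<longrightarrow> sat M e E p)"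


section \<open>Axiom systems\<close>

definition basic_axioms :: "fm set" where
  "basic_axioms =
    (let m = NVar 0; n = NVar 1 in
     {Neg (Eq (Plus n One) Zero),
      Imp (Eq (Plus m One) (Plus n One)) (Eq m n),
      Eq (Plus m Zero) m,
      Eq (Plus m (Plus n One)) (Plus (Plus m n) One),
      Eq (Times m Zero) Zero,
      Eq (Times m (Plus n One)) (Plus (Times m n) m),
      Neg (Less m Zero),
      Iff (Less m (Plus n One)) (Disj (Less m n) (Eq m n))})"

definition induction_axiom :: fm where
  "induction_axiom =
    AllS 0 (Imp (Conj (Mem Zero 0)
                      (AllN 0 (Imp (Mem (NVar 0) 0) (Mem (Plus (NVar 0) One) 0))))
                (AllN 0 (Mem (NVar 0) 0)))"

definition comprehension :: "(fm \<Rightarrow> bool) \<Rightarrow> fm set" where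
  "comprehension C =
    {ExS X (AllN n (Iff (Mem (NVar n) X) p)) | X n p. C p \<and> X \<notin> fvS p}"

definition ACA0 :: "fm set" where
  "ACA0 = basic_axioms \<union> {induction_axiom} \<union> comprehension arithmetical"

definition Pi11_CA :: "fm set" where
  "Pi11_CA = comprehension Pi11"


section \<open>Notions defined inside a structure\<close>

text \<open>Everything below is the interpretation in a structure \<open>M\<close> of a definition made in second
  order arithmetic: number quantifiers range over the (possibly nonstandard) numbers of \<open>M\<close> and
  set quantifiers over \<open>sets M\<close>. In particular codes of formulas, of programs and of finite
  sequences are numbers of \<open>M\<close>. Set-valued expressions such as sections and joins are class
  terms, used only through membership, equality and relations that unfold to these.\<close>

context
  fixes M :: "'a L2_structure" (structure)
begin

primrec num :: "nat \<Rightarrow> 'a" where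
  "num 0 = \<zero>"
| "num (Suc k) = num k \<oplus> \<one>"

definition pr :: "'a \<Rightarrow> 'a \<Rightarrow> 'a" where
  "pr x y = (x \<oplus> y) \<otimes> (x \<oplus> y) \<oplus> x"

text \<open>For \<open>k \<ge> 1\<close> the number \<open>node k x y\<close> exceeds both \<open>x\<close> and \<open>y\<close>.\<close>

definition node :: "nat \<Rightarrow> 'a \<Rightarrow> 'a \<Rightarrow> 'a" where
  "node k x y = pr (num k) (pr x y)"

subsection \<open>Inductive definitions by finite certificates\<close>

text \<open>The usual coding of finite sets by triples of numbers, based on the Chinese remainder theorem:
  \<open>i\<close> belongs to the set iff \<open>i < k\<close> and \<open>m(i + 1) + 1\<close> divides \<open>n\<close>.\<close>

definition fset :: "'a \<Rightarrow> 'a \<Rightarrow> 'a \<Rightarrow> 'a set" where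
  "fset k m n = {i. i \<prec> k \<and> (\<exists>q. n = q \<otimes> (m \<otimes> (i \<oplus> \<one>) \<oplus> \<one>))}"

text \<open>\<open>derivable \<Phi> a\<close>: \<open>a\<close> lies in a (coded) finite set each of whose members \<open>x\<close> is justified,
  in the sense of the clauses \<open>\<Phi>\<close>, by members of that same set. In every use below the premises of
  a clause are smaller than its conclusion in a well-founded order, so this is the inductive
  definition with clauses \<open>\<Phi>\<close>, phrased with derivations that are coded by numbers of \<open>M\<close>.\<close>

definition derivable :: "('a set \<Rightarrow> 'a \<Rightarrow> bool) \<Rightarrow> 'a \<Rightarrow> bool" where
  "derivable \<Phi> a \<longleftrightarrow> (\<exists>k m n. a \<in> fset k m n \<and> (\<forall>x\<in>fset k m n. \<Phi> (fset k m n) x))"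

text \<open>There is a finite sequence from \<open>a\<close> to \<open>b\<close> whose consecutive entries are related by \<open>R\<close>;
  \<open>pr i p\<close> in the certificate says that \<open>p\<close> is reached from \<open>a\<close> in \<open>i\<close> steps.\<close>

definition chain :: "('a \<Rightarrow> 'a \<Rightarrow> bool) \<Rightarrow> 'a \<Rightarrow> 'a \<Rightarrow> bool" where
  "chain R a b \<longleftrightarrow>
    (\<exists>l. derivable (\<lambda>F x. x = pr \<zero> a \<or>
                     (\<exists>i p q. x = pr (i \<oplus> \<one>) q \<and> pr i p \<in> F \<and> R p q)) (pr l b))"

subsection \<open>Relative computability\<close>

text \<open>Programs for the partial recursive functionals, with unary functions acting on coded pairs.\<close>

definition p_zero :: 'a where "p_zero = node 1 \<zero> \<zero>"
definition p_succ :: 'a where "p_succ = node 2 \<zero> \<zero>"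
definition p_id :: 'a where "p_id = node 3 \<zero> \<zero>"
definition p_fst :: 'a where "p_fst = node 4 \<zero> \<zero>"
definition p_snd :: 'a where "p_snd = node 5 \<zero> \<zero>"
definition p_oracle :: 'a where "p_oracle = node 6 \<zero> \<zero>"
definition p_pair :: "'a \<Rightarrow> 'a \<Rightarrow> 'a" where "p_pair f g = node 7 f g"
definition p_comp :: "'a \<Rightarrow> 'a \<Rightarrow> 'a" where "p_comp f g = node 8 f g"
definition p_rec :: "'a \<Rightarrow> 'a \<Rightarrow> 'a" where "p_rec f g = node 9 f g"
definition p_mu :: "'a \<Rightarrow> 'a" where "p_mu f = node 10 f \<zero>"

text \<open>\<open>computes Z e x y\<close>: the program \<open>e\<close> with oracle \<open>Z\<close> halts on input \<open>x\<close> with output \<open>y\<close>.\<close>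

definition computes :: "'a set \<Rightarrow> 'a \<Rightarrow> 'a \<Rightarrow> 'a \<Rightarrow> bool" where
  "computes Z e x y \<longleftrightarrow> derivable
    (\<lambda>F c. \<exists>e x y. c = pr e (pr x y) \<and>
      (e = p_zero \<and> y = \<zero> \<or>
       e = p_succ \<and> y = x \<oplus> \<one> \<or>
       e = p_id \<and> y = x \<or>
       e = p_fst \<and> (\<exists>w. x = pr y w) \<or>
       e = p_snd \<and> (\<exists>w. x = pr w y) \<or>
       e = p_oracle \<and> (x \<in> Z \<and> y = \<one> \<or> x \<notin> Z \<and> y = \<zero>) \<or>
       (\<exists>f g u v. e = p_pair f g \<and> y = pr u v \<and> pr f (pr x u) \<in> F \<and> pr g (pr x v) \<in> F) \<or>
       (\<exists>f g u. e = p_comp f g \<and> pr g (pr x u) \<in> F \<and> pr f (pr u y) \<in> F) \<or>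
       (\<exists>f g a. e = p_rec f g \<and> x = pr a \<zero> \<and> pr f (pr a y) \<in> F) \<or>
       (\<exists>f g a n u. e = p_rec f g \<and> x = pr a (n \<oplus> \<one>) \<and>
          pr e (pr (pr a n) u) \<in> F \<and> pr g (pr (pr a (pr n u)) y) \<in> F) \<or>
       (\<exists>f. e = p_mu f \<and> pr f (pr (pr x y) \<zero>) \<in> F \<and>
          (\<forall>n. n \<prec> y \<longrightarrow> (\<exists>u. u \<noteq> \<zero> \<and> pr f (pr (pr x n) u) \<in> F)))))
    (pr e (pr x y))"

definition turing_le :: "'a set \<Rightarrow> 'a set \<Rightarrow> bool"  (infix \<open>\<le>\<^sub>T\<close> 50) where
  "Y \<le>\<^sub>T Z \<longleftrightarrow>
    (\<exists>e. \<forall>x. (x \<in> Y \<longrightarrow> computes Z e x \<one>) \<and> (x \<notin> Y \<longrightarrow> computes Z e x \<zero>))"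

subsection \<open>Countable coded Turing ideals\<close>

definition section_of :: "'a set \<Rightarrow> 'a \<Rightarrow> 'a set" where
  "section_of W n = {i. pr i n \<in> W}"

definition join :: "'a set \<Rightarrow> 'a set \<Rightarrow> 'a set" where
  "join A B = {(\<one> \<oplus> \<one>) \<otimes> x | x. x \<in> A} \<union> {(\<one> \<oplus> \<one>) \<otimes> y \<oplus> \<one> | y. y \<in> B}"

definition turing_ideal :: "'a set \<Rightarrow> 'a set \<Rightarrow> bool" where
  "turing_ideal W X \<longleftrightarrow>
    (\<forall>m n. \<exists>k. section_of W k = join (section_of W m) (section_of W n)) \<and>
    (\<forall>m. \<forall>Y\<in>sets M. Y \<le>\<^sub>T section_of W m \<longrightarrow> (\<exists>k. section_of W k = Y)) \<and>
    (\<exists>k. section_of W k = X)"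

subsection \<open>Coded syntax\<close>

text \<open>Codes for expressions of the language with a constant \<open>c_X\<close> for the set \<open>X\<close>, extended by
  parameters: \<open>c_num n\<close> names the number \<open>n\<close> and \<open>c_set n\<close> names the set \<open>section_of W n\<close>.\<close>

definition c_var :: "'a \<Rightarrow> 'a" where "c_var v = node 1 v \<zero>"
definition c_zero :: 'a where "c_zero = node 2 \<zero> \<zero>"
definition c_one :: 'a where "c_one = node 3 \<zero> \<zero>"
definition c_plus :: "'a \<Rightarrow> 'a \<Rightarrow> 'a" where "c_plus s t = node 4 s t"
definition c_times :: "'a \<Rightarrow> 'a \<Rightarrow> 'a" where "c_times s t = node 5 s t"
definition c_num :: "'a \<Rightarrow> 'a" where "c_num n = node 6 n \<zero>"
definition c_svar :: "'a \<Rightarrow> 'a" where "c_svar v = node 7 v \<zero>"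
definition c_X :: 'a where "c_X = node 8 \<zero> \<zero>"
definition c_set :: "'a \<Rightarrow> 'a" where "c_set n = node 9 n \<zero>"
definition c_eq :: "'a \<Rightarrow> 'a \<Rightarrow> 'a" where "c_eq s t = node 10 s t"
definition c_less :: "'a \<Rightarrow> 'a \<Rightarrow> 'a" where "c_less s t = node 11 s t"
definition c_mem :: "'a \<Rightarrow> 'a \<Rightarrow> 'a" where "c_mem t A = node 12 t A"
definition c_neg :: "'a \<Rightarrow> 'a" where "c_neg p = node 13 p \<zero>"
definition c_conj :: "'a \<Rightarrow> 'a \<Rightarrow> 'a" where "c_conj p q = node 14 p q"
definition c_alln :: "'a \<Rightarrow> 'a \<Rightarrow> 'a" where "c_alln v p = node 15 v p"
definition c_alls :: "'a \<Rightarrow> 'a \<Rightarrow> 'a" where "c_alls v p = node 16 v p"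

definition binary_ops :: "('a \<Rightarrow> 'a \<Rightarrow> 'a) set" where
  "binary_ops = {c_plus, c_times, c_eq, c_less, c_mem, c_conj}"

text \<open>\<open>is_term\<close>, \<open>is_set_term\<close> and \<open>is_formula\<close> describe expressions without parameters.\<close>

definition is_term :: "'a \<Rightarrow> bool" where
  "is_term = derivable
    (\<lambda>F x. (\<exists>v. x = c_var v) \<or> x = c_zero \<or> x = c_one \<or>
           (\<exists>s\<in>F. \<exists>t\<in>F. x = c_plus s t \<or> x = c_times s t))"

definition is_set_term :: "'a \<Rightarrow> bool" where
  "is_set_term A \<longleftrightarrow> (\<exists>v. A = c_svar v) \<or> A = c_X"

definition is_formula :: "'a \<Rightarrow> bool" where
  "is_formula = derivable
    (\<lambda>F x. (\<exists>s t. is_term s \<and> is_term t \<and> (x = c_eq s t \<or> x = c_less s t)) \<or>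
           (\<exists>t A. is_term t \<and> is_set_term A \<and> x = c_mem t A) \<or>
           (\<exists>p\<in>F. x = c_neg p) \<or>
           (\<exists>p\<in>F. \<exists>q\<in>F. x = c_conj p q) \<or>
           (\<exists>v. \<exists>p\<in>F. x = c_alln v p \<or> x = c_alls v p))"

text \<open>\<open>free_in z a\<close>: the variable with code \<open>z\<close> (of the form \<open>c_var v\<close> or \<open>c_svar v\<close>) occurs
  free in the term or formula with code \<open>a\<close>.\<close>

definition free_in :: "'a \<Rightarrow> 'a \<Rightarrow> bool" where
  "free_in z = derivable
    (\<lambda>F x. x = z \<or>
           (\<exists>f\<in>binary_ops. \<exists>a b. x = f a b \<and> (a \<in> F \<or> b \<in> F)) \<or>
           (\<exists>p\<in>F. x = c_neg p) \<or>
           (\<exists>v. \<exists>p\<in>F. x = c_alln v p \<and> z \<noteq> c_var v) \<or>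
           (\<exists>v. \<exists>p\<in>F. x = c_alls v p \<and> z \<noteq> c_svar v))"

definition is_closed :: "'a \<Rightarrow> bool" where
  "is_closed a \<longleftrightarrow> (\<forall>v. \<not> free_in (c_var v) a \<and> \<not> free_in (c_svar v) a)"

definition is_sentence :: "'a \<Rightarrow> bool" where
  "is_sentence p \<longleftrightarrow> is_formula p \<and> is_closed p"

text \<open>\<open>subst z c p q\<close>: replacing the free occurrences of the variable \<open>z\<close> in \<open>p\<close> by \<open>c\<close> yields \<open>q\<close>.
  Only parameters are substituted for variables, so no variable can be captured.\<close>

definition subst :: "'a \<Rightarrow> 'a \<Rightarrow> 'a \<Rightarrow> 'a \<Rightarrow> bool" where
  "subst z c p q \<longleftrightarrow> derivable
    (\<lambda>F x. \<exists>p q. x = pr p q \<and>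
      (p = z \<and> q = c \<or>
       p \<noteq> z \<and> q = p \<and>
         ((\<exists>n. p = c_var n \<or> p = c_num n \<or> p = c_svar n \<or> p = c_set n) \<or>
          p = c_zero \<or> p = c_one \<or> p = c_X) \<or>
       (\<exists>f\<in>binary_ops. \<exists>a b a' b'. p = f a b \<and> q = f a' b' \<and> pr a a' \<in> F \<and> pr b b' \<in> F) \<or>
       (\<exists>a a'. p = c_neg a \<and> q = c_neg a' \<and> pr a a' \<in> F) \<or>
       (\<exists>v a. (p = c_alln v a \<and> z = c_var v \<or> p = c_alls v a \<and> z = c_svar v) \<and> q = p) \<or>
       (\<exists>v a a'. p = c_alln v a \<and> z \<noteq> c_var v \<and> q = c_alln v a' \<and> pr a a' \<in> F) \<or>
       (\<exists>v a a'. p = c_alls v a \<and> z \<noteq> c_svar v \<and> q = c_alls v a' \<and> pr a a' \<in> F)))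
    (pr p q)"

subsection \<open>Valuations and computable entailment\<close>

definition immediate_subformula :: "'a \<Rightarrow> 'a \<Rightarrow> bool" where
  "immediate_subformula p q \<longleftrightarrow>
    p = c_neg q \<or> (\<exists>r. p = c_conj q r \<or> p = c_conj r q) \<or> (\<exists>v. p = c_alln v q \<or> p = c_alls v q)"

definition parameter_instance :: "'a \<Rightarrow> 'a \<Rightarrow> bool" where
  "parameter_instance p q \<longleftrightarrow>
    (\<exists>v n. subst (c_var v) (c_num n) p q \<or> subst (c_svar v) (c_set n) p q)"

text \<open>The parameters of the coded model are numbers and indices of its sets, so \<open>Sub\<close> does not
  depend on the code of the model.\<close>

definition Sub :: "'a \<Rightarrow> 'a set" where
  "Sub p = {s. is_closed s \<and>
    (\<exists>q. chain immediate_subformula p q \<and> chain parameter_instance q s)}"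

definition term_val :: "'a \<Rightarrow> 'a \<Rightarrow> bool" where
  "term_val t n \<longleftrightarrow> derivable
    (\<lambda>F x. \<exists>t n. x = pr t n \<and>
      (t = c_zero \<and> n = \<zero> \<or>
       t = c_one \<and> n = \<one> \<or>
       t = c_num n \<or>
       (\<exists>a b i j. pr a i \<in> F \<and> pr b j \<in> F \<and>
          (t = c_plus a b \<and> n = i \<oplus> j \<or> t = c_times a b \<and> n = i \<otimes> j))))
    (pr t n)"

definition in_set_term :: "'a set \<Rightarrow> 'a set \<Rightarrow> 'a \<Rightarrow> 'a \<Rightarrow> bool" where
  "in_set_term W X i A \<longleftrightarrow>
    A = c_X \<and> i \<in> X \<or> (\<exists>n. A = c_set n \<and> i \<in> section_of W n)"

definition val_function :: "'a \<Rightarrow> 'a set \<Rightarrow> bool" where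
  "val_function p f \<longleftrightarrow>
    (\<forall>x\<in>f. \<exists>s\<in>Sub p. x = pr s \<zero> \<or> x = pr s \<one>) \<and>
    (\<forall>s\<in>Sub p. pr s \<zero> \<in> f \<longleftrightarrow> pr s \<one> \<notin> f)"

text \<open>\<open>valuation W X p f\<close>: \<open>f\<close> is (the graph of) a valuation function for \<open>p\<close> in the model coded
  by \<open>W\<close>.\<close>

definition valuation :: "'a set \<Rightarrow> 'a set \<Rightarrow> 'a \<Rightarrow> 'a set \<Rightarrow> bool" where
  "valuation W X p f \<longleftrightarrow> val_function p f \<and>
    (\<forall>s t. c_eq s t \<in> Sub p \<longrightarrow>
      (pr (c_eq s t) \<one> \<in> f \<longleftrightarrow> (\<exists>i j. term_val s i \<and> term_val t j \<and> i = j))) \<and>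
    (\<forall>s t. c_less s t \<in> Sub p \<longrightarrow>
      (pr (c_less s t) \<one> \<in> f \<longleftrightarrow> (\<exists>i j. term_val s i \<and> term_val t j \<and> i \<prec> j))) \<and>
    (\<forall>t A. c_mem t A \<in> Sub p \<longrightarrow>
      (pr (c_mem t A) \<one> \<in> f \<longleftrightarrow> (\<exists>i. term_val t i \<and> in_set_term W X i A))) \<and>
    (\<forall>q. c_neg q \<in> Sub p \<longrightarrow>
      (pr (c_neg q) \<one> \<in> f \<longleftrightarrow> pr q \<zero> \<in> f)) \<and>
    (\<forall>q r. c_conj q r \<in> Sub p \<longrightarrow>
      (pr (c_conj q r) \<one> \<in> f \<longleftrightarrow> pr q \<one> \<in> f \<and> pr r \<one> \<in> f)) \<and>
    (\<forall>v q. c_alln v q \<in> Sub p \<longrightarrow>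
      (pr (c_alln v q) \<one> \<in> f \<longleftrightarrow>
        (\<forall>n r. subst (c_var v) (c_num n) q r \<longrightarrow> pr r \<one> \<in> f))) \<and>
    (\<forall>v q. c_alls v q \<in> Sub p \<longrightarrow>
      (pr (c_alls v q) \<one> \<in> f \<longleftrightarrow>
        (\<forall>n r. subst (c_svar v) (c_set n) q r \<longrightarrow> pr r \<one> \<in> f)))"

definition computably_entailed :: "'a set \<Rightarrow> 'a \<Rightarrow> bool" where
  "computably_entailed X p \<longleftrightarrow> is_sentence p \<and>
    (\<forall>W\<in>sets M. turing_ideal W X \<longrightarrow>
      (\<forall>f\<in>sets M. valuation W X p f \<longrightarrow> pr p \<one> \<in> f))"

definition truth_sets_exist :: bool where
  "truth_sets_exist \<longleftrightarrow>
    (\<forall>X\<in>sets M. \<exists>C\<in>sets M. \<forall>p. p \<in> C \<longleftrightarrow> computably_entailed X p)"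

end

end

theory Submission
  imports Defs
begin

text \<open>
  \<^bold>\<open>From comprehension to truth sets.\<close> That \<open>p\<close> is \<open>X\<close>-computably entailed says: for all sets
  \<open>W\<close> and \<open>f\<close>, if \<open>W\<close> codes a Turing ideal containing \<open>X\<close> and \<open>f\<close> is a valuation for \<open>p\<close>, then \<open>f\<close>
  makes \<open>p\<close> true. This would be a \<open>\<Pi>\<^sup>1\<^sub>1\<close> condition were it not for the closure condition on
  ideals, which speaks of all sets \<open>Y\<close> computable from a section of \<open>W\<close>. Computations are
  deterministic (\<open>computes_fun\<close>), so \<open>Y\<close> is determined by a program, and the quantifier over \<open>Y\<close> can
  be replaced by one over programs (\<open>turing_ideal_alt\<close>). After pairing \<open>W\<close> with \<open>f\<close> the condition is
  \<open>\<Pi>\<^sup>1\<^sub>1\<close> (\<open>computably_entailed_set\<close>).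

  \<^bold>\<open>From truth sets to comprehension.\<close> Let \<open>\<forall>Y. \<theta>(n, Y)\<close> be a \<open>\<Pi>\<^sup>1\<^sub>1\<close> formula. Its set parameters
  are coded into one set \<open>X\<close>; its number parameters and the value of \<open>n\<close> are replaced by closed
  numerals, whose length may be nonstandard. The resulting sentence is \<open>X\<close>-computably entailed iff
  \<open>\<forall>Y. \<theta>(n, Y)\<close> is true (\<open>code_entailed\<close>): a valuation evaluates the arithmetical formula \<open>\<theta>\<close> in an
  \<open>\<omega>\<close>-model exactly as \<open>M\<close> does (\<open>valuation_code_fm\<close>), so a true sentence is entailed; and if \<open>Y = A\<close>
  is a counterexample, then the sentence fails in the Turing ideal generated by \<open>X\<close> and \<open>A\<close>, which
  arithmetical comprehension can code (\<open>ideal_exists\<close>), and the valuation that witnesses this exists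
  because the quantifier depth of the sentence is a standard number (\<open>valuation_exists\<close>). Hence
  the set defined by \<open>\<forall>Y. \<theta>(n, Y)\<close> is arithmetical in \<open>C(X)\<close>.

  The numbers of \<open>M\<close> may be nonstandard, so facts about arbitrary codes have to be proved by
  induction inside \<open>M\<close>, which is available for arithmetically definable predicates only; induction
  in the metatheory is confined to the formula \<open>\<theta>\<close> and to depths of formulas. The predicate \<open>definable\<close> and its closure rules
  discharge the side condition. Two constructions carry the internal arguments. The first is the
  coding of bounded definable sets through the Chinese remainder theorem (\<open>bounded_fin\<close>), which
  makes finite certificates combinable. The second is a notion of computation relative to a
  \<^emph>\<open>tree\<close> of oracles: a tree names a set computed from the sets that its subtrees name, so the
  sets named by trees are closed under Turing reducibility without any composition of programs
  (\<open>computes_simulation\<close>).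
\<close>

section \<open>Renaming of variables\<close>

primrec rename_tm :: "(nat \<Rightarrow> nat) \<Rightarrow> tm \<Rightarrow> tm" where
  "rename_tm r (NVar n) = NVar (r n)"
| "rename_tm r Zero = Zero"
| "rename_tm r One = One"
| "rename_tm r (Plus s t) = Plus (rename_tm r s) (rename_tm r t)"
| "rename_tm r (Times s t) = Times (rename_tm r s) (rename_tm r t)"

primrec rename_fm :: "(nat \<Rightarrow> nat) \<Rightarrow> (nat \<Rightarrow> nat) \<Rightarrow> fm \<Rightarrow> fm" where
  "rename_fm r u (Eq s t) = Eq (rename_tm r s) (rename_tm r t)"
| "rename_fm r u (Less s t) = Less (rename_tm r s) (rename_tm r t)"
| "rename_fm r u (Mem t X) = Mem (rename_tm r t) (u X)"
| "rename_fm r u (Neg p) = Neg (rename_fm r u p)"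
| "rename_fm r u (Conj p q) = Conj (rename_fm r u p) (rename_fm r u q)"
| "rename_fm r u (AllN n p) = AllN (r n) (rename_fm r u p)"
| "rename_fm r u (AllS X p) = AllS (u X) (rename_fm r u p)"

lemma tval_rename_tm: "tval M e (rename_tm r t) = tval M (e \<circ> r) t"
  by (induction t) auto

lemma upd_comp_inj: "inj r \<Longrightarrow> e(r n := x) \<circ> r = (e \<circ> r)(n := x)"
  by (auto simp: fun_eq_iff dest: injD)

lemma sat_rename_fm: "inj r \<Longrightarrow> inj u \<Longrightarrow> sat M e E (rename_fm r u p) \<longleftrightarrow> sat M (e \<circ> r) (E \<circ> u) p"
  by (induction p arbitrary: e E) (simp_all add: tval_rename_tm upd_comp_inj)

lemma arithmetical_rename_fm [simp]: "arithmetical (rename_fm r u p) = arithmetical p"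
  by (induction p) auto

lemma sat_cong_sets:
  "(\<And>V. V \<in> fvS p \<Longrightarrow> E V = E' V) \<Longrightarrow> sat M e E p \<longleftrightarrow> sat M e E' p"
proof (induction p arbitrary: e E E')
  case (AllS X p)
  have "sat M e (E(X := A)) p \<longleftrightarrow> sat M e (E'(X := A)) p" for A
    by (rule AllS.IH) (use AllS.prems in auto)
  then show ?case by simp
next
  case (Conj p q)
  have "sat M e E p = sat M e E' p" "sat M e E q = sat M e E' q"
    using Conj.prems by (auto intro!: Conj.IH)
  then show ?case by simp
next
  case (Neg p)
  have "sat M e E p = sat M e E' p" using Neg.prems by (auto intro!: Neg.IH)
  then show ?case by simp
next
  case (AllN n p)
  have "sat M (e(n := x)) E p = sat M (e(n := x)) E' p" for x
    using AllN.prems by (auto intro!: AllN.IH)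
  then show ?case by simp
qed simp_all

lemma sat_comprehension:
  "sat M e E (ExS V (AllN n (Iff (Mem (NVar n) V) q))) \<longleftrightarrow>
    (\<exists>B\<in>sets M. \<forall>x. x \<in> B \<longleftrightarrow> sat M (e(n := x)) (E(V := B)) q)"
  by simp blast

lemma finite_fvS [simp]: "finite (fvS p)"
  by (induction p) auto

text \<open>An assignment of the number variables is split in two: even variables are the arguments of a
  predicate, odd variables hold its number parameters.\<close>

definition interleave :: "(nat \<Rightarrow> 'a) \<Rightarrow> (nat \<Rightarrow> 'a) \<Rightarrow> nat \<Rightarrow> 'a" where
  "interleave e c i = (if even i then e (i div 2) else c (i div 2))"

lemma interleave_simps [simp]: "interleave e c (2 * i) = e i" "interleave e c (Suc (2 * i)) = c i"
  by (auto simp: interleave_def)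

lemma interleave_cases: obtains k where "i = 2 * k" | k where "i = Suc (2 * k)"
  by (metis oddE evenE Suc_eq_plus1)

text \<open>Two formulas with parameter lists \<open>c\<close> and \<open>d\<close> are brought to the common list
  \<open>interleave c d\<close> by renaming their odd variables; the Boolean selects the list.\<close>

definition spread :: "bool \<Rightarrow> nat \<Rightarrow> nat" where
  "spread b i = (if even i then i else Suc (2 * (if b then i else i - 1)))"

lemma spread_simps [simp]:
  "spread b (2 * i) = 2 * i"
  "spread True (Suc (2 * i)) = Suc (2 * (Suc (2 * i)))"
  "spread False (Suc (2 * i)) = Suc (2 * (2 * i))"
  by (auto simp: spread_def)

lemma inj_spread: "inj (spread b)"
proof (rule inj_on_inverseI)
  fix i
  show "(\<lambda>j. if even j then j else if b then j div 2 else j div 2 + 1) (spread b i) = i"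
    by (cases b; cases i rule: interleave_cases) simp_all
qed

lemma interleave_spread: "interleave e (interleave c d) \<circ> spread b = interleave e (if b then d else c)"
proof
  fix i show "(interleave e (interleave c d) \<circ> spread b) i = interleave e (if b then d else c) i"
    by (cases b; cases i rule: interleave_cases) (simp_all only: o_apply spread_simps interleave_simps if_True if_False)
qed

text \<open>Quantification over argument \<open>0\<close> moves that argument to the odd variable \<open>1\<close>, shifts the other
  arguments down and makes room among the parameters.\<close>

definition slot :: "nat \<Rightarrow> nat" where
  "slot i = (if i = 0 then 1 else if even i then i - 2 else i + 2)"

lemma slot_simps [simp]: "slot 0 = Suc 0" "slot (Suc (Suc (2 * i))) = 2 * i"
    "slot (Suc (2 * i)) = Suc (Suc (Suc (2 * i)))"
  by (auto simp: slot_def)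

lemma inj_slot: "inj slot"
proof (rule inj_on_inverseI)
  fix i
  show "(\<lambda>j. if j = 1 then 0 else if even j then j + 2 else j - 2) (slot i) = i"
    by (cases i; cases "i - 1") (auto simp: slot_def)
qed

lemma interleave_slot: "(interleave e (case_nat d c))(Suc 0 := x) \<circ> slot = interleave (case_nat x e) c"
proof
  fix i show "((interleave e (case_nat d c))(Suc 0 := x) \<circ> slot) i = interleave (case_nat x e) c i"
  proof (cases i rule: interleave_cases)
    case (1 k)
    show ?thesis
    proof (cases k)
      case 0 then show ?thesis using 1 interleave_simps(1)[of "case_nat x e" c 0] by simp
    next
      case (Suc j)
      then have "i = Suc (Suc (2 * j))" using 1 by simp
      then show ?thesis using 1 Suc interleave_simps(1)[of "case_nat x e" c "Suc j"] by simp
    qed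
  next
    case (2 k)
    then show ?thesis using interleave_simps(2)[of e "case_nat d c" "Suc k"] by simp
  qed
qed

text \<open>The analogue of \<open>spread\<close> for set variables; variable \<open>0\<close> is the argument and stays fixed.\<close>

definition setspread :: "bool \<Rightarrow> nat \<Rightarrow> nat" where
  "setspread b = case_nat 0 (\<lambda>V. Suc (2 * V + (if b then 1 else 0)))"

lemma inj_setspread: "inj (setspread b)"
  unfolding setspread_def by (rule injI) (auto split: nat.splits)

lemma case_nat_setspread:
  "case_nat S (interleave C D) \<circ> setspread b = case_nat S (if b then D else C)"
  by (rule ext) (auto simp: setspread_def split: nat.splits)











section \<open>Finitary conditions\<close>

named_theorems finitary_intros

text \<open>Conditions on a set that are monotone and depend on finitely many members only, where finite is
  meant in the metatheory. The clauses of all inductive definitions of coded syntax have this form;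
  the clause for the search operator of programs has not.\<close>

definition finitary :: "('a set \<Rightarrow> bool) \<Rightarrow> bool" where
  "finitary Q \<longleftrightarrow> (\<forall>F G. F \<subseteq> G \<longrightarrow> Q F \<longrightarrow> Q G) \<and> (\<forall>F. Q F \<longrightarrow> (\<exists>S\<subseteq>F. finite S \<and> Q S))"

lemma finitaryI: "(\<And>F G. F \<subseteq> G \<Longrightarrow> Q F \<Longrightarrow> Q G) \<Longrightarrow> (\<And>F. Q F \<Longrightarrow> \<exists>S\<subseteq>F. finite S \<and> Q S) \<Longrightarrow> finitary Q"
  unfolding finitary_def by simp

lemma finitary_mono: "finitary Q \<Longrightarrow> F \<subseteq> G \<Longrightarrow> Q F \<Longrightarrow> Q G"
  unfolding finitary_def by simp

lemma finitary_support: assumes "finitary Q" "Q F" obtains S where "S \<subseteq> F" "finite S" "Q S"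
  using assms unfolding finitary_def by auto

lemma finitary_const [finitary_intros]: "finitary (\<lambda>F. b)" by (rule finitaryI) auto

lemma finitary_mem [finitary_intros]: "finitary (\<lambda>F. a \<in> F)"
  by (rule finitaryI) (auto intro!: exI[of _ "{a}"])

lemma finitary_disj [finitary_intros]: assumes "finitary P" "finitary Q" shows "finitary (\<lambda>F. P F \<or> Q F)"
proof (rule finitaryI)
  show "\<exists>S\<subseteq>F. finite S \<and> (P S \<or> Q S)" if "P F \<or> Q F" for F
    using that by (elim disjE) (metis finitary_support[OF assms(1)], metis finitary_support[OF assms(2)])
qed (use finitary_mono[OF assms(1)] finitary_mono[OF assms(2)] in auto)

lemma finitary_conj [finitary_intros]: assumes "finitary P" "finitary Q" shows "finitary (\<lambda>F. P F \<and> Q F)"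
proof (rule finitaryI)
  show "\<exists>S\<subseteq>F. finite S \<and> P S \<and> Q S" if F: "P F \<and> Q F" for F
  proof -
    obtain S where S: "S \<subseteq> F" "finite S" "P S" using finitary_support[OF assms(1)] F by blast
    obtain T where T: "T \<subseteq> F" "finite T" "Q T" using finitary_support[OF assms(2)] F by blast
    have "P (S \<union> T)" using finitary_mono[OF assms(1), of S "S \<union> T"] S by simp
    moreover have "Q (S \<union> T)" using finitary_mono[OF assms(2), of T "S \<union> T"] T by simp
    ultimately show ?thesis using S T by (intro exI[of _ "S \<union> T"]) auto
  qed
qed (use finitary_mono[OF assms(1)] finitary_mono[OF assms(2)] in auto)

lemma finitary_ex [finitary_intros]: assumes "\<And>y. finitary (P y)" shows "finitary (\<lambda>F. \<exists>y. P y F)"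
proof (rule finitaryI)
  show "\<exists>S\<subseteq>F. finite S \<and> (\<exists>y. P y S)" if "\<exists>y. P y F" for F
    using that finitary_support[OF assms] by metis
qed (use finitary_mono[OF assms] in blast)

lemma finitary_bex [finitary_intros]: "(\<And>y. finitary (P y)) \<Longrightarrow> finitary (\<lambda>F. \<exists>y\<in>F. P y F)"
  unfolding Bex_def by (intro finitary_intros)

section \<open>Arithmetically definable predicates\<close>

named_theorems definableI

locale aca0 =
  fixes M :: "'a L2_structure" (structure)
  assumes nonempty: "sets M \<noteq> {}" and models_ACA0: "M \<Turnstile> ACA0"
begin

text \<open>Functions of an assignment that are values of terms with parameters. Arguments are numbered in
  the manner of de Bruijn indices.\<close>

definition polynomial :: "((nat \<Rightarrow> 'a) \<Rightarrow> 'a) \<Rightarrow> bool" where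
  "polynomial T \<longleftrightarrow> (\<exists>t c. \<forall>e. T e = tval M (interleave e c) t)"

text \<open>A predicate of numbers \<open>e 0, e 1, \<dots>\<close> and one set \<open>S\<close> that is given by an arithmetical formula
  with parameters from \<open>M\<close>. Because arbitrary parameters are absorbed, every constant of type \<^typ>\<open>'a\<close>
  and every member of \<^term>\<open>sets M\<close> may occur in a predicate, and the rules \<open>definableI\<close> prove
  definability by following the structure of a formula of higher-order logic. The set \<open>S\<close> is the
  one over which a \<open>\<Pi>\<^sup>1\<^sub>1\<close> formula quantifies.\<close>

definition definable :: "((nat \<Rightarrow> 'a) \<Rightarrow> 'a set \<Rightarrow> bool) \<Rightarrow> bool" where
  "definable P \<longleftrightarrow> (\<exists>q c C. arithmetical q \<and> (\<forall>V. C V \<in> sets M) \<and>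
     (\<forall>e S. P e S \<longleftrightarrow> sat M (interleave e c) (case_nat S C) q))"

lemma tval_spread: "tval M (interleave e (interleave c d)) (rename_tm (spread b) t) = tval M (interleave e (if b then d else c)) t"
  by (simp add: tval_rename_tm interleave_spread)

lemma sat_spread: "sat M (interleave e (interleave c d)) (case_nat S (interleave C D)) (rename_fm (spread b) (setspread b) q)
    \<longleftrightarrow> sat M (interleave e (if b then d else c)) (case_nat S (if b then D else C)) q"
  by (simp add: sat_rename_fm inj_spread inj_setspread interleave_spread case_nat_setspread)

lemma polynomial_var [definableI]: "polynomial (\<lambda>e. e n)"
  unfolding polynomial_def by (rule exI[of _ "NVar (2 * n)"]) simp

lemma polynomial_const [definableI]: "polynomial (\<lambda>e. c)"
  unfolding polynomial_def by (rule exI[of _ "NVar 1"], rule exI[of _ "\<lambda>_. c"]) (simp add: interleave_def)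

lemma polynomial_two:
  assumes "polynomial s" "polynomial t"
  obtains p q c where "\<And>e. s e = tval M (interleave e c) p" "\<And>e. t e = tval M (interleave e c) q"
proof -
  obtain p c where 1: "\<And>e. s e = tval M (interleave e c) p" using assms(1) unfolding polynomial_def by blast
  obtain q d where 2: "\<And>e. t e = tval M (interleave e d) q" using assms(2) unfolding polynomial_def by blast
  show ?thesis
    by (rule that[of "interleave c d" "rename_tm (spread False) p" "rename_tm (spread True) q"])
      (simp_all add: 1 2 tval_spread)
qed

lemma polynomial_plus [definableI]: "polynomial s \<Longrightarrow> polynomial t \<Longrightarrow> polynomial (\<lambda>e. s e \<oplus> t e)"
proof (erule (1) polynomial_two)
  fix c p q assume 1: "\<And>e. s e = tval M (interleave e c) p" "\<And>e. t e = tval M (interleave e c) q"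
  show ?thesis unfolding polynomial_def by (rule exI[of _ "Plus p q"], rule exI[of _ c]) (simp add: 1)
qed

lemma polynomial_times [definableI]: "polynomial s \<Longrightarrow> polynomial t \<Longrightarrow> polynomial (\<lambda>e. s e \<otimes> t e)"
proof (erule (1) polynomial_two)
  fix c p q assume 1: "\<And>e. s e = tval M (interleave e c) p" "\<And>e. t e = tval M (interleave e c) q"
  show ?thesis unfolding polynomial_def by (rule exI[of _ "Times p q"], rule exI[of _ c]) (simp add: 1)
qed

lemma polynomial_shift: "polynomial t \<Longrightarrow> polynomial (\<lambda>e. t (\<lambda>i. e (Suc i)))"
proof -
  assume "polynomial t"
  then obtain p c where 1: "\<And>e. t e = tval M (interleave e c) p" unfolding polynomial_def by blast
  define r where "r i = (if even i then i + 2 else i)" for i :: nat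
  have "interleave (\<lambda>i. e (Suc i)) c = interleave e c \<circ> r" for e
  proof
    fix i show "interleave (\<lambda>i. e (Suc i)) c i = (interleave e c \<circ> r) i"
      using interleave_simps(1)[of e c "Suc _"] by (cases i rule: interleave_cases) (auto simp: r_def)
  qed
  then have "t (\<lambda>i. e (Suc i)) = tval M (interleave e c) (rename_tm r p)" for e
    by (simp add: 1 tval_rename_tm)
  then show ?thesis unfolding polynomial_def by blast
qed

lemma some_set: obtains A where "A \<in> sets M" using nonempty by auto

lemma definable_eq [definableI]: "polynomial s \<Longrightarrow> polynomial t \<Longrightarrow> definable (\<lambda>e S. s e = t e)"
proof (erule (1) polynomial_two)
  fix c p q assume 1: "\<And>e. s e = tval M (interleave e c) p" "\<And>e. t e = tval M (interleave e c) q"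
  obtain A where "A \<in> sets M" by (rule some_set)
  then show ?thesis unfolding definable_def
    by (intro exI[of _ "Eq p q"] exI[of _ c] exI[of _ "\<lambda>_. A"]) (simp add: 1)
qed

lemma definable_less [definableI]: "polynomial s \<Longrightarrow> polynomial t \<Longrightarrow> definable (\<lambda>e S. s e \<prec> t e)"
proof (erule (1) polynomial_two)
  fix c p q assume 1: "\<And>e. s e = tval M (interleave e c) p" "\<And>e. t e = tval M (interleave e c) q"
  obtain A where "A \<in> sets M" by (rule some_set)
  then show ?thesis unfolding definable_def
    by (intro exI[of _ "Less p q"] exI[of _ c] exI[of _ "\<lambda>_. A"]) (simp add: 1)
qed

lemma definable_mem_var [definableI]: "polynomial t \<Longrightarrow> definable (\<lambda>e S. t e \<in> S)"
proof -
  assume "polynomial t"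
  then obtain p c where 1: "\<And>e. t e = tval M (interleave e c) p" unfolding polynomial_def by blast
  obtain A where "A \<in> sets M" by (rule some_set)
  then show ?thesis unfolding definable_def
    by (intro exI[of _ "Mem p 0"] exI[of _ c] exI[of _ "\<lambda>_. A"]) (simp add: 1)
qed

lemma definable_mem_const [definableI]: "polynomial t \<Longrightarrow> A \<in> sets M \<Longrightarrow> definable (\<lambda>e S. t e \<in> A)"
proof -
  assume "polynomial t" "A \<in> sets M"
  then obtain p c where 1: "\<And>e. t e = tval M (interleave e c) p" unfolding polynomial_def by blast
  show ?thesis unfolding definable_def
    by (intro exI[of _ "Mem p 1"] exI[of _ c] exI[of _ "\<lambda>_. A"]) (simp add: 1 \<open>A \<in> sets M\<close>)
qed

lemma definable_not [definableI]: "definable P \<Longrightarrow> definable (\<lambda>e S. \<not> P e S)"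
proof -
  assume "definable P"
  then obtain q c C where "arithmetical q" "\<forall>V. C V \<in> sets M"
     "\<And>e S. P e S \<longleftrightarrow> sat M (interleave e c) (case_nat S C) q" unfolding definable_def by blast
  then show ?thesis unfolding definable_def
    by (intro exI[of _ "Neg q"] exI[of _ c] exI[of _ C]) simp
qed

lemma definable_conj [definableI]: "definable P \<Longrightarrow> definable Q \<Longrightarrow> definable (\<lambda>e S. P e S \<and> Q e S)"
proof -
  assume "definable P" "definable Q"
  then obtain q c C r d D where q: "arithmetical q" "\<forall>V. C V \<in> sets M"
     "\<And>e S. P e S \<longleftrightarrow> sat M (interleave e c) (case_nat S C) q" and r: "arithmetical r" "\<forall>V. D V \<in> sets M"
     "\<And>e S. Q e S \<longleftrightarrow> sat M (interleave e d) (case_nat S D) r"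
    unfolding definable_def by blast
  have "\<forall>V. interleave C D V \<in> sets M" using q r by (simp add: interleave_def)
  then show ?thesis unfolding definable_def
    by (intro exI[of _ "Conj (rename_fm (spread False) (setspread False) q) (rename_fm (spread True) (setspread True) r)"]
       exI[of _ "interleave c d"] exI[of _ "interleave C D"]) (simp add: sat_spread q r)
qed

lemma definable_const [definableI]: "definable (\<lambda>e S. b)"
proof -
  have "definable (\<lambda>e S. e 0 = e 0)" by (intro definableI)
  moreover have "definable (\<lambda>e S. \<not> e 0 = e 0)" by (rule definable_not) (intro definableI)
  ultimately show ?thesis by (cases b) simp_all
qed

lemma definable_disj [definableI]: "definable P \<Longrightarrow> definable Q \<Longrightarrow> definable (\<lambda>e S. P e S \<or> Q e S)"
  using definable_not[OF definable_conj[OF definable_not definable_not], of P Q] by simp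

lemma definable_imp [definableI]: "definable P \<Longrightarrow> definable Q \<Longrightarrow> definable (\<lambda>e S. P e S \<longrightarrow> Q e S)"
  unfolding imp_conv_disj by (intro definable_disj definable_not)

lemma definable_iff [definableI]: "definable P \<Longrightarrow> definable Q \<Longrightarrow> definable (\<lambda>e S. P e S \<longleftrightarrow> Q e S)"
  unfolding iff_conv_conj_imp by (intro definable_conj definable_imp)

text \<open>Under the quantifier the bound variable has index \<open>0\<close>, which shifts the indices of the others.\<close>

lemma definable_all [definableI]: "definable (\<lambda>e S. P (\<lambda>i. e (Suc i)) S (e 0)) \<Longrightarrow> definable (\<lambda>e S. \<forall>x. P e S x)"
proof -
  assume "definable (\<lambda>e S. P (\<lambda>i. e (Suc i)) S (e 0))"
  then obtain q c C where q: "arithmetical q" "\<forall>V. C V \<in> sets M"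
     "\<And>e S. P (\<lambda>i. e (Suc i)) S (e 0) \<longleftrightarrow> sat M (interleave e c) (case_nat S C) q" unfolding definable_def by blast
  have P: "P e S x \<longleftrightarrow> sat M (interleave (case_nat x e) c) (case_nat S C) q" for e S x
    using q(3)[of "case_nat x e"] by simp
  show ?thesis unfolding definable_def
    by (intro exI[of _ "AllN (Suc 0) (rename_fm slot id q)"] exI[of _ "case_nat \<zero> c"] exI[of _ C])
      (simp add: sat_rename_fm inj_slot interleave_slot q(1,2) flip: P)
qed

lemma definable_ex [definableI]: "definable (\<lambda>e S. P (\<lambda>i. e (Suc i)) S (e 0)) \<Longrightarrow> definable (\<lambda>e S. \<exists>x. P e S x)"
  using definable_not[OF definable_all[of "\<lambda>e S x. \<not> P e S x"], OF definable_not] by simp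

lemma definable_ball [definableI]: "definable (\<lambda>e S. e 0 \<in> F (\<lambda>i. e (Suc i)) S) \<Longrightarrow>
    definable (\<lambda>e S. P (\<lambda>i. e (Suc i)) S (e 0)) \<Longrightarrow> definable (\<lambda>e S. \<forall>x\<in>F e S. P e S x)"
  unfolding Ball_def by (rule definable_all) (rule definable_imp)

lemma definable_bex [definableI]: "definable (\<lambda>e S. e 0 \<in> F (\<lambda>i. e (Suc i)) S) \<Longrightarrow>
    definable (\<lambda>e S. P (\<lambda>i. e (Suc i)) S (e 0)) \<Longrightarrow> definable (\<lambda>e S. \<exists>x\<in>F e S. P e S x)"
  unfolding Bex_def by (rule definable_ex) (rule definable_conj)

lemma definable_finite_ex:
  "finite I \<Longrightarrow> (\<And>i. i \<in> I \<Longrightarrow> definable (P i)) \<Longrightarrow> definable (\<lambda>e S. \<exists>i\<in>I. P i e S)"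
proof (induction rule: finite_induct)
  case empty show ?case by (simp add: definable_const)
next
  case (insert i I)
  have "definable (\<lambda>e S. P i e S \<or> (\<exists>i\<in>I. P i e S))"
    by (rule definable_disj) (use insert in auto)
  then show ?case by simp
qed

text \<open>It is enough to prove definability for variables as arguments: \<open>P t\<close> is equivalent to
  \<open>\<forall>x. x = t \<longrightarrow> P x\<close>.\<close>

lemma definable_inst: "definable (\<lambda>e S. P (e 0)) \<Longrightarrow> polynomial t \<Longrightarrow> definable (\<lambda>e S. P (t e))"
proof -
  assume "definable (\<lambda>e S. P (e 0))" "polynomial t"
  then have "definable (\<lambda>e S. \<forall>x. x = t e \<longrightarrow> P x)"
    by (intro definable_all definable_imp definable_eq polynomial_var polynomial_shift)
  then show ?thesis by simp
qed

lemma arithmetical_comprehension: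
  assumes "definable (\<lambda>e S. P (e 0))" shows "{x. P x} \<in> sets M"
proof -
  obtain q c C where q: "arithmetical q" "\<forall>V. C V \<in> sets M"
     "\<And>e S. P (e 0) \<longleftrightarrow> sat M (interleave e c) (case_nat S C) q" using assms unfolding definable_def by blast
  obtain A where A: "A \<in> sets M" by (rule some_set)
  obtain V where V: "V \<notin> fvS q" using ex_new_if_finite[OF infinite_UNIV_nat finite_fvS] by blast
  let ?E = "case_nat A C"
  have "ExS V (AllN 0 (Iff (Mem (NVar 0) V) q)) \<in> ACA0"
    unfolding ACA0_def comprehension_def using q(1) V by blast
  moreover have "\<forall>X. ?E X \<in> sets M" using A q(2) by (auto split: nat.splits)
  ultimately have "sat M (interleave (\<lambda>_. \<zero>) c) ?E (ExS V (AllN 0 (Iff (Mem (NVar 0) V) q)))"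
    using models_ACA0 unfolding models_def by blast
  then obtain B where B: "B \<in> sets M" "\<And>x. x \<in> B \<longleftrightarrow> sat M ((interleave (\<lambda>_. \<zero>) c)(0 := x)) (?E(V := B)) q"
    unfolding sat_comprehension by blast
  have "sat M ((interleave (\<lambda>_. \<zero>) c)(0 := x)) (?E(V := B)) q \<longleftrightarrow> P x" for x
  proof -
    have "(interleave (\<lambda>_. \<zero>) c)(0 := x) = interleave ((\<lambda>_. \<zero>)(0 := x)) c" by (auto simp: interleave_def fun_eq_iff)
    moreover have "sat M ((interleave (\<lambda>_. \<zero>) c)(0 := x)) (?E(V := B)) q \<longleftrightarrow> sat M ((interleave (\<lambda>_. \<zero>) c)(0 := x)) ?E q"
      by (rule sat_cong_sets) (use V in auto)
    ultimately show ?thesis using q(3)[of "(\<lambda>_. \<zero>)(0 := x)" A] by simp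
  qed
  then have "B = {x. P x}" using B(2) by blast
  then show ?thesis using B(1) by simp
qed

lemma Pi11_comprehension:
  assumes "M \<Turnstile> Pi11_CA" "definable (\<lambda>e S. P (e 0) S)" shows "{x. \<forall>A\<in>sets M. P x A} \<in> sets M"
proof -
  obtain q c C where q: "arithmetical q" "\<forall>V. C V \<in> sets M"
     "\<And>e S. P (e 0) S \<longleftrightarrow> sat M (interleave e c) (case_nat S C) q" using assms(2) unfolding definable_def by blast
  obtain A where A: "A \<in> sets M" by (rule some_set)
  obtain V where V: "V \<notin> fvS (AllS 0 q)" using ex_new_if_finite[OF infinite_UNIV_nat finite_fvS] by blast
  let ?E = "case_nat A C"
  have "Pi11 (AllS 0 q)" unfolding Pi11_def using q(1) by blast
  then have "ExS V (AllN 0 (Iff (Mem (NVar 0) V) (AllS 0 q))) \<in> Pi11_CA"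
    unfolding Pi11_CA_def comprehension_def using V by blast
  moreover have "\<forall>X. ?E X \<in> sets M" using A q(2) by (auto split: nat.splits)
  ultimately have "sat M (interleave (\<lambda>_. \<zero>) c) ?E (ExS V (AllN 0 (Iff (Mem (NVar 0) V) (AllS 0 q))))"
    using assms(1) unfolding models_def by blast
  then have "\<exists>B\<in>sets M. \<forall>x. x \<in> B \<longleftrightarrow> sat M ((interleave (\<lambda>_. \<zero>) c)(0 := x)) (?E(V := B)) (AllS 0 q)"
    unfolding sat_comprehension .
  then obtain B where B: "B \<in> sets M"
    "\<And>x. x \<in> B \<longleftrightarrow> sat M ((interleave (\<lambda>_. \<zero>) c)(0 := x)) (?E(V := B)) (AllS 0 q)" by blast
  have "sat M ((interleave (\<lambda>_. \<zero>) c)(0 := x)) (?E(V := B)) (AllS 0 q) \<longleftrightarrow> (\<forall>A\<in>sets M. P x A)" for x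
  proof -
    have "(interleave (\<lambda>_. \<zero>) c)(0 := x) = interleave ((\<lambda>_. \<zero>)(0 := x)) c" by (auto simp: interleave_def fun_eq_iff)
    moreover have "sat M ((interleave (\<lambda>_. \<zero>) c)(0 := x)) (?E(V := B)) (AllS 0 q) \<longleftrightarrow>
        sat M ((interleave (\<lambda>_. \<zero>) c)(0 := x)) ?E (AllS 0 q)"
      by (rule sat_cong_sets) (use V in auto)
    moreover have "?E(0 := A') = case_nat A' C" for A' by (auto simp: fun_eq_iff split: nat.splits)
    ultimately show ?thesis using q(3)[of "(\<lambda>_. \<zero>)(0 := x)"] by simp
  qed
  then have "B = {x. \<forall>A\<in>sets M. P x A}" using B(2) by blast
  then show ?thesis using B(1) by simp
qed

lemma arithmetical_induct:
  assumes "definable (\<lambda>e S. P (e 0))" "P \<zero>" "\<And>x. P x \<Longrightarrow> P (x \<oplus> \<one>)"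
  shows "P a"
proof -
  have A: "{x. P x} \<in> sets M" by (rule arithmetical_comprehension) fact
  have "sat M (\<lambda>_. a) (\<lambda>_. {x. P x}) induction_axiom"
    using models_ACA0 A unfolding models_def ACA0_def by (simp del: sat.simps)
  then have "\<forall>A\<in>sets M. \<zero> \<in> A \<longrightarrow> (\<exists>x. x \<in> A \<and> x \<oplus> \<one> \<notin> A) \<or> (\<forall>x. x \<in> A)"
    unfolding induction_axiom_def by simp
  from bspec[OF this A] show ?thesis using assms(2,3) by auto
qed

section \<open>Arithmetic in a model of arithmetical comprehension\<close>

text \<open>The laws of an ordered semiring follow from the basic axioms by induction inside \<open>M\<close>. The order
  is then an instance of \<^locale>\<open>linorder\<close>.\<close>

lemma basic: "p \<in> basic_axioms \<Longrightarrow> sat M e (\<lambda>_. A) p" if "A \<in> sets M"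
  using models_ACA0 that unfolding models_def ACA0_def by (simp del: sat.simps)

lemma basic_facts:
  "n \<oplus> \<one> \<noteq> \<zero>" "m \<oplus> \<one> = n \<oplus> \<one> \<Longrightarrow> m = n"
  "m \<oplus> \<zero> = m" "m \<oplus> (n \<oplus> \<one>) = (m \<oplus> n) \<oplus> \<one>"
  "m \<otimes> \<zero> = \<zero>" "m \<otimes> (n \<oplus> \<one>) = m \<otimes> n \<oplus> m"
  "\<not> m \<prec> \<zero>" "m \<prec> n \<oplus> \<one> \<longleftrightarrow> m \<prec> n \<or> m = n"
proof -
  obtain A where A: "A \<in> sets M" by (rule some_set)
  define e where "e i = (if i = 0 then m else n)" for i :: nat
  have e: "e 0 = m" "e 1 = n" by (simp_all add: e_def)
  have B: "sat M e (\<lambda>_. A) p" if "p \<in> basic_axioms" for p using basic[OF A that] .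
  have 1: "sat M e (\<lambda>_. A) (Neg (Eq (Plus (NVar 1) One) Zero))"
    "sat M e (\<lambda>_. A) (Imp (Eq (Plus (NVar 0) One) (Plus (NVar 1) One)) (Eq (NVar 0) (NVar 1)))"
    "sat M e (\<lambda>_. A) (Eq (Plus (NVar 0) Zero) (NVar 0))"
    "sat M e (\<lambda>_. A) (Eq (Plus (NVar 0) (Plus (NVar 1) One)) (Plus (Plus (NVar 0) (NVar 1)) One))"
    "sat M e (\<lambda>_. A) (Eq (Times (NVar 0) Zero) Zero)"
    "sat M e (\<lambda>_. A) (Eq (Times (NVar 0) (Plus (NVar 1) One)) (Plus (Times (NVar 0) (NVar 1)) (NVar 0)))"
    "sat M e (\<lambda>_. A) (Neg (Less (NVar 0) Zero))"
    "sat M e (\<lambda>_. A) (Iff (Less (NVar 0) (Plus (NVar 1) One)) (Disj (Less (NVar 0) (NVar 1)) (Eq (NVar 0) (NVar 1))))"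
    by (rule B, unfold basic_axioms_def Let_def, blast)+
  show "n \<oplus> \<one> \<noteq> \<zero>" "m \<oplus> \<one> = n \<oplus> \<one> \<Longrightarrow> m = n"
  "m \<oplus> \<zero> = m" "m \<oplus> (n \<oplus> \<one>) = (m \<oplus> n) \<oplus> \<one>"
  "m \<otimes> \<zero> = \<zero>" "m \<otimes> (n \<oplus> \<one>) = m \<otimes> n \<oplus> m"
  "\<not> m \<prec> \<zero>" "m \<prec> n \<oplus> \<one> \<longleftrightarrow> m \<prec> n \<or> m = n"
    using 1[unfolded sat.simps tval.simps e] by blast+
qed

lemmas succ_nonzero [simp] = basic_facts(1) basic_facts(1)[symmetric]
lemmas add_0 [simp] = basic_facts(3)
lemmas mult_0 [simp] = basic_facts(5)
lemmas not_less_0 [simp] = basic_facts(7)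
lemmas less_succ = basic_facts(8)
lemma succ_inj [simp]: "m \<oplus> \<one> = n \<oplus> \<one> \<longleftrightarrow> m = n" using basic_facts(2) by blast

lemma add_assoc: "(a \<oplus> b) \<oplus> c = a \<oplus> (b \<oplus> c)"
  by (rule arithmetical_induct[where P="\<lambda>c. (a \<oplus> b) \<oplus> c = a \<oplus> (b \<oplus> c)"]) (intro definableI | simp add: basic_facts)+

lemma zero_add [simp]: "\<zero> \<oplus> a = a"
  by (rule arithmetical_induct[where P="\<lambda>a. \<zero> \<oplus> a = a"]) (intro definableI | simp add: basic_facts)+

lemma succ_add: "(a \<oplus> \<one>) \<oplus> b = (a \<oplus> b) \<oplus> \<one>"
  by (rule arithmetical_induct[where P="\<lambda>b. (a \<oplus> \<one>) \<oplus> b = (a \<oplus> b) \<oplus> \<one>"]) (intro definableI | simp add: basic_facts)+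

lemma add_comm: "a \<oplus> b = b \<oplus> a"
  by (rule arithmetical_induct[where P="\<lambda>b. a \<oplus> b = b \<oplus> a"]) (intro definableI | simp add: basic_facts succ_add)+

lemma add_left_comm: "a \<oplus> (b \<oplus> c) = b \<oplus> (a \<oplus> c)"
  by (metis add_assoc add_comm)

lemmas add_ac = add_assoc add_comm add_left_comm

lemma add_cancel [simp]: "a \<oplus> c = b \<oplus> c \<longleftrightarrow> a = b"
  by (rule arithmetical_induct[where P="\<lambda>c. a \<oplus> c = b \<oplus> c \<longleftrightarrow> a = b"]) (intro definableI | simp add: basic_facts)+

lemma add_cancel_left [simp]: "c \<oplus> a = c \<oplus> b \<longleftrightarrow> a = b"
  by (metis add_cancel add_comm)

lemma add_cancel_0 [simp]: "a \<oplus> b = a \<longleftrightarrow> b = \<zero>" "a = a \<oplus> b \<longleftrightarrow> b = \<zero>"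
  by (metis add_cancel_left add_0)+

lemma mult_1_right [simp]: "a \<otimes> \<one> = a"
  using basic_facts(6)[of a \<zero>] by simp

lemma distrib: "a \<otimes> (b \<oplus> c) = a \<otimes> b \<oplus> a \<otimes> c"
proof (rule arithmetical_induct[where P="\<lambda>c. a \<otimes> (b \<oplus> c) = a \<otimes> b \<oplus> a \<otimes> c"])
  show "definable (\<lambda>e S. a \<otimes> (b \<oplus> e 0) = a \<otimes> b \<oplus> a \<otimes> e 0)" by (intro definableI)
  show "a \<otimes> (b \<oplus> (c \<oplus> \<one>)) = a \<otimes> b \<oplus> a \<otimes> (c \<oplus> \<one>)"
    if "a \<otimes> (b \<oplus> c) = a \<otimes> b \<oplus> a \<otimes> c" for c
    using that by (metis basic_facts(4,6) add_assoc)
qed simp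

lemma zero_mult [simp]: "\<zero> \<otimes> a = \<zero>"
  by (rule arithmetical_induct[where P="\<lambda>a. \<zero> \<otimes> a = \<zero>"]) (intro definableI | simp add: basic_facts)+

lemma succ_mult: "(a \<oplus> \<one>) \<otimes> b = a \<otimes> b \<oplus> b"
proof (rule arithmetical_induct[where P="\<lambda>b. (a \<oplus> \<one>) \<otimes> b = a \<otimes> b \<oplus> b"])
  show "definable (\<lambda>e S. (a \<oplus> \<one>) \<otimes> e 0 = a \<otimes> e 0 \<oplus> e 0)" by (intro definableI)
  show "(a \<oplus> \<one>) \<otimes> (b \<oplus> \<one>) = a \<otimes> (b \<oplus> \<one>) \<oplus> (b \<oplus> \<one>)" if "(a \<oplus> \<one>) \<otimes> b = a \<otimes> b \<oplus> b" for b
    using that by (simp only: basic_facts(6) add_assoc) (simp only: add_ac)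
qed simp

lemma mult_comm: "a \<otimes> b = b \<otimes> a"
  by (rule arithmetical_induct[where P="\<lambda>b. a \<otimes> b = b \<otimes> a"]) (intro definableI | simp add: basic_facts(6) succ_mult)+

lemma distrib2: "(b \<oplus> c) \<otimes> a = b \<otimes> a \<oplus> c \<otimes> a"
  by (metis distrib mult_comm)

lemma mult_assoc: "(a \<otimes> b) \<otimes> c = a \<otimes> (b \<otimes> c)"
proof (rule arithmetical_induct[where P="\<lambda>c. (a \<otimes> b) \<otimes> c = a \<otimes> (b \<otimes> c)"])
  show "definable (\<lambda>e S. (a \<otimes> b) \<otimes> e 0 = a \<otimes> (b \<otimes> e 0))" by (intro definableI)
  show "(a \<otimes> b) \<otimes> (c \<oplus> \<one>) = a \<otimes> (b \<otimes> (c \<oplus> \<one>))" if "(a \<otimes> b) \<otimes> c = a \<otimes> (b \<otimes> c)" for c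
    using that by (simp only: basic_facts(6) distrib mult_1_right)
qed simp

lemma mult_left_comm: "a \<otimes> (b \<otimes> c) = b \<otimes> (a \<otimes> c)"
  by (metis mult_assoc mult_comm)

lemma mult_1 [simp]: "\<one> \<otimes> a = a"
  using succ_mult[of \<zero> a] by simp

lemmas ring = add_assoc add_comm add_left_comm mult_assoc mult_comm mult_left_comm distrib distrib2

lemma zero_or_succ: "a = \<zero> \<or> (\<exists>b. a = b \<oplus> \<one>)"
  by (rule arithmetical_induct[where P="\<lambda>a. a = \<zero> \<or> (\<exists>b. a = b \<oplus> \<one>)"]) (intro definableI | simp)+

lemma zero_one [simp]: "\<zero> \<noteq> \<one>" "\<one> \<noteq> \<zero>"
  using basic_facts(1)[of \<zero>] by auto

lemma add_eq_0 [simp]: "a \<oplus> b = \<zero> \<longleftrightarrow> a = \<zero> \<and> b = \<zero>"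
  using zero_or_succ[of b] by (auto simp: basic_facts(4))

lemma less_iff: "m \<prec> n \<longleftrightarrow> (\<exists>d. n = m \<oplus> (d \<oplus> \<one>))"
proof (rule arithmetical_induct[where P="\<lambda>n. m \<prec> n \<longleftrightarrow> (\<exists>d. n = m \<oplus> (d \<oplus> \<one>))"])
  show "definable (\<lambda>e S. m \<prec> e 0 \<longleftrightarrow> (\<exists>d. e 0 = m \<oplus> (d \<oplus> \<one>)))" by (intro definableI)
  show "m \<prec> \<zero> \<longleftrightarrow> (\<exists>d. \<zero> = m \<oplus> (d \<oplus> \<one>))" by (metis basic_facts(1,4,7))
  fix n assume IH: "m \<prec> n \<longleftrightarrow> (\<exists>d. n = m \<oplus> (d \<oplus> \<one>))"
  have "(\<exists>d. n \<oplus> \<one> = m \<oplus> (d \<oplus> \<one>)) \<longleftrightarrow> (\<exists>d. n = m \<oplus> d)" by (metis basic_facts(2,4))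
  also have "\<dots> \<longleftrightarrow> n = m \<or> (\<exists>d. n = m \<oplus> (d \<oplus> \<one>))"
    using zero_or_succ by (metis add_0)
  finally show "m \<prec> n \<oplus> \<one> \<longleftrightarrow> (\<exists>d. n \<oplus> \<one> = m \<oplus> (d \<oplus> \<one>))"
    using IH less_succ by blast
qed

lemma ex_zero_succ: "(\<exists>d. P d) \<longleftrightarrow> P \<zero> \<or> (\<exists>d. P (d \<oplus> \<one>))"
  using zero_or_succ by metis

lemma ex_add_iff: "(\<exists>d. n = m \<oplus> d) \<longleftrightarrow> m \<prec> n \<or> m = n"
  unfolding less_iff by (subst ex_zero_succ) auto

lemma linear: "m \<prec> n \<or> m = n \<or> n \<prec> m"
proof -
  have "(\<exists>d. m = n \<oplus> d) \<or> (\<exists>d. n = m \<oplus> d)"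
  proof (rule arithmetical_induct[where P="\<lambda>m. (\<exists>d. m = n \<oplus> d) \<or> (\<exists>d. n = m \<oplus> d)"])
    show "definable (\<lambda>e S. (\<exists>d. e 0 = n \<oplus> d) \<or> (\<exists>d. n = e 0 \<oplus> d))" by (intro definableI)
    show "(\<exists>d. \<zero> = n \<oplus> d) \<or> (\<exists>d. n = \<zero> \<oplus> d)" by simp
    fix x assume "(\<exists>d. x = n \<oplus> d) \<or> (\<exists>d. n = x \<oplus> d)"
    then show "(\<exists>d. x \<oplus> \<one> = n \<oplus> d) \<or> (\<exists>d. n = (x \<oplus> \<one>) \<oplus> d)"
    proof
      assume "\<exists>d. x = n \<oplus> d" then show ?thesis by (metis basic_facts(4))
    next
      assume "\<exists>d. n = x \<oplus> d" then show ?thesis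
        by (subst (asm) ex_zero_succ) (auto simp: basic_facts(4) succ_add intro: exI[of _ "\<one>"])
    qed
  qed
  then show ?thesis unfolding ex_add_iff by blast
qed

lemma less_irrefl [simp]: "\<not> m \<prec> m" by (simp add: less_iff)

lemma less_trans: "a \<prec> b \<Longrightarrow> b \<prec> c \<Longrightarrow> a \<prec> c"
  unfolding less_iff by (metis add_assoc)

definition le :: "'a \<Rightarrow> 'a \<Rightarrow> bool" where "le x y \<longleftrightarrow> x \<prec> y \<or> x = y"

lemma linorder_less: "class.linorder le (\<prec>)"
proof
  show "x \<prec> y \<longleftrightarrow> le x y \<and> \<not> le y x" for x y
    unfolding le_def using less_trans less_irrefl by blast
  show "le x x" for x unfolding le_def by blast
  show "le x y \<Longrightarrow> le y z \<Longrightarrow> le x z" for x y z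
    unfolding le_def using less_trans by blast
  show "le x y \<Longrightarrow> le y x \<Longrightarrow> x = y" for x y
    unfolding le_def using less_trans less_irrefl by blast
  show "le x y \<or> le y x" for x y
    unfolding le_def using linear by blast
qed

interpretation lo: linorder le "(\<prec>)" by (rule linorder_less)

lemma le_iff: "le x y \<longleftrightarrow> (\<exists>d. y = x \<oplus> d)"
  unfolding le_def ex_add_iff ..

lemma less_succ_self [simp]: "x \<prec> x \<oplus> \<one>" by (simp add: less_succ)

lemma le_add [simp]: "le x (x \<oplus> y)" "le x (y \<oplus> x)" by (auto simp: le_iff add_comm)

lemma le_refl [simp]: "le x x" by (simp add: le_def)

lemma succ_le: "le (x \<oplus> \<one>) y \<longleftrightarrow> x \<prec> y" by (auto simp: le_iff less_iff ring)

lemma add_less_mono: assumes "a \<prec> b" "le c d" shows "a \<oplus> c \<prec> b \<oplus> d"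
proof -
  obtain u v where "b = a \<oplus> (u \<oplus> \<one>)" "d = c \<oplus> v" using assms unfolding less_iff le_iff by blast
  then have "b \<oplus> d = (a \<oplus> c) \<oplus> ((u \<oplus> v) \<oplus> \<one>)" by (simp only: add_ac)
  then show ?thesis unfolding less_iff by blast
qed

lemma arithmetical_less_induct:
  assumes "definable (\<lambda>e S. P (e 0))" "\<And>x. (\<And>y. y \<prec> x \<Longrightarrow> P y) \<Longrightarrow> P x"
  shows "P a"
proof -
  have "\<forall>y. y \<prec> a \<longrightarrow> P y"
    by (rule arithmetical_induct[where P="\<lambda>a. \<forall>y. y \<prec> a \<longrightarrow> P y"])
     (intro definableI definable_inst[OF assms(1)], simp, use assms(2) less_succ in blast)
  then show ?thesis using assms(2) by blast
qed

section \<open>Coded finite sets\<close>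

definition divides :: "'a \<Rightarrow> 'a \<Rightarrow> bool" where "divides d n \<longleftrightarrow> (\<exists>q. n = q \<otimes> d)"

lemma definable_divides [definableI]: "polynomial s \<Longrightarrow> polynomial t \<Longrightarrow> definable (\<lambda>e S. divides (s e) (t e))"
  unfolding divides_def by (intro definableI polynomial_shift)

lemma divides_mult: "divides d n \<Longrightarrow> divides d (n \<otimes> x)"
  unfolding divides_def by (metis mult_assoc mult_comm)

lemma divides_add_cancel: assumes "divides d (a \<oplus> b)" "divides d a" shows "divides d b"
proof -
  obtain q q' where q: "a \<oplus> b = q \<otimes> d" "a = q' \<otimes> d" using assms unfolding divides_def by blast
  show ?thesis
  proof (cases "q \<prec> q'")
    case True
    then obtain r where "q' = q \<oplus> (r \<oplus> \<one>)" unfolding less_iff by blast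
    then have "q \<otimes> d \<oplus> ((r \<oplus> \<one>) \<otimes> d \<oplus> b) = q \<otimes> d" using q by (simp add: distrib2 add_assoc)
    then have "b = \<zero>" by simp
    then show ?thesis unfolding divides_def by (metis zero_mult)
  next
    case False
    then obtain r where "q = q' \<oplus> r" using le_iff[of q' q] linear unfolding le_def by blast
    then have "q' \<otimes> d \<oplus> b = q' \<otimes> d \<oplus> r \<otimes> d" using q by (simp add: distrib2)
    then show ?thesis unfolding divides_def by auto
  qed
qed

lemma multiple_exists: "\<exists>m. m \<noteq> \<zero> \<and> (\<forall>j. j \<prec> b \<longrightarrow> divides (j \<oplus> \<one>) m)"
proof (rule arithmetical_induct[where P="\<lambda>b. \<exists>m. m \<noteq> \<zero> \<and> (\<forall>j. j \<prec> b \<longrightarrow> divides (j \<oplus> \<one>) m)"])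
  show "definable (\<lambda>e S. \<exists>m. m \<noteq> \<zero> \<and> (\<forall>j. j \<prec> e 0 \<longrightarrow> divides (j \<oplus> \<one>) m))" by (intro definableI)
  show "\<exists>m. m \<noteq> \<zero> \<and> (\<forall>j. j \<prec> \<zero> \<longrightarrow> divides (j \<oplus> \<one>) m)" by (auto intro: exI[of _ \<one>])
  fix b assume "\<exists>m. m \<noteq> \<zero> \<and> (\<forall>j. j \<prec> b \<longrightarrow> divides (j \<oplus> \<one>) m)"
  then obtain m where m: "m \<noteq> \<zero>" "\<forall>j. j \<prec> b \<longrightarrow> divides (j \<oplus> \<one>) m" by blast
  obtain m' where m': "m = m' \<oplus> \<one>" using m(1) zero_or_succ by blast
  show "\<exists>m. m \<noteq> \<zero> \<and> (\<forall>j. j \<prec> b \<oplus> \<one> \<longrightarrow> divides (j \<oplus> \<one>) m)"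
  proof (intro exI[of _ "m \<otimes> (b \<oplus> \<one>)"] conjI allI impI)
    show "m \<otimes> (b \<oplus> \<one>) \<noteq> \<zero>" unfolding m' by (simp add: distrib distrib2)
    fix j assume "j \<prec> b \<oplus> \<one>"
    then show "divides (j \<oplus> \<one>) (m \<otimes> (b \<oplus> \<one>))"
      using m(2) divides_mult less_succ divides_def by metis
  qed
qed

text \<open>Goedel's moduli: if every \<open>j + 1\<close> with \<open>j < b\<close> divides \<open>m\<close>, then the moduli for \<open>j < b\<close> are
  pairwise coprime. Coprimality is used in the form that \<open>d | x c\<close> implies \<open>d | x\<close>, which
  avoids primes and greatest common divisors inside \<open>M\<close>.\<close>

definition modulus :: "'a \<Rightarrow> 'a \<Rightarrow> 'a" where "modulus m i = m \<otimes> (i \<oplus> \<one>) \<oplus> \<one>"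

context
  fixes b m assumes m: "\<And>j. j \<prec> b \<Longrightarrow> divides (j \<oplus> \<one>) m" "m \<noteq> \<zero>"
begin

text \<open>The modulus is \<open>1\<close> modulo \<open>m\<close>, so \<open>y\<close> is the difference of a multiple of the modulus and
  \<open>y m (j + 1)\<close>.\<close>

lemma modulus_cancel_m: assumes "divides (modulus m j) (y \<otimes> m)" shows "divides (modulus m j) y"
proof (rule divides_add_cancel)
  show "divides (modulus m j) (y \<otimes> m \<otimes> (j \<oplus> \<one>))" by (rule divides_mult) fact
  have "y \<otimes> m \<otimes> (j \<oplus> \<one>) \<oplus> y = y \<otimes> modulus m j" by (simp add: modulus_def ring)
  then show "divides (modulus m j) (y \<otimes> m \<otimes> (j \<oplus> \<one>) \<oplus> y)" unfolding divides_def by auto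
qed

lemma modulus_cancel_diff: assumes "divides (modulus m j) (x \<otimes> (m \<otimes> (t \<oplus> \<one>)))" "t \<prec> b" shows "divides (modulus m j) x"
proof -
  obtain u where u: "m = u \<otimes> (t \<oplus> \<one>)" using m(1)[OF assms(2)] unfolding divides_def by blast
  have "divides (modulus m j) (x \<otimes> (t \<oplus> \<one>) \<otimes> m)" using assms(1) by (simp only: ring)
  then have "divides (modulus m j) (x \<otimes> (t \<oplus> \<one>))" by (rule modulus_cancel_m)
  then have "divides (modulus m j) (x \<otimes> (t \<oplus> \<one>) \<otimes> u)" by (rule divides_mult)
  then have "divides (modulus m j) (x \<otimes> m)" by (simp only: mult_assoc mult_comm[of "t \<oplus> \<one>" u] u[symmetric])
  then show ?thesis by (rule modulus_cancel_m)
qed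

text \<open>The difference of two moduli is \<open>m (t + 1)\<close> with \<open>t < b\<close>; both factors can be cancelled.\<close>

lemma modulus_coprime: assumes "divides (modulus m j) (x \<otimes> modulus m i)" "i \<prec> b" "j \<prec> b" "i \<noteq> j" shows "divides (modulus m j) x"
proof -
  have self: "divides (modulus m j) (x \<otimes> modulus m j)" unfolding divides_def by blast
  consider "i \<prec> j" | "j \<prec> i" using assms(4) linear by blast
  then show ?thesis
  proof cases
    case 1
    then obtain t where t: "j = i \<oplus> (t \<oplus> \<one>)" unfolding less_iff by blast
    have "x \<otimes> modulus m j = x \<otimes> modulus m i \<oplus> x \<otimes> (m \<otimes> (t \<oplus> \<one>))" by (simp add: modulus_def t ring)
    moreover have "t \<prec> b" using assms(3) t by (metis add_comm add_assoc less_iff less_trans less_succ_self)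
    ultimately show ?thesis using modulus_cancel_diff divides_add_cancel assms(1) self by metis
  next
    case 2
    then obtain t where t: "i = j \<oplus> (t \<oplus> \<one>)" unfolding less_iff by blast
    have "x \<otimes> modulus m i = x \<otimes> modulus m j \<oplus> x \<otimes> (m \<otimes> (t \<oplus> \<one>))" by (simp add: modulus_def t ring)
    moreover have "t \<prec> b" using assms(2) t by (metis add_comm add_assoc less_iff less_trans less_succ_self)
    ultimately show ?thesis using modulus_cancel_diff divides_add_cancel assms(1) self by metis
  qed
qed

lemma modulus_not_one: "\<not> divides (modulus m j) \<one>"
proof
  assume "divides (modulus m j) \<one>"
  then obtain q where q: "\<one> = q \<otimes> modulus m j" unfolding divides_def by blast
  then have "q \<noteq> \<zero>" by auto
  then obtain r where r: "q = r \<oplus> \<one>" using zero_or_succ by blast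
  have "\<zero> \<oplus> \<one> = (r \<otimes> modulus m j \<oplus> m \<otimes> (j \<oplus> \<one>)) \<oplus> \<one>"
    using q unfolding r modulus_def by (simp add: distrib2 add_assoc)
  then have "\<zero> = r \<otimes> modulus m j \<oplus> m \<otimes> (j \<oplus> \<one>)" by (simp only: succ_inj)
  then have "m \<otimes> j = \<zero> \<and> m = \<zero>" using distrib by (metis add_eq_0 mult_1_right)
  then show False using m(2) by blast
qed

text \<open>The product of the moduli with index in \<open>P\<close> is built by induction on the number \<open>c\<close> of indices
  that have been treated; by coprimality each new factor changes the divisors at its own index only.\<close>

lemma beta_function:
  assumes P: "definable (\<lambda>e S. P (e 0))"
  shows "\<exists>n. \<forall>j. j \<prec> b \<longrightarrow> (divides (modulus m j) n \<longleftrightarrow> P j)"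
proof -
  have "le c b \<longrightarrow> (\<exists>n. \<forall>j. j \<prec> b \<longrightarrow> (divides (modulus m j) n \<longleftrightarrow> P j \<and> j \<prec> c))" (is "?R c") for c
  proof (rule arithmetical_induct[where P="?R"])
    show "definable (\<lambda>e S. ?R (e 0))"
      unfolding le_def modulus_def by (intro definableI P)
    show "?R \<zero>"
      using modulus_not_one by auto
    fix c assume IH: "?R c"
    show "?R (c \<oplus> \<one>)"
    proof
      assume "le (c \<oplus> \<one>) b"
      then have c: "c \<prec> b" by (simp add: succ_le)
      then obtain n where n: "\<And>j. j \<prec> b \<Longrightarrow> divides (modulus m j) n \<longleftrightarrow> P j \<and> j \<prec> c" using IH unfolding le_def by blast
      show "\<exists>n. \<forall>j. j \<prec> b \<longrightarrow> (divides (modulus m j) n \<longleftrightarrow> P j \<and> j \<prec> c \<oplus> \<one>)"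
      proof (cases "P c")
        case True
        have "divides (modulus m j) (n \<otimes> modulus m c) \<longleftrightarrow> P j \<and> j \<prec> c \<oplus> \<one>" if j: "j \<prec> b" for j
        proof (cases "j = c")
          case True then show ?thesis using \<open>P c\<close> by (auto simp: divides_def)
        next
          case False
          then have "divides (modulus m j) (n \<otimes> modulus m c) \<longleftrightarrow> divides (modulus m j) n"
            using modulus_coprime[of j n c] divides_mult c j by blast
          then show ?thesis using n j False less_succ by blast
        qed
        then show ?thesis by blast
      next
        case False
        then show ?thesis using n less_succ by metis
      qed
    qed
  qed
  from this[of b] show ?thesis by (metis le_refl)
qed

end

definition coded_finite :: "'a set \<Rightarrow> bool" where "coded_finite F \<longleftrightarrow> (\<exists>k m n. F = fset M k m n)"

text \<open>All certificates are obtained from this lemma, by an arithmetical definition of the bounded set of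
  their members.\<close>

lemma bounded_fin:
  assumes P: "definable (\<lambda>e S. P (e 0))" and b: "\<And>x. P x \<Longrightarrow> x \<prec> b"
  shows "coded_finite {x. P x}"
proof -
  obtain m where m: "m \<noteq> \<zero>" "\<forall>j. j \<prec> b \<longrightarrow> divides (j \<oplus> \<one>) m" using multiple_exists by blast
  have "\<exists>n. \<forall>j. j \<prec> b \<longrightarrow> (divides (modulus m j) n \<longleftrightarrow> P j)"
    by (rule beta_function) (use m P in auto)
  then obtain n where "\<forall>j. j \<prec> b \<longrightarrow> (divides (m \<otimes> (j \<oplus> \<one>) \<oplus> \<one>) n \<longleftrightarrow> P j)"
    using m by (auto simp: modulus_def)
  then have "{x. P x} = fset M b m n"
    using b unfolding fset_def divides_def by blast
  then show ?thesis unfolding coded_finite_def by blast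
qed

lemma fset_bound: "x \<in> fset M k m n \<Longrightarrow> x \<prec> k" by (simp add: fset_def)

lemma definable_mem_fset [definableI]:
  "polynomial t \<Longrightarrow> polynomial k \<Longrightarrow> polynomial m \<Longrightarrow> polynomial n \<Longrightarrow> definable (\<lambda>e S. t e \<in> fset M (k e) (m e) (n e))"
  unfolding fset_def mem_Collect_eq by (intro definableI polynomial_shift)

lemma fset_sets [definableI]: "fset M k m n \<in> sets M"
  unfolding fset_def by (rule arithmetical_comprehension) (intro definableI)

lemma coded_finite_bound: "coded_finite F \<Longrightarrow> \<exists>b. \<forall>x\<in>F. x \<prec> b" unfolding coded_finite_def using fset_bound by blast

lemma coded_finite_sets: "coded_finite F \<Longrightarrow> F \<in> sets M" unfolding coded_finite_def using fset_sets by blast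

lemma coded_finite_un: assumes "coded_finite F" "coded_finite G" shows "coded_finite (F \<union> G)"
proof -
  obtain b c where b: "\<forall>x\<in>F. x \<prec> b" "\<forall>x\<in>G. x \<prec> c" using coded_finite_bound assms by blast
  have "coded_finite {x. x \<in> F \<or> x \<in> G}"
  proof (rule bounded_fin[where b="b \<oplus> c"])
    show "definable (\<lambda>e S. e 0 \<in> F \<or> e 0 \<in> G)" by (intro definableI coded_finite_sets assms)
    show "x \<prec> b \<oplus> c" if "x \<in> F \<or> x \<in> G" for x
      using that b le_add lo.less_le_trans by blast
  qed
  then show ?thesis by (simp add: Un_def)
qed

lemma coded_finite_empty: "coded_finite {}"
  using bounded_fin[of "\<lambda>x. False" \<zero>] by (simp add: definable_const)

lemma coded_finite_sing: "coded_finite {a}"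
  using bounded_fin[of "\<lambda>x. x = a" "a \<oplus> \<one>"] by (simp add: definable_eq polynomial_var polynomial_const)

section \<open>Certificates of inductive definitions\<close>

lemma derivable_fin:
  "derivable M \<Phi> a \<longleftrightarrow> (\<exists>F. coded_finite F \<and> a \<in> F \<and> (\<forall>x\<in>F. \<Phi> F x))"
  unfolding derivable_def coded_finite_def by blast

lemma derivable_close:
  assumes mono: "\<And>F G x. F \<subseteq> G \<Longrightarrow> \<Phi> F x \<Longrightarrow> \<Phi> G x" and "coded_finite F" "\<And>x. x \<in> F \<Longrightarrow> \<Phi> F x" "\<Phi> F a"
  shows "derivable M \<Phi> a"
  unfolding derivable_fin
proof (intro exI[of _ "F \<union> {a}"] conjI ballI)
  show "coded_finite (F \<union> {a})" by (intro coded_finite_un coded_finite_sing assms)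
  show "\<Phi> (F \<union> {a}) x" if "x \<in> F \<union> {a}" for x
    by (rule mono[of F]) (use that assms in auto)
qed simp

text \<open>The union of certificates is a certificate, by monotonicity of the clauses.\<close>

lemma derivable_finite_support:
  assumes mono: "\<And>F G x. F \<subseteq> G \<Longrightarrow> \<Phi> F x \<Longrightarrow> \<Phi> G x" and "finite S" "S \<subseteq> Collect (derivable M \<Phi>)"
  shows "\<exists>F. coded_finite F \<and> S \<subseteq> F \<and> (\<forall>x\<in>F. \<Phi> F x)"
  using assms(2,3)
proof (induction rule: finite_induct)
  case empty then show ?case using coded_finite_empty by blast
next
  case (insert a S)
  obtain F where F: "coded_finite F" "S \<subseteq> F" "\<forall>x\<in>F. \<Phi> F x" using insert by auto
  obtain G where G: "coded_finite G" "a \<in> G" "\<forall>x\<in>G. \<Phi> G x" using insert.prems unfolding derivable_fin by auto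
  have "\<forall>x\<in>F \<union> G. \<Phi> (F \<union> G) x" using F(3) G(3) mono by (metis Un_iff Un_upper1 Un_upper2)
  then show ?case using coded_finite_un F G by (metis UnCI Un_mono insert_subset le_supI1)
qed

lemma derivable_mono_unfold:
  assumes mono: "\<And>F G x. F \<subseteq> G \<Longrightarrow> \<Phi> F x \<Longrightarrow> \<Phi> G x" and "derivable M \<Phi> x"
  shows "\<Phi> (Collect (derivable M \<Phi>)) x"
proof -
  obtain F where F: "coded_finite F" "x \<in> F" "\<forall>x\<in>F. \<Phi> F x" using assms(2) unfolding derivable_fin by blast
  then have "F \<subseteq> Collect (derivable M \<Phi>)" unfolding derivable_fin by blast
  then show ?thesis using mono F by blast
qed

text \<open>For inversion, the certificate of \<open>x\<close> contains all premises of \<open>x\<close>; for closure, the certificates of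
  the finitely many premises of \<open>x\<close> are united and extended by \<open>x\<close>.\<close>

lemma derivable_iff:
  assumes "\<And>x. finitary (\<lambda>F. \<Phi> F x)"
  shows "derivable M \<Phi> x \<longleftrightarrow> \<Phi> (Collect (derivable M \<Phi>)) x"
proof
  have mono: "\<And>F G x. F \<subseteq> G \<Longrightarrow> \<Phi> F x \<Longrightarrow> \<Phi> G x" using finitary_mono[OF assms] by blast
  show "\<Phi> (Collect (derivable M \<Phi>)) x" if "derivable M \<Phi> x"
    using mono that by (rule derivable_mono_unfold)
  show "derivable M \<Phi> x" if x: "\<Phi> (Collect (derivable M \<Phi>)) x"
  proof -
    obtain S where S: "S \<subseteq> Collect (derivable M \<Phi>)" "finite S" "\<Phi> S x"
      using finitary_support[OF assms x] .
    have "\<exists>F. coded_finite F \<and> S \<subseteq> F \<and> (\<forall>x\<in>F. \<Phi> F x)"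
      by (rule derivable_finite_support) (use S mono in blast)+
    then obtain F where F: "coded_finite F" "S \<subseteq> F" "\<forall>x\<in>F. \<Phi> F x" by blast
    show ?thesis
      by (rule derivable_close[where F=F]) (use F S mono in blast)+
  qed
qed

lemma definable_derivable [definableI]:
  assumes "definable (\<lambda>e S. \<exists>k m n. a e \<in> fset M k m n \<and> (\<forall>x\<in>fset M k m n. \<Phi> e S (fset M k m n) x))"
  shows "definable (\<lambda>e S. derivable M (\<Phi> e S) (a e))"
  unfolding derivable_def by fact

text \<open>A substitute for \<open>derivable_finite_support\<close> when the number of premises is a number of \<open>M\<close>: the
  certificates for \<open>i < b\<close> are collected into a single one by induction on \<open>b\<close>. The premise
  for \<open>i\<close> is given by a relation \<open>Q i\<close>, and indices without a derivable premise are skipped.\<close>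

lemma derivable_collect:
  assumes mono: "\<And>F G x. F \<subseteq> G \<Longrightarrow> \<Phi> F x \<Longrightarrow> \<Phi> G x"
    and d: "definable (\<lambda>e S. \<Phi> (fset M (e (Suc (Suc (Suc 0)))) (e (Suc (Suc 0))) (e (Suc 0))) (e 0))"
    and Q: "definable (\<lambda>e S. Q (e (Suc 0)) (e 0))"
  shows "\<exists>F. coded_finite F \<and> (\<forall>x\<in>F. \<Phi> F x) \<and> (\<forall>i. i \<prec> b \<longrightarrow> (\<exists>z. Q i z \<and> derivable M \<Phi> z) \<longrightarrow> (\<exists>z\<in>F. Q i z))"
proof -
  define D where "D = {x. derivable M \<Phi> x}"
  have D: "D \<in> sets M" unfolding D_def
    by (rule arithmetical_comprehension) (intro definableI d)
  have "\<exists>k m n. (\<forall>x\<in>fset M k m n. \<Phi> (fset M k m n) x) \<and>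
     (\<forall>i. (\<exists>z. Q i z \<and> z \<in> D) \<longrightarrow> i \<prec> b \<longrightarrow> (\<exists>z. Q i z \<and> z \<in> fset M k m n))" (is "?R b")
  proof (rule arithmetical_induct[where P="?R"])
    show "definable (\<lambda>e S. ?R (e 0))"
      by (intro definableI d Q D)
    obtain k m n where "{} = fset M k m n" using coded_finite_empty unfolding coded_finite_def by blast
    then show "?R \<zero>"
      by (metis ball_empty not_less_0)
    fix b assume "?R b"
    then obtain F where F: "coded_finite F" "\<forall>x\<in>F. \<Phi> F x"
      "\<And>i. (\<exists>z. Q i z \<and> z \<in> D) \<Longrightarrow> i \<prec> b \<Longrightarrow> (\<exists>z. Q i z \<and> z \<in> F)"
      unfolding coded_finite_def by blast
    have "\<exists>G. coded_finite G \<and> (\<forall>x\<in>G. \<Phi> G x) \<and> ((\<exists>z. Q b z \<and> z \<in> D) \<longrightarrow> (\<exists>z. Q b z \<and> z \<in> G))"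
    proof (cases "\<exists>z. Q b z \<and> z \<in> D")
      case True
      then show ?thesis unfolding D_def mem_Collect_eq derivable_fin by blast
    next
      case False
      then show ?thesis using coded_finite_empty by blast
    qed
    then obtain G where G: "coded_finite G" "\<forall>x\<in>G. \<Phi> G x" "(\<exists>z. Q b z \<and> z \<in> D) \<longrightarrow> (\<exists>z. Q b z \<and> z \<in> G)"
      by blast
    have "\<forall>x\<in>F \<union> G. \<Phi> (F \<union> G) x" using F(2) G(2) mono by (metis Un_iff Un_upper1 Un_upper2)
    moreover have "\<exists>z. Q i z \<and> z \<in> F \<union> G" if "\<exists>z. Q i z \<and> z \<in> D" "i \<prec> b \<oplus> \<one>" for i
      using F(3) G(3) that less_succ by blast
    moreover obtain k m n where "F \<union> G = fset M k m n" using coded_finite_un[OF F(1) G(1)] unfolding coded_finite_def by blast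
    ultimately show "?R (b \<oplus> \<one>)" by metis
  qed
  then obtain k m n where "(\<forall>x\<in>fset M k m n. \<Phi> (fset M k m n) x)"
     "(\<forall>i. (\<exists>z. Q i z \<and> z \<in> D) \<longrightarrow> i \<prec> b \<longrightarrow> (\<exists>z. Q i z \<and> z \<in> fset M k m n))" by blast
  then show ?thesis unfolding D_def
    by (intro exI[of _ "fset M k m n"]) (auto simp: coded_finite_def)
qed

section \<open>Pairing\<close>

lemma pr_less: assumes "x \<oplus> y \<prec> x' \<oplus> y'" shows "pr M x y \<prec> pr M x' y'"
proof -
  obtain d where d: "x' \<oplus> y' = (x \<oplus> y) \<oplus> (d \<oplus> \<one>)" using assms unfolding less_iff by blast
  \<comment> \<open>With \<open>s = x + y\<close>, the square of \<open>s + d + 1\<close> exceeds \<open>s\<^sup>2 + s\<close>, hence \<open>s\<^sup>2 + x\<close>.\<close>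
  have "pr M x' y' = pr M x y \<oplus> (((x \<oplus> y) \<otimes> (d \<oplus> d) \<oplus> d \<otimes> d \<oplus> d \<oplus> d \<oplus> x \<oplus> y \<oplus> y \<oplus> x') \<oplus> \<one>)"
    unfolding pr_def d by (simp only: ring mult_1 mult_1_right)
  then show ?thesis unfolding less_iff by blast
qed

lemma pr_inject [simp]: "pr M x y = pr M x' y' \<longleftrightarrow> x = x' \<and> y = y'"
proof
  assume e: "pr M x y = pr M x' y'"
  then have s: "x \<oplus> y = x' \<oplus> y'" using pr_less linear less_irrefl by metis
  then have "x = x'" using e unfolding pr_def by simp
  then show "x = x' \<and> y = y'" using s by simp
qed simp

lemma square_ge: "le x (x \<otimes> x)"
  using zero_or_succ[of x] by (auto simp: distrib distrib2)

lemma pr_ge: "le (x \<oplus> y) (pr M x y)"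
  unfolding pr_def using square_ge le_add lo.order.trans by blast

lemma num_inj [simp]: "num M k = num M l \<longleftrightarrow> k = l"
proof (induction k arbitrary: l)
  case 0 show ?case by (cases l) auto
next
  case (Suc k) show ?case by (cases l) (auto simp: Suc)
qed

lemma node_inject [simp]: "node M k x y = node M k' x' y' \<longleftrightarrow> k = k' \<and> x = x' \<and> y = y'"
  by (simp add: node_def)

text \<open>Hence subexpressions have smaller codes, which makes induction on codes possible. That even the sum
  is smaller is used for the induction in \<open>deterministic\<close>.\<close>

lemma node_gt: assumes "k \<noteq> 0" shows "x \<oplus> y \<prec> node M k x y"
proof -
  obtain j where j: "k = Suc j" using assms by (cases k) auto
  obtain u where u: "pr M x y = (x \<oplus> y) \<oplus> u" using pr_ge[of x y] unfolding le_iff by blast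
  obtain v where v: "(num M k \<oplus> pr M x y) \<otimes> (num M k \<oplus> pr M x y) = (num M k \<oplus> pr M x y) \<oplus> v"
    using square_ge unfolding le_iff by blast
  have "node M k x y = (x \<oplus> y) \<oplus> ((u \<oplus> v \<oplus> num M k \<oplus> num M j) \<oplus> \<one>)"
    unfolding node_def pr_def[of M "num M k"] v unfolding u j num.simps by (simp only: add_ac)
  then show ?thesis unfolding less_iff by blast
qed

lemma node_gt1 [simp]: "k \<noteq> 0 \<Longrightarrow> x \<prec> node M k x y"
  using node_gt le_add lo.le_less_trans by blast

lemma node_gt2 [simp]: "k \<noteq> 0 \<Longrightarrow> y \<prec> node M k x y"
  using node_gt le_add lo.le_less_trans by blast

lemma polynomial_pr [definableI]: "polynomial s \<Longrightarrow> polynomial t \<Longrightarrow> polynomial (\<lambda>e. pr M (s e) (t e))"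
  unfolding pr_def by (intro definableI)

lemma polynomial_node [definableI]: "polynomial s \<Longrightarrow> polynomial t \<Longrightarrow> polynomial (\<lambda>e. node M k (s e) (t e))"
  unfolding node_def by (intro definableI)

section \<open>Computations relative to a tree of oracles\<close>

lemmas program_defs = p_zero_def p_succ_def p_id_def p_fst_def p_snd_def p_oracle_def p_pair_def p_comp_def p_rec_def p_mu_def

lemma polynomial_programs [definableI]:
  "polynomial s \<Longrightarrow> polynomial t \<Longrightarrow> polynomial (\<lambda>e. p_pair M (s e) (t e))"
  "polynomial s \<Longrightarrow> polynomial t \<Longrightarrow> polynomial (\<lambda>e. p_comp M (s e) (t e))"
  "polynomial s \<Longrightarrow> polynomial t \<Longrightarrow> polynomial (\<lambda>e. p_rec M (s e) (t e))"
  "polynomial s \<Longrightarrow> polynomial (\<lambda>e. p_mu M (s e))"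
  unfolding program_defs by (intro definableI; assumption)+

text \<open>Oracle trees. The leaves name two given sets \<open>X\<close> and \<open>A\<close>; \<open>tree_join a b\<close> names the join of the
  sets named by \<open>a\<close> and \<open>b\<close>; \<open>tree_comp d a\<close> names the set computed by the program \<open>d\<close> from the
  set named by \<open>a\<close>.\<close>

definition tree_X :: 'a where "tree_X = node M 1 \<zero> \<zero>"
definition tree_A :: 'a where "tree_A = node M 2 \<zero> \<zero>"
definition tree_join :: "'a \<Rightarrow> 'a \<Rightarrow> 'a" where "tree_join a b = node M 3 a b"
definition tree_comp :: "'a \<Rightarrow> 'a \<Rightarrow> 'a" where "tree_comp d a = node M 4 d a"
lemmas tree_defs = tree_X_def tree_A_def tree_join_def tree_comp_def

lemma polynomial_trees [definableI]:
  "polynomial s \<Longrightarrow> polynomial t \<Longrightarrow> polynomial (\<lambda>e. tree_join (s e) (t e))"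
  "polynomial s \<Longrightarrow> polynomial t \<Longrightarrow> polynomial (\<lambda>e. tree_comp (s e) (t e))"
  unfolding tree_defs by (intro definableI; assumption)+

text \<open>Answers \<open>y\<close> to the query \<open>x\<close> at the tree \<open>s\<close>. In this and the following clauses \<open>P\<close> stands for
  the results that are already available.\<close>

definition oracle_clause :: "'a set \<Rightarrow> 'a set \<Rightarrow> ('a \<Rightarrow> 'a \<Rightarrow> 'a \<Rightarrow> 'a \<Rightarrow> bool) \<Rightarrow> 'a \<Rightarrow> 'a \<Rightarrow> 'a \<Rightarrow> bool" where
  "oracle_clause X A P s x y \<longleftrightarrow>
     s = tree_X \<and> (x \<in> X \<and> y = \<one> \<or> x \<notin> X \<and> y = \<zero>) \<or>
     s = tree_A \<and> (x \<in> A \<and> y = \<one> \<or> x \<notin> A \<and> y = \<zero>) \<or>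
     (\<exists>a b w. s = tree_join a b \<and> x = (\<one> \<oplus> \<one>) \<otimes> w \<and> P a (p_oracle M) w y) \<or>
     (\<exists>a b w. s = tree_join a b \<and> x = (\<one> \<oplus> \<one>) \<otimes> w \<oplus> \<one> \<and> P b (p_oracle M) w y) \<or>
     (\<exists>d a. s = tree_comp d a \<and> P a d x y)"

text \<open>The clauses for programs other than oracle queries and unbounded search. They are shared by
  the computations of the theory and those relative to a tree, which makes the simulation of
  the former by the latter a matter of relabelling.\<close>

definition program_clause :: "('a \<Rightarrow> 'a \<Rightarrow> 'a \<Rightarrow> bool) \<Rightarrow> 'a \<Rightarrow> 'a \<Rightarrow> 'a \<Rightarrow> bool" where
  "program_clause P e x y \<longleftrightarrow>
      (e = p_zero M \<and> y = \<zero> \<or>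
       e = p_succ M \<and> y = x \<oplus> \<one> \<or>
       e = p_id M \<and> y = x \<or>
       e = p_fst M \<and> (\<exists>w. x = pr M y w) \<or>
       e = p_snd M \<and> (\<exists>w. x = pr M w y) \<or>
       (\<exists>f g u v. e = p_pair M f g \<and> y = pr M u v \<and> P f x u \<and> P g x v) \<or>
       (\<exists>f g u. e = p_comp M f g \<and> P g x u \<and> P f u y) \<or>
       (\<exists>f g a. e = p_rec M f g \<and> x = pr M a \<zero> \<and> P f a y) \<or>
       (\<exists>f g a n u. e = p_rec M f g \<and> x = pr M a (n \<oplus> \<one>) \<and>
          P e (pr M a n) u \<and> P g (pr M a (pr M n u)) y))"

definition search_clause :: "('a \<Rightarrow> 'a \<Rightarrow> 'a \<Rightarrow> bool) \<Rightarrow> 'a \<Rightarrow> 'a \<Rightarrow> 'a \<Rightarrow> bool" where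
  "search_clause P e x y \<longleftrightarrow> (\<exists>f. e = p_mu M f \<and> P f (pr M x y) \<zero> \<and>
          (\<forall>n. n \<prec> y \<longrightarrow> (\<exists>u. u \<noteq> \<zero> \<and> P f (pr M x n) u)))"

text \<open>The tree is a component of the derived objects: the certificate of a computation at \<open>s\<close> contains
  the computations at subtrees of \<open>s\<close> that answer its queries.\<close>

definition tree_clause :: "'a set \<Rightarrow> 'a set \<Rightarrow> 'a set \<Rightarrow> 'a \<Rightarrow> bool" where
  "tree_clause X A F c \<longleftrightarrow> (\<exists>s e x y. c = pr M s (pr M e (pr M x y)) \<and>
     (e = p_oracle M \<and> oracle_clause X A (\<lambda>s e x y. pr M s (pr M e (pr M x y)) \<in> F) s x y \<or>
      program_clause (\<lambda>e x y. pr M s (pr M e (pr M x y)) \<in> F) e x y \<or>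
      search_clause (\<lambda>e x y. pr M s (pr M e (pr M x y)) \<in> F) e x y))"

definition tree_computes :: "'a set \<Rightarrow> 'a set \<Rightarrow> 'a \<Rightarrow> 'a \<Rightarrow> 'a \<Rightarrow> 'a \<Rightarrow> bool" where
  "tree_computes X A s e x y \<longleftrightarrow> derivable M (tree_clause X A) (pr M s (pr M e (pr M x y)))"

definition computes_clause :: "'a set \<Rightarrow> 'a set \<Rightarrow> 'a \<Rightarrow> bool" where
  "computes_clause Z F c \<longleftrightarrow> (\<exists>e x y. c = pr M e (pr M x y) \<and>
     (e = p_oracle M \<and> (x \<in> Z \<and> y = \<one> \<or> x \<notin> Z \<and> y = \<zero>) \<or>
      program_clause (\<lambda>e x y. pr M e (pr M x y) \<in> F) e x y \<or>
      search_clause (\<lambda>e x y. pr M e (pr M x y) \<in> F) e x y))"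

lemma computes_alt: "computes M Z e x y \<longleftrightarrow> derivable M (computes_clause Z) (pr M e (pr M x y))"
  unfolding computes_def computes_clause_def program_clause_def search_clause_def
  by (rule arg_cong[where f="\<lambda>\<Phi>. derivable M \<Phi> (pr M e (pr M x y))"])
    (intro ext arg_cong[where f=Ex] conj_cong refl, argo)

lemma program_clause_intros:
  "program_clause P (p_zero M) x \<zero>"
  "program_clause P (p_succ M) x (x \<oplus> \<one>)"
  "program_clause P (p_id M) x x"
  "program_clause P (p_fst M) (pr M y w) y"
  "program_clause P (p_snd M) (pr M w y) y"
  "P f x u \<Longrightarrow> P g x v \<Longrightarrow> program_clause P (p_pair M f g) x (pr M u v)"
  "P g x u \<Longrightarrow> P f u y \<Longrightarrow> program_clause P (p_comp M f g) x y"
  "P f a y \<Longrightarrow> program_clause P (p_rec M f g) (pr M a \<zero>) y"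
  "P (p_rec M f g) (pr M a n) u \<Longrightarrow> P g (pr M a (pr M n u)) y \<Longrightarrow> program_clause P (p_rec M f g) (pr M a (n \<oplus> \<one>)) y"
  unfolding program_clause_def by (simp_all add: program_defs) blast+

lemma program_clause_cases [consumes 1, case_names zero succ id fst snd pair comp rec0 recS]:
  assumes "program_clause P e x y"
  obtains "e = p_zero M" "y = \<zero>"
  | "e = p_succ M" "y = x \<oplus> \<one>"
  | "e = p_id M" "y = x"
  | w where "e = p_fst M" "x = pr M y w"
  | w where "e = p_snd M" "x = pr M w y"
  | f g u v where "e = p_pair M f g" "y = pr M u v" "P f x u" "P g x v"
  | f g u where "e = p_comp M f g" "P g x u" "P f u y"
  | f g a where "e = p_rec M f g" "x = pr M a \<zero>" "P f a y"
  | f g a n u where "e = p_rec M f g" "x = pr M a (n \<oplus> \<one>)" "P (p_rec M f g) (pr M a n) u" "P g (pr M a (pr M n u)) y"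
  using assms unfolding program_clause_def by (elim disjE exE conjE; simp)

lemma oracle_clause_mono: "oracle_clause X A P s x y \<Longrightarrow> (\<And>s e x y. P s e x y \<Longrightarrow> Q s e x y) \<Longrightarrow> oracle_clause X A Q s x y"
  unfolding oracle_clause_def by blast

lemma program_clause_mono: "program_clause P e x y \<Longrightarrow> (\<And>e x y. P e x y \<Longrightarrow> Q e x y) \<Longrightarrow> program_clause Q e x y"
  by (erule program_clause_cases) (blast intro: program_clause_intros)+

lemma search_clause_mono: "search_clause P e x y \<Longrightarrow> (\<And>e x y. P e x y \<Longrightarrow> Q e x y) \<Longrightarrow> search_clause Q e x y"
  unfolding search_clause_def by blast

lemma tree_clause_mono: assumes "F \<subseteq> G" "tree_clause X A F c" shows "tree_clause X A G c"
proof -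
  obtain s e x y where c: "c = pr M s (pr M e (pr M x y))" and
    d: "e = p_oracle M \<and> oracle_clause X A (\<lambda>s e x y. pr M s (pr M e (pr M x y)) \<in> F) s x y \<or>
      program_clause (\<lambda>e x y. pr M s (pr M e (pr M x y)) \<in> F) e x y \<or>
      search_clause (\<lambda>e x y. pr M s (pr M e (pr M x y)) \<in> F) e x y"
    using assms(2) unfolding tree_clause_def by blast
  have 1: "oracle_clause X A (\<lambda>s e x y. pr M s (pr M e (pr M x y)) \<in> F) s x y \<Longrightarrow>
      oracle_clause X A (\<lambda>s e x y. pr M s (pr M e (pr M x y)) \<in> G) s x y"
    by (erule oracle_clause_mono) (rule subsetD[OF assms(1)])
  have 2: "program_clause (\<lambda>e x y. pr M s (pr M e (pr M x y)) \<in> F) e x y \<Longrightarrow>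
      program_clause (\<lambda>e x y. pr M s (pr M e (pr M x y)) \<in> G) e x y"
    by (erule program_clause_mono) (rule subsetD[OF assms(1)])
  have 3: "search_clause (\<lambda>e x y. pr M s (pr M e (pr M x y)) \<in> F) e x y \<Longrightarrow>
      search_clause (\<lambda>e x y. pr M s (pr M e (pr M x y)) \<in> G) e x y"
    by (erule search_clause_mono) (rule subsetD[OF assms(1)])
  show ?thesis unfolding tree_clause_def
    by (intro exI[of _ s] exI[of _ e] exI[of _ x] exI[of _ y] conjI c)
      (use d 1 2 3 in argo)
qed

lemma definable_tree_clause [definableI]:
  assumes "X \<in> sets M" "A \<in> sets M"
    "polynomial t" "polynomial k" "polynomial m" "polynomial n"
  shows "definable (\<lambda>e S. tree_clause X A (fset M (k e) (m e) (n e)) (t e))"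
  unfolding tree_clause_def oracle_clause_def program_clause_def search_clause_def by (intro definableI polynomial_shift assms)

lemma definable_tree_computes [definableI]:
  assumes "X \<in> sets M" "A \<in> sets M" "polynomial s" "polynomial p" "polynomial x" "polynomial y"
  shows "definable (\<lambda>e S. tree_computes X A (s e) (p e) (x e) (y e))"
  unfolding tree_computes_def tree_clause_def oracle_clause_def program_clause_def search_clause_def by (intro definableI polynomial_shift assms)

lemma tree_computes_dest: assumes "tree_computes X A s e x y"
  shows "e = p_oracle M \<and> oracle_clause X A (tree_computes X A) s x y \<or> program_clause (tree_computes X A s) e x y \<or> search_clause (tree_computes X A s) e x y"
proof -
  have "tree_clause X A (Collect (derivable M (tree_clause X A))) (pr M s (pr M e (pr M x y)))"
    by (rule derivable_mono_unfold) (erule (1) tree_clause_mono, rule assms[unfolded tree_computes_def])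
  then show ?thesis
    unfolding tree_clause_def[of X A "Collect _"] mem_Collect_eq pr_inject tree_computes_def[symmetric] by blast
qed

lemma tree_computes_close: assumes "coded_finite F" "\<And>z. z \<in> F \<Longrightarrow> tree_clause X A F z"
    "e = p_oracle M \<and> oracle_clause X A (\<lambda>s e x y. pr M s (pr M e (pr M x y)) \<in> F) s x y \<or>
      program_clause (\<lambda>e x y. pr M s (pr M e (pr M x y)) \<in> F) e x y \<or>
      search_clause (\<lambda>e x y. pr M s (pr M e (pr M x y)) \<in> F) e x y"
  shows "tree_computes X A s e x y"
  unfolding tree_computes_def
proof (rule derivable_close[where F=F])
  show "tree_clause X A F (pr M s (pr M e (pr M x y)))"
    unfolding tree_clause_def[of X A F] using assms(3) by blast
qed (use assms(1,2) tree_clause_mono in blast)+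

text \<open>At most one premise is used, so its certificate can be extended.\<close>

lemma oracle_clause_closed: assumes "oracle_clause X A (tree_computes X A) s x y" shows "tree_computes X A s (p_oracle M) x y"
proof -
  have "oracle_clause X A (\<lambda>_ _ _ _. False) s x y \<or> (\<exists>s' e' x' y'. tree_computes X A s' e' x' y' \<and>
      oracle_clause X A (\<lambda>a b c d. (a,b,c,d) = (s',e',x',y')) s x y)"
    using assms unfolding oracle_clause_def by (elim disjE) (simp_all, blast+)
  then show ?thesis
  proof (elim disjE exE conjE)
    assume "oracle_clause X A (\<lambda>_ _ _ _. False) s x y"
    then have "oracle_clause X A (\<lambda>s e x y. pr M s (pr M e (pr M x y)) \<in> {}) s x y" by (rule oracle_clause_mono) simp
    then show ?thesis by (intro tree_computes_close[of "{}"]) (auto simp: coded_finite_empty)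
  next
    fix s' e' x' y' assume 1: "tree_computes X A s' e' x' y'" "oracle_clause X A (\<lambda>a b c d. (a,b,c,d) = (s',e',x',y')) s x y"
    obtain F where F: "coded_finite F" "\<And>z. z \<in> F \<Longrightarrow> tree_clause X A F z" "pr M s' (pr M e' (pr M x' y')) \<in> F"
      using 1(1) unfolding tree_computes_def derivable_fin by blast
    have "oracle_clause X A (\<lambda>s e x y. pr M s (pr M e (pr M x y)) \<in> F) s x y"
      using 1(2) by (rule oracle_clause_mono) (use F(3) in simp)
    then show ?thesis by (intro tree_computes_close[of F] F(1,2)) simp_all
  qed
qed

text \<open>A certificate for \<open>Y\<close> is turned into one for the tree by attaching \<open>a\<close> to all its members and
  adding certificates for the finitely many oracle queries that it contains, which exist because
  \<open>a\<close> decides \<open>Y\<close>.\<close>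

lemma computes_simulation:
  assumes XA: "X \<in> sets M" "A \<in> sets M"
    and dec: "\<And>x. x \<in> Y \<Longrightarrow> tree_computes X A a (p_oracle M) x \<one>" "\<And>x. x \<notin> Y \<Longrightarrow> tree_computes X A a (p_oracle M) x \<zero>"
    and "computes M Y e x y"
  shows "tree_computes X A a e x y"
proof -
  obtain F where F: "coded_finite F" "pr M e (pr M x y) \<in> F" "\<And>z. z \<in> F \<Longrightarrow> computes_clause Y F z"
    using assms(5) unfolding computes_alt derivable_fin by blast
  obtain k where k: "\<And>z. z \<in> F \<Longrightarrow> z \<prec> k" using coded_finite_bound[OF F(1)] by blast
  \<comment> \<open>\<open>E\<close> holds certificates for whatever is derivable at \<open>a\<close> below \<open>k\<close>, in particular for the answers to all queries in \<open>F\<close>.\<close>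
  have "\<exists>E. coded_finite E \<and> (\<forall>z\<in>E. tree_clause X A E z) \<and>
     (\<forall>i. i \<prec> k \<longrightarrow> (\<exists>z. z = pr M a i \<and> derivable M (tree_clause X A) z) \<longrightarrow> (\<exists>z\<in>E. z = pr M a i))"
    by (rule derivable_collect) (erule (1) tree_clause_mono, (intro definableI XA)+)
  then obtain E where E: "coded_finite E" "\<And>z. z \<in> E \<Longrightarrow> tree_clause X A E z"
    "\<And>i. i \<prec> k \<Longrightarrow> derivable M (tree_clause X A) (pr M a i) \<Longrightarrow> pr M a i \<in> E" by blast
  \<comment> \<open>The relabelled certificate.\<close>
  define I where "I = {z. \<exists>c. z = pr M a c \<and> c \<in> F}"
  have "coded_finite I" unfolding I_def
  proof (rule bounded_fin[where b="pr M a k"])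
    show "definable (\<lambda>e S. \<exists>c. e 0 = pr M a c \<and> c \<in> F)" by (intro definableI coded_finite_sets F)
    show "z \<prec> pr M a k" if zc: "\<exists>c. z = pr M a c \<and> c \<in> F" for z
    proof -
      obtain c where c: "z = pr M a c" "c \<prec> k" using zc k by blast
      have "a \<oplus> c \<prec> a \<oplus> k" using add_less_mono[OF c(2) le_refl[of a]] by (simp only: add_comm)
      then show ?thesis unfolding c(1) by (rule pr_less)
    qed
  qed
  then have coded_finite: "coded_finite (I \<union> E)" using E(1) by (rule coded_finite_un)
  have "tree_clause X A (I \<union> E) z" if z: "z \<in> I \<union> E" for z
  proof (cases "z \<in> E")
    case True then show ?thesis using E(2) tree_clause_mono by blast
  next
    case False
    then obtain c where c: "z = pr M a c" "c \<in> F" using z unfolding I_def by blast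
    obtain e x y where exy: "c = pr M e (pr M x y)" and
     d: "e = p_oracle M \<and> (x \<in> Y \<and> y = \<one> \<or> x \<notin> Y \<and> y = \<zero>) \<or>
      program_clause (\<lambda>e x y. pr M e (pr M x y) \<in> F) e x y \<or>
      search_clause (\<lambda>e x y. pr M e (pr M x y) \<in> F) e x y"
      using F(3)[OF c(2)] unfolding computes_clause_def by blast
    have sub: "pr M a (pr M e (pr M x y)) \<in> I \<union> E" if "pr M e (pr M x y) \<in> F" for e x y
      using that unfolding I_def by blast
    from d show ?thesis
    proof (elim disjE)
      assume "e = p_oracle M \<and> (x \<in> Y \<and> y = \<one> \<or> x \<notin> Y \<and> y = \<zero>)"
      then have "tree_computes X A a e x y" using dec by blast
      then have "z \<in> E" using E(3) k c exy unfolding tree_computes_def by blast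
      then show ?thesis using False by blast
    next
      assume "program_clause (\<lambda>e x y. pr M e (pr M x y) \<in> F) e x y"
      then have "program_clause (\<lambda>e x y. pr M a (pr M e (pr M x y)) \<in> I \<union> E) e x y"
        by (rule program_clause_mono) (rule sub)
      then show ?thesis unfolding tree_clause_def c(1) exy by blast
    next
      assume "search_clause (\<lambda>e x y. pr M e (pr M x y) \<in> F) e x y"
      then have "search_clause (\<lambda>e x y. pr M a (pr M e (pr M x y)) \<in> I \<union> E) e x y"
        by (rule search_clause_mono) (rule sub)
      then show ?thesis unfolding tree_clause_def c(1) exy by blast
    qed
  qed
  moreover have "pr M a (pr M e (pr M x y)) \<in> I \<union> E" using F(2) unfolding I_def by blast
  ultimately show ?thesis using coded_finite unfolding tree_computes_def derivable_fin by blast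
qed

section \<open>Determinism\<close>

lemma two_mult: "(\<one> \<oplus> \<one>) \<otimes> w = w \<oplus> w" by (simp add: distrib2)

lemma double_less: "w \<prec> v \<Longrightarrow> w \<oplus> w \<oplus> \<one> \<prec> v \<oplus> v"
proof -
  assume "w \<prec> v"
  then obtain d where d: "v = w \<oplus> (d \<oplus> \<one>)" unfolding less_iff by blast
  have "v \<oplus> v = (w \<oplus> w \<oplus> \<one>) \<oplus> ((d \<oplus> d) \<oplus> \<one>)" unfolding d by (simp only: add_ac)
  then show ?thesis unfolding less_iff by blast
qed

lemma double_inj: "w \<oplus> w = v \<oplus> v \<longleftrightarrow> w = v"
  using double_less[of w v] double_less[of v w] linear[of w v] less_irrefl less_trans less_succ_self by metis

text \<open>The queries to a join at even and at odd numbers do not interfere.\<close>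

lemma double_parity: "w \<oplus> w \<noteq> v \<oplus> v \<oplus> \<one>"
proof
  assume e: "w \<oplus> w = v \<oplus> v \<oplus> \<one>"
  consider "w \<prec> v" | "w = v" | "v \<prec> w" using linear by blast
  then show False
  proof cases
    case 1 then show False using double_less[OF 1] e less_succ_self less_trans less_irrefl by metis
  next
    case 2 then show False using e less_succ_self less_irrefl by metis
  next
    case 3 then show False using double_less[OF 3] e less_irrefl by metis
  qed
qed

lemma parity_cases: "\<exists>w. z = w \<oplus> w \<or> z = w \<oplus> w \<oplus> \<one>"
proof (rule arithmetical_induct[where P="\<lambda>z. \<exists>w. z = w \<oplus> w \<or> z = w \<oplus> w \<oplus> \<one>"])
  show "definable (\<lambda>e S. \<exists>w. e 0 = w \<oplus> w \<or> e 0 = w \<oplus> w \<oplus> \<one>)" by (intro definableI)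
  show "\<exists>w. \<zero> = w \<oplus> w \<or> \<zero> = w \<oplus> w \<oplus> \<one>" by (rule exI[of _ \<zero>]) simp
  fix z assume "\<exists>w. z = w \<oplus> w \<or> z = w \<oplus> w \<oplus> \<one>"
  then obtain w where "z = w \<oplus> w \<or> z = w \<oplus> w \<oplus> \<one>" by blast
  then show "\<exists>w. z \<oplus> \<one> = w \<oplus> w \<or> z \<oplus> \<one> = w \<oplus> w \<oplus> \<one>"
  proof
    assume "z = w \<oplus> w \<oplus> \<one>"
    then have "z \<oplus> \<one> = (w \<oplus> \<one>) \<oplus> (w \<oplus> \<one>)" by (simp only: add_ac)
    then show ?thesis by blast
  qed blast
qed

definition deterministic :: "'a set \<Rightarrow> 'a set \<Rightarrow> 'a \<Rightarrow> 'a \<Rightarrow> bool" where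
  "deterministic X A s e \<longleftrightarrow> (\<forall>x y y'. tree_computes X A s e x y \<longrightarrow> tree_computes X A s e x y' \<longrightarrow> y = y')"

lemma deterministicD: "deterministic X A s e \<Longrightarrow> tree_computes X A s e x y \<Longrightarrow> tree_computes X A s e x y' \<Longrightarrow> y = y'"
  unfolding deterministic_def by blast

lemma not_oracle: "\<not> program_clause P (p_oracle M) x y" "\<not> search_clause P (p_oracle M) x y"
  by (auto simp: search_clause_def program_defs elim!: program_clause_cases)

lemma tree_computes_oracle: "tree_computes X A s (p_oracle M) x y \<Longrightarrow> oracle_clause X A (tree_computes X A) s x y"
  using tree_computes_dest not_oracle by blast

lemma oracle_clause_dest:
  "oracle_clause X A P tree_X x y \<Longrightarrow> x \<in> X \<and> y = \<one> \<or> x \<notin> X \<and> y = \<zero>"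
  "oracle_clause X A P tree_A x y \<Longrightarrow> x \<in> A \<and> y = \<one> \<or> x \<notin> A \<and> y = \<zero>"
  "oracle_clause X A P (tree_join a b) (w \<oplus> w) y \<Longrightarrow> P a (p_oracle M) w y"
  "oracle_clause X A P (tree_join a b) (w \<oplus> w \<oplus> \<one>) y \<Longrightarrow> P b (p_oracle M) w y"
  "oracle_clause X A P (tree_comp d a) x y \<Longrightarrow> P a d x y"
  unfolding oracle_clause_def tree_defs two_mult by (simp_all add: double_inj double_parity double_parity[symmetric])

lemma oracle_clause_tree: "oracle_clause X A P s x y \<Longrightarrow> s = tree_X \<or> s = tree_A \<or> (\<exists>a b. s = tree_join a b) \<or> (\<exists>d a. s = tree_comp d a)"
  unfolding oracle_clause_def by blast

text \<open>A query at \<open>s\<close> is answered at a subtree, in the case of \<open>tree_comp d a\<close> by the program \<open>d\<close>. So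
  the sum of tree and program decreases, as it does from a program to its subprograms.\<close>

lemma deterministic_oracle:
  assumes IH: "\<And>s' e'. s' \<oplus> e' \<prec> s \<oplus> p_oracle M \<Longrightarrow> deterministic X A s' e'"
  shows "deterministic X A s (p_oracle M)"
proof -
  have J: "deterministic X A a (p_oracle M) \<and> deterministic X A b (p_oracle M)" if "s = tree_join a b" for a b
  proof -
    have "a \<prec> s" "b \<prec> s" unfolding that tree_defs by simp_all
    then show ?thesis using IH add_less_mono le_refl by blast
  qed
  have C: "deterministic X A a d" if "s = tree_comp d a" for a d
  proof -
    have "d \<oplus> a \<prec> s" unfolding that tree_defs by (rule node_gt) simp
    then have "a \<oplus> d \<prec> s \<oplus> p_oracle M" using le_add lo.less_le_trans add_comm by metis
    then show ?thesis by (rule IH)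
  qed
  show ?thesis unfolding deterministic_def
  proof (intro allI impI)
    fix x y y' assume "tree_computes X A s (p_oracle M) x y" "tree_computes X A s (p_oracle M) x y'"
    then have "oracle_clause X A (tree_computes X A) s x y" "oracle_clause X A (tree_computes X A) s x y'" by (blast dest: tree_computes_oracle)+
    then have o: "oracle_clause X A (tree_computes X A) s x y" "oracle_clause X A (tree_computes X A) s x y'" .
    from oracle_clause_tree[OF o(1)] show "y = y'"
    proof (elim disjE exE)
      assume s: "s = tree_X" then show ?thesis using o[unfolded s, THEN oracle_clause_dest(1)] by blast
    next
      assume s: "s = tree_A" then show ?thesis using o[unfolded s, THEN oracle_clause_dest(2)] by blast
    next
      fix a b assume s: "s = tree_join a b"
      obtain w where w: "x = w \<oplus> w \<or> x = w \<oplus> w \<oplus> \<one>" using parity_cases by blast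
      then show ?thesis
      proof
        assume x: "x = w \<oplus> w"
        show ?thesis by (rule deterministicD[OF conjunct1[OF J[OF s]] o[unfolded s x, THEN oracle_clause_dest(3)]])
      next
        assume x: "x = w \<oplus> w \<oplus> \<one>"
        show ?thesis by (rule deterministicD[OF conjunct2[OF J[OF s]] o[unfolded s x, THEN oracle_clause_dest(4)]])
      qed
    next
      fix d a assume s: "s = tree_comp d a"
      show ?thesis by (rule deterministicD[OF C[OF s] o[unfolded s, THEN oracle_clause_dest(5)]])
    qed
  qed
qed

lemma tree_computes_progD: "tree_computes X A s e x y \<Longrightarrow> e \<noteq> p_oracle M \<Longrightarrow> (\<And>f. e \<noteq> p_mu M f) \<Longrightarrow> program_clause (tree_computes X A s) e x y"
  using tree_computes_dest unfolding search_clause_def by blast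

lemma program_clause_fun:
  "program_clause P (p_zero M) x y \<Longrightarrow> y = \<zero>"
  "program_clause P (p_succ M) x y \<Longrightarrow> y = x \<oplus> \<one>"
  "program_clause P (p_id M) x y \<Longrightarrow> y = x"
  "program_clause P (p_fst M) (pr M u v) y \<Longrightarrow> y = u"
  "program_clause P (p_snd M) (pr M u v) y \<Longrightarrow> y = v"
  by (erule program_clause_cases; simp add: program_defs)+

lemma tree_computes_mu: "tree_computes X A s (p_mu M f) x y \<Longrightarrow> tree_computes X A s f (pr M x y) \<zero> \<and>
    (\<forall>n. n \<prec> y \<longrightarrow> (\<exists>u. u \<noteq> \<zero> \<and> tree_computes X A s f (pr M x n) u))"
  by (drule tree_computes_dest) (auto simp: search_clause_def program_defs elim!: program_clause_cases)

lemma deterministic_mu: assumes "deterministic X A s f" shows "deterministic X A s (p_mu M f)"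
  unfolding deterministic_def
proof (intro allI impI)
  fix x y y' assume "tree_computes X A s (p_mu M f) x y" "tree_computes X A s (p_mu M f) x y'"
  from this[THEN tree_computes_mu] linear[of y y'] show "y = y'" using deterministicD[OF assms] by metis
qed

lemma tree_computes_pair: "tree_computes X A s (p_pair M f g) x y \<Longrightarrow> \<exists>u v. y = pr M u v \<and> tree_computes X A s f x u \<and> tree_computes X A s g x v"
  by (drule tree_computes_progD) (auto simp: program_defs elim!: program_clause_cases)

lemma deterministic_pair: "deterministic X A s f \<Longrightarrow> deterministic X A s g \<Longrightarrow> deterministic X A s (p_pair M f g)"
  unfolding deterministic_def[of X A s "p_pair M f g"] using deterministicD tree_computes_pair by metis

lemma tree_computes_comp: "tree_computes X A s (p_comp M f g) x y \<Longrightarrow> \<exists>u. tree_computes X A s g x u \<and> tree_computes X A s f u y"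
  by (drule tree_computes_progD) (auto simp: program_defs elim!: program_clause_cases)

lemma deterministic_comp: "deterministic X A s f \<Longrightarrow> deterministic X A s g \<Longrightarrow> deterministic X A s (p_comp M f g)"
  unfolding deterministic_def[of X A s "p_comp M f g"] using deterministicD tree_computes_comp by metis

lemma tree_computes_rec: "tree_computes X A s (p_rec M f g) x y \<Longrightarrow> \<exists>a n. x = pr M a n"
  "tree_computes X A s (p_rec M f g) (pr M a \<zero>) y \<Longrightarrow> tree_computes X A s f a y"
  "tree_computes X A s (p_rec M f g) (pr M a (n \<oplus> \<one>)) y \<Longrightarrow>
     \<exists>u. tree_computes X A s (p_rec M f g) (pr M a n) u \<and> tree_computes X A s g (pr M a (pr M n u)) y"
  by (drule tree_computes_progD; auto simp: program_defs elim!: program_clause_cases)+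

text \<open>The recursion calls the same program again; the inner induction is on the recursion argument.\<close>

lemma deterministic_rec:
  assumes XA: "X \<in> sets M" "A \<in> sets M" and fg: "deterministic X A s f" "deterministic X A s g"
  shows "deterministic X A s (p_rec M f g)"
proof -
  have "\<forall>y y'. tree_computes X A s (p_rec M f g) (pr M a n) y \<longrightarrow> tree_computes X A s (p_rec M f g) (pr M a n) y' \<longrightarrow> y = y'" (is "?R a n") for a n
  proof (rule arithmetical_induct[where P="?R a"])
    show "definable (\<lambda>e S. ?R a (e 0))"
      by (intro definableI XA)
    show "?R a \<zero>"
      using tree_computes_rec(2) deterministicD[OF fg(1)] by blast
    show "?R a (n \<oplus> \<one>)"
      if "?R a n" for n
      using that tree_computes_rec(3) deterministicD[OF fg(2)] by metis
  qed
  then show ?thesis unfolding deterministic_def using tree_computes_rec(1) by metis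
qed

lemma deterministic:
  assumes XA: "X \<in> sets M" "A \<in> sets M" shows "deterministic X A s e"
proof -
  have "\<forall>s e. N = s \<oplus> e \<longrightarrow> deterministic X A s e" for N
  proof (rule arithmetical_less_induct[where P="\<lambda>N. \<forall>s e. N = s \<oplus> e \<longrightarrow> deterministic X A s e"])
    show "definable (\<lambda>e S. \<forall>s p. e 0 = s \<oplus> p \<longrightarrow> deterministic X A s p)"
      unfolding deterministic_def by (intro definableI XA)
    fix N assume IH: "\<And>N'. N' \<prec> N \<Longrightarrow> \<forall>s e. N' = s \<oplus> e \<longrightarrow> deterministic X A s e"
    show "\<forall>s e. N = s \<oplus> e \<longrightarrow> deterministic X A s e"
    proof (intro allI impI)
      fix s e assume N: "N = s \<oplus> e"
      have IHs: "deterministic X A s f" if "f \<prec> e" for f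
        using IH add_less_mono[OF that le_refl[of s]] unfolding N by (metis add_comm)
      show "deterministic X A s e"
      proof (cases "e = p_oracle M")
        case True
        then show ?thesis using deterministic_oracle IH N by blast
      next
        case no: False
        show ?thesis
        proof (cases "\<exists>f. e = p_mu M f")
          case True
          then obtain f where f: "e = p_mu M f" by blast
          have "f \<prec> e" unfolding f program_defs by simp
          then show ?thesis unfolding f using deterministic_mu IHs f by blast
        next
          case nm: False
          show ?thesis unfolding deterministic_def
          proof (intro allI impI)
            fix x y y' assume 1: "tree_computes X A s e x y" and 2: "tree_computes X A s e x y'"
            have p: "program_clause (tree_computes X A s) e x y" "program_clause (tree_computes X A s) e x y'" using 1 2 tree_computes_progD no nm by blast+
            have fp: "deterministic X A s e" if "e = p_pair M f g \<or> e = p_comp M f g \<or> e = p_rec M f g" for f g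
            proof -
              have "f \<prec> e" "g \<prec> e" using that unfolding program_defs by auto
              then show ?thesis using that IHs deterministic_pair deterministic_comp deterministic_rec[OF XA] by blast
            qed
            from p(1) show "y = y'"
            proof (cases rule: program_clause_cases)
              case pair then show ?thesis using fp deterministicD 1 2 by blast
            next
              case comp then show ?thesis using fp deterministicD 1 2 by blast
            next
              case rec0 then show ?thesis using fp deterministicD 1 2 by blast
            next
              case recS then show ?thesis using fp deterministicD 1 2 by blast
            qed (use p(2) in \<open>auto dest: program_clause_fun\<close>)
          qed
        qed
      qed
    qed
  qed
  then show ?thesis by blast
qed

lemma tree_computes_fun: "X \<in> sets M \<Longrightarrow> A \<in> sets M \<Longrightarrow> tree_computes X A s e x y \<Longrightarrow> tree_computes X A s e x y' \<Longrightarrow> y = y'"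
  using deterministic deterministicD by blast

lemma tree_computes_tX: "x \<in> X \<Longrightarrow> tree_computes X A tree_X (p_oracle M) x \<one>" "x \<notin> X \<Longrightarrow> tree_computes X A tree_X (p_oracle M) x \<zero>"
  by (rule oracle_clause_closed, simp add: oracle_clause_def)+

lemma tree_computes_tA: "x \<in> A \<Longrightarrow> tree_computes X A tree_A (p_oracle M) x \<one>" "x \<notin> A \<Longrightarrow> tree_computes X A tree_A (p_oracle M) x \<zero>"
  by (rule oracle_clause_closed, simp add: oracle_clause_def)+

text \<open>A computation with oracle \<open>Z\<close> is simulated at the leaf that names \<open>Z\<close>.\<close>

lemma computes_fun: "Z \<in> sets M \<Longrightarrow> computes M Z e x y \<Longrightarrow> computes M Z e x y' \<Longrightarrow> y = y'"
  using computes_simulation[of Z Z Z tree_X] tree_computes_tX tree_computes_fun by metis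

section \<open>The Turing ideal generated by two sets\<close>

text \<open>The sections of the code are the sets named by trees. Since the index of every section has to
  name some set, the trees that are not total are used for a repetition of \<open>X\<close>.\<close>

lemma ideal_exists:
  assumes XA: "X \<in> sets M" "A \<in> sets M"
  shows "\<exists>W\<in>sets M. turing_ideal M W X \<and> (\<exists>k. section_of M W k = A)"
proof -
  let ?o = "p_oracle M"
  define tot where "tot s \<longleftrightarrow> (\<forall>x. tree_computes X A s ?o x \<zero> \<or> tree_computes X A s ?o x \<one>)" for s
  define W where "W = {z. \<exists>x s. z = pr M x s \<and> (tot s \<and> tree_computes X A s ?o x \<one> \<or> \<not> tot s \<and> x \<in> X)}"
  have W: "W \<in> sets M" unfolding W_def tot_def by (rule arithmetical_comprehension) (intro definableI XA)
  have sec: "x \<in> section_of M W s \<longleftrightarrow> (if tot s then tree_computes X A s ?o x \<one> else x \<in> X)" for x s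
    unfolding section_of_def W_def by auto
  have secI: "section_of M W s = Y" if "\<And>x. x \<in> Y \<Longrightarrow> tree_computes X A s ?o x \<one>" "\<And>x. x \<notin> Y \<Longrightarrow> tree_computes X A s ?o x \<zero>" for s Y
  proof -
    have "tot s" using that unfolding tot_def by blast
    then show ?thesis using that tree_computes_fun[OF XA] zero_one unfolding set_eq_iff sec by metis
  qed
  have dec: "\<exists>s. \<forall>x. (x \<in> section_of M W m \<longrightarrow> tree_computes X A s ?o x \<one>) \<and> (x \<notin> section_of M W m \<longrightarrow> tree_computes X A s ?o x \<zero>)" for m
  proof (cases "tot m")
    case True then show ?thesis unfolding sec tot_def by metis
  next
    case False then show ?thesis unfolding sec using tree_computes_tX[of _ X A] by auto
  qed
  have "turing_ideal M W X" unfolding turing_ideal_def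
  proof (intro conjI allI ballI impI)
    fix m n
    obtain a b where a: "\<And>x. x \<in> section_of M W m \<Longrightarrow> tree_computes X A a ?o x \<one>" "\<And>x. x \<notin> section_of M W m \<Longrightarrow> tree_computes X A a ?o x \<zero>"
      and b: "\<And>x. x \<in> section_of M W n \<Longrightarrow> tree_computes X A b ?o x \<one>" "\<And>x. x \<notin> section_of M W n \<Longrightarrow> tree_computes X A b ?o x \<zero>"
      using dec[of m] dec[of n] by blast
    have j: "tree_computes X A (tree_join a b) ?o (w \<oplus> w) y" if "tree_computes X A a ?o w y" for w y
      by (rule oracle_clause_closed) (use that in \<open>auto simp: oracle_clause_def two_mult\<close>)
    have j': "tree_computes X A (tree_join a b) ?o (w \<oplus> w \<oplus> \<one>) y" if "tree_computes X A b ?o w y" for w y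
      by (rule oracle_clause_closed) (use that in \<open>auto simp: oracle_clause_def two_mult\<close>)
    have J: "x \<in> join M (section_of M W m) (section_of M W n) \<longleftrightarrow>
      (\<exists>w. x = w \<oplus> w \<and> w \<in> section_of M W m \<or> x = w \<oplus> w \<oplus> \<one> \<and> w \<in> section_of M W n)" for x
      unfolding join_def two_mult by blast
    have "section_of M W (tree_join a b) = join M (section_of M W m) (section_of M W n)"
    proof (rule secI)
      show "tree_computes X A (tree_join a b) ?o x \<one>" if "x \<in> join M (section_of M W m) (section_of M W n)" for x
        using that a(1) b(1) j j' unfolding J by blast
      show "tree_computes X A (tree_join a b) ?o x \<zero>" if "x \<notin> join M (section_of M W m) (section_of M W n)" for x
        using that a(2) b(2) j j' parity_cases[of x] unfolding J by metis
    qed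
    then show "\<exists>k. section_of M W k = join M (section_of M W m) (section_of M W n)" by blast
  next
    fix m Y assume Y: "Y \<in> sets M" "turing_le M Y (section_of M W m)"
    obtain e where e: "\<And>x. x \<in> Y \<Longrightarrow> computes M (section_of M W m) e x \<one>"
       "\<And>x. x \<notin> Y \<Longrightarrow> computes M (section_of M W m) e x \<zero>" using Y(2) unfolding turing_le_def by blast
    obtain a where a: "\<And>x. x \<in> section_of M W m \<Longrightarrow> tree_computes X A a ?o x \<one>" "\<And>x. x \<notin> section_of M W m \<Longrightarrow> tree_computes X A a ?o x \<zero>"
      using dec[of m] by blast
    have c: "tree_computes X A (tree_comp e a) ?o x y" if "computes M (section_of M W m) e x y" for x y
      by (rule oracle_clause_closed) (use computes_simulation[OF XA a that] in \<open>auto simp: oracle_clause_def\<close>)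
    have "section_of M W (tree_comp e a) = Y" by (rule secI) (use c e in blast)+
    then show "\<exists>k. section_of M W k = Y" by blast
  next
    have "section_of M W tree_X = X" by (rule secI) (use tree_computes_tX[of _ X A] in blast)+
    then show "\<exists>k. section_of M W k = X" by blast
  qed
  moreover have "section_of M W tree_A = A" by (rule secI) (use tree_computes_tA[of _ A X] in blast)+
  ultimately show ?thesis using W by blast
qed

section \<open>Definability of the coded syntax\<close>

lemma definable_inst2: "definable (\<lambda>e S. P (e 0) (e (Suc 0))) \<Longrightarrow> polynomial s \<Longrightarrow> polynomial t \<Longrightarrow> definable (\<lambda>e S. P (s e) (t e))"
proof -
  assume "definable (\<lambda>e S. P (e 0) (e (Suc 0)))" "polynomial s" "polynomial t"
  then have "definable (\<lambda>e S. \<forall>y. y = t e \<longrightarrow> (\<forall>x. x = s e \<longrightarrow> P x y))"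
    by (intro definable_all definable_imp definable_eq polynomial_var polynomial_shift)
  then show ?thesis by simp
qed

lemma definable_inst4: "definable (\<lambda>e S. P (e 0) (e (Suc 0)) (e (Suc (Suc 0))) (e (Suc (Suc (Suc 0))))) \<Longrightarrow>
  polynomial s \<Longrightarrow> polynomial t \<Longrightarrow> polynomial u \<Longrightarrow> polynomial v \<Longrightarrow> definable (\<lambda>e S. P (s e) (t e) (u e) (v e))"
proof -
  assume "definable (\<lambda>e S. P (e 0) (e (Suc 0)) (e (Suc (Suc 0))) (e (Suc (Suc (Suc 0)))))" "polynomial s" "polynomial t" "polynomial u" "polynomial v"
  then have "definable (\<lambda>e S. \<forall>w. w = v e \<longrightarrow> (\<forall>z. z = u e \<longrightarrow> (\<forall>y. y = t e \<longrightarrow> (\<forall>x. x = s e \<longrightarrow> P x y z w))))"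
    by (intro definable_all definable_imp definable_eq polynomial_var polynomial_shift)
  then show ?thesis by simp
qed

lemmas c_defs = c_var_def c_zero_def c_one_def c_plus_def c_times_def c_num_def c_svar_def c_X_def
  c_set_def c_eq_def c_less_def c_mem_def c_neg_def c_conj_def c_alln_def c_alls_def

lemma polynomial_codes [definableI]:
  "polynomial s \<Longrightarrow> polynomial (\<lambda>e. c_var M (s e))"
  "polynomial s \<Longrightarrow> polynomial (\<lambda>e. c_svar M (s e))"
  "polynomial s \<Longrightarrow> polynomial (\<lambda>e. c_num M (s e))"
  "polynomial s \<Longrightarrow> polynomial (\<lambda>e. c_set M (s e))"
  "polynomial s \<Longrightarrow> polynomial (\<lambda>e. c_neg M (s e))"
  "polynomial s \<Longrightarrow> polynomial t \<Longrightarrow> polynomial (\<lambda>e. c_plus M (s e) (t e))"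
  "polynomial s \<Longrightarrow> polynomial t \<Longrightarrow> polynomial (\<lambda>e. c_times M (s e) (t e))"
  "polynomial s \<Longrightarrow> polynomial t \<Longrightarrow> polynomial (\<lambda>e. c_eq M (s e) (t e))"
  "polynomial s \<Longrightarrow> polynomial t \<Longrightarrow> polynomial (\<lambda>e. c_less M (s e) (t e))"
  "polynomial s \<Longrightarrow> polynomial t \<Longrightarrow> polynomial (\<lambda>e. c_mem M (s e) (t e))"
  "polynomial s \<Longrightarrow> polynomial t \<Longrightarrow> polynomial (\<lambda>e. c_conj M (s e) (t e))"
  "polynomial s \<Longrightarrow> polynomial t \<Longrightarrow> polynomial (\<lambda>e. c_alln M (s e) (t e))"
  "polynomial s \<Longrightarrow> polynomial t \<Longrightarrow> polynomial (\<lambda>e. c_alls M (s e) (t e))"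
  unfolding c_defs by (intro definableI; assumption)+

lemma bex_binary_ops: "(\<exists>f\<in>binary_ops M. P f) \<longleftrightarrow>
   P (c_plus M) \<or> P (c_times M) \<or> P (c_eq M) \<or> P (c_less M) \<or> P (c_mem M) \<or> P (c_conj M)"
  by (simp add: binary_ops_def)

lemma definable_is_term [definableI]: "polynomial t \<Longrightarrow> definable (\<lambda>e S. is_term M (t e))"
  by (erule definable_inst[rotated], unfold is_term_def) (intro definableI)

lemma definable_is_set_term [definableI]: "polynomial t \<Longrightarrow> definable (\<lambda>e S. is_set_term M (t e))"
  by (erule definable_inst[rotated], unfold is_set_term_def) (intro definableI)

lemma definable_is_formula [definableI]: "polynomial t \<Longrightarrow> definable (\<lambda>e S. is_formula M (t e))"
  by (erule definable_inst[rotated], unfold is_formula_def) (intro definableI)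

lemma definable_free_in [definableI]: "polynomial s \<Longrightarrow> polynomial t \<Longrightarrow> definable (\<lambda>e S. free_in M (s e) (t e))"
  by (rule definable_inst2[where P="free_in M"], unfold free_in_def bex_binary_ops) (intro definableI | assumption)+

lemma definable_is_closed [definableI]: "polynomial t \<Longrightarrow> definable (\<lambda>e S. is_closed M (t e))"
  by (erule definable_inst[rotated], unfold is_closed_def) (intro definableI)

lemma definable_is_sentence [definableI]: "polynomial t \<Longrightarrow> definable (\<lambda>e S. is_sentence M (t e))"
  unfolding is_sentence_def by (intro definableI)

lemma definable_subst [definableI]: "polynomial s \<Longrightarrow> polynomial t \<Longrightarrow> polynomial u \<Longrightarrow> polynomial v \<Longrightarrow> definable (\<lambda>e S. subst M (s e) (t e) (u e) (v e))"
  by (rule definable_inst4[where P="subst M"], unfold subst_def bex_binary_ops) (intro definableI | assumption)+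

lemma definable_immediate_subformula [definableI]: "polynomial s \<Longrightarrow> polynomial t \<Longrightarrow> definable (\<lambda>e S. immediate_subformula M (s e) (t e))"
  by (rule definable_inst2[where P="immediate_subformula M"], unfold immediate_subformula_def) (intro definableI | assumption)+

lemma definable_parameter_instance [definableI]: "polynomial s \<Longrightarrow> polynomial t \<Longrightarrow> definable (\<lambda>e S. parameter_instance M (s e) (t e))"
  by (rule definable_inst2[where P="parameter_instance M"], unfold parameter_instance_def) (intro definableI | assumption)+

lemma definable_chain_immediate_subformula [definableI]:
  "polynomial s \<Longrightarrow> polynomial t \<Longrightarrow> definable (\<lambda>e S. chain M (immediate_subformula M) (s e) (t e))"
  by (rule definable_inst2[where P="chain M (immediate_subformula M)"], unfold chain_def) (intro definableI | assumption)+

lemma definable_chain_parameter_instance [definableI]: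
  "polynomial s \<Longrightarrow> polynomial t \<Longrightarrow> definable (\<lambda>e S. chain M (parameter_instance M) (s e) (t e))"
  by (rule definable_inst2[where P="chain M (parameter_instance M)"], unfold chain_def) (intro definableI | assumption)+

lemma definable_Sub [definableI]: "polynomial s \<Longrightarrow> polynomial t \<Longrightarrow> definable (\<lambda>e S. s e \<in> Sub M (t e))"
  by (rule definable_inst2[where P="\<lambda>s t. s \<in> Sub M t"], unfold Sub_def mem_Collect_eq) (intro definableI | assumption)+

lemma definable_term_val [definableI]: "polynomial s \<Longrightarrow> polynomial t \<Longrightarrow> definable (\<lambda>e S. term_val M (s e) (t e))"
  by (rule definable_inst2[where P="term_val M"], unfold term_val_def) (intro definableI | assumption)+

lemma definable_mem_Collect [definableI]: "definable (\<lambda>e S. P e S (t e)) \<Longrightarrow> definable (\<lambda>e S. t e \<in> {x. P e S x})"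
  by simp

section \<open>From \<open>\<Pi>\<^sup>1\<^sub>1\<close> comprehension to truth sets\<close>

lemma section_sets [definableI]: "W \<in> sets M \<Longrightarrow> section_of M W n \<in> sets M"
  unfolding section_of_def by (rule arithmetical_comprehension) (intro definableI)

definition ideal_by_programs :: "'a set \<Rightarrow> 'a set \<Rightarrow> bool" where
  "ideal_by_programs W X \<longleftrightarrow>
    (\<forall>m n. \<exists>k. section_of M W k = join M (section_of M W m) (section_of M W n)) \<and>
    (\<forall>m e. (\<forall>x. computes M (section_of M W m) e x \<one> \<or> computes M (section_of M W m) e x \<zero>) \<longrightarrow>
       (\<exists>k. \<forall>x. x \<in> section_of M W k \<longleftrightarrow> computes M (section_of M W m) e x \<one>)) \<and>
    (\<exists>k. section_of M W k = X)"

text \<open>Determinism allows the quantifier over all sets \<open>Y\<close> computable from a section to be replaced by one over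
  the programs that are total and two-valued. Conversely, the set computed by such a program exists by
  arithmetical comprehension. This makes the notion of an ideal arithmetical in its code.\<close>

lemma turing_ideal_alt:
  assumes "W \<in> sets M"
  shows "turing_ideal M W X \<longleftrightarrow> ideal_by_programs W X"
proof -
  \<comment> \<open>A program never yields both values, so the set it decides is unique.\<close>
  have fn: "\<not> (computes M (section_of M W m) e x \<one> \<and> computes M (section_of M W m) e x \<zero>)" for m e x
    using computes_fun[OF section_sets[OF assms], of m e x \<zero> \<one>] zero_one by blast
  have cs: "{x. computes M (section_of M W m) e x \<one>} \<in> sets M" for m e
  proof (rule arithmetical_comprehension)
    have "section_of M W m \<in> sets M" using assms by (rule section_sets)
    then show "definable (\<lambda>ea S. computes M (section_of M W m) e (ea 0) \<one>)"
      unfolding computes_alt computes_clause_def program_clause_def search_clause_def by (intro definableI assms)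
  qed
  have "(\<forall>Y\<in>sets M. turing_le M Y (section_of M W m) \<longrightarrow> (\<exists>k. section_of M W k = Y)) \<longleftrightarrow>
     (\<forall>e. (\<forall>x. computes M (section_of M W m) e x \<one> \<or> computes M (section_of M W m) e x \<zero>) \<longrightarrow>
       (\<exists>k. \<forall>x. x \<in> section_of M W k \<longleftrightarrow> computes M (section_of M W m) e x \<one>))" (is "?L \<longleftrightarrow> ?R") for m
  proof
    assume L: ?L
    show ?R
    proof (intro allI impI)
      fix e assume t: "\<forall>x. computes M (section_of M W m) e x \<one> \<or> computes M (section_of M W m) e x \<zero>"
      have "turing_le M {x. computes M (section_of M W m) e x \<one>} (section_of M W m)"
        unfolding turing_le_def using t by blast
      then show "\<exists>k. \<forall>x. x \<in> section_of M W k \<longleftrightarrow> computes M (section_of M W m) e x \<one>"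
        using L cs by blast
    qed
  next
    assume R: ?R
    show ?L
    proof (intro ballI impI)
      fix Y assume "Y \<in> sets M" "turing_le M Y (section_of M W m)"
      then obtain e where e: "\<And>x. x \<in> Y \<Longrightarrow> computes M (section_of M W m) e x \<one>"
        "\<And>x. x \<notin> Y \<Longrightarrow> computes M (section_of M W m) e x \<zero>" unfolding turing_le_def by blast
      then obtain k where "\<forall>x. x \<in> section_of M W k \<longleftrightarrow> computes M (section_of M W m) e x \<one>" using R by blast
      then show "\<exists>k. section_of M W k = Y" using e fn by blast
    qed
  qed
  then show ?thesis unfolding turing_ideal_def ideal_by_programs_def by simp
qed

lemma pair_sets:
  assumes "A \<in> sets M" "B \<in> sets M"
  shows "\<exists>G\<in>sets M. section_of M G \<zero> = A \<and> section_of M G \<one> = B"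
proof -
  let ?G = "{z. \<exists>x. z = pr M x \<zero> \<and> x \<in> A \<or> z = pr M x \<one> \<and> x \<in> B}"
  have "?G \<in> sets M" by (rule arithmetical_comprehension) (intro definableI assms)
  moreover have "section_of M ?G \<zero> = A" "section_of M ?G \<one> = B" unfolding section_of_def by auto
  ultimately show ?thesis by blast
qed

text \<open>The sections \<open>0\<close> and \<open>1\<close> of the set quantified over play the roles of \<open>W\<close> and \<open>f\<close>.\<close>

lemma computably_entailed_set:
  assumes "M \<Turnstile> Pi11_CA" "X \<in> sets M"
  shows "{p. computably_entailed M X p} \<in> sets M"
proof -
  note T = turing_ideal_alt[where X = X]
  define Q where "Q G p \<longleftrightarrow> ideal_by_programs (section_of M G \<zero>) X \<longrightarrow> valuation M (section_of M G \<zero>) X p (section_of M G \<one>) \<longrightarrow>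
     pr M p \<one> \<in> section_of M G \<one>" for G p
  have "computably_entailed M X p \<longleftrightarrow> (\<forall>G\<in>sets M. is_sentence M p \<and> Q G p)" for p
  proof
    assume "computably_entailed M X p"
    then show "\<forall>G\<in>sets M. is_sentence M p \<and> Q G p"
      unfolding computably_entailed_def Q_def using section_sets T by blast
  next
    assume R: "\<forall>G\<in>sets M. is_sentence M p \<and> Q G p"
    show "computably_entailed M X p" unfolding computably_entailed_def
    proof (intro conjI ballI impI)
      show "is_sentence M p" using R assms(2) by blast
      fix W f assume "W \<in> sets M" "f \<in> sets M" "turing_ideal M W X" "valuation M W X p f"
      moreover obtain G where "G \<in> sets M" "section_of M G \<zero> = W" "section_of M G \<one> = f"
        using pair_sets calculation(1,2) by blast
      ultimately show "pr M p \<one> \<in> f" using R T unfolding Q_def by blast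
    qed
  qed
  moreover have "{p. \<forall>G\<in>sets M. is_sentence M p \<and> Q G p} \<in> sets M"
  proof (rule Pi11_comprehension[OF assms(1)])
    have 1: "definable (\<lambda>e S. ideal_by_programs (section_of M S \<zero>) X)"
      unfolding ideal_by_programs_def computes_alt computes_clause_def program_clause_def search_clause_def section_of_def join_def set_eq_iff Un_iff mem_Collect_eq
      by (intro definableI assms(2))
    have 2: "definable (\<lambda>e S. valuation M (section_of M S \<zero>) X (e 0) (section_of M S \<one>))"
      unfolding valuation_def val_function_def in_set_term_def section_of_def mem_Collect_eq
      by (intro definableI assms(2))
    have 3: "definable (\<lambda>e S. pr M (e 0) \<one> \<in> section_of M S \<one>)"
      unfolding section_of_def mem_Collect_eq by (intro definableI)
    show "definable (\<lambda>e S. is_sentence M (e 0) \<and> Q S (e 0))"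
      unfolding Q_def by (intro definable_conj definable_imp 1 2 3 definable_is_sentence polynomial_var)
  qed
  ultimately show ?thesis by simp
qed

section \<open>Recursion equations for coded syntax\<close>

lemma is_term_iff: "is_term M x \<longleftrightarrow> (\<exists>v. x = c_var M v) \<or> x = c_zero M \<or> x = c_one M \<or>
   (\<exists>s t. is_term M s \<and> is_term M t \<and> (x = c_plus M s t \<or> x = c_times M s t))"
  unfolding is_term_def by (subst derivable_iff, intro finitary_intros) auto

lemma is_term_intros [simp]: "is_term M (c_var M v)" "is_term M (c_zero M)" "is_term M (c_one M)"
  "is_term M s \<Longrightarrow> is_term M t \<Longrightarrow> is_term M (c_plus M s t)"
  "is_term M s \<Longrightarrow> is_term M t \<Longrightarrow> is_term M (c_times M s t)"
  by (subst is_term_iff, blast)+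

lemma is_formula_iff: "is_formula M x \<longleftrightarrow>
   (\<exists>s t. is_term M s \<and> is_term M t \<and> (x = c_eq M s t \<or> x = c_less M s t)) \<or>
   (\<exists>t A. is_term M t \<and> is_set_term M A \<and> x = c_mem M t A) \<or>
   (\<exists>p. is_formula M p \<and> x = c_neg M p) \<or>
   (\<exists>p q. is_formula M p \<and> is_formula M q \<and> x = c_conj M p q) \<or>
   (\<exists>v p. is_formula M p \<and> (x = c_alln M v p \<or> x = c_alls M v p))"
  unfolding is_formula_def by (subst derivable_iff, intro finitary_intros) auto

lemma is_formula_intros:
  "is_term M s \<Longrightarrow> is_term M t \<Longrightarrow> is_formula M (c_eq M s t)"
  "is_term M s \<Longrightarrow> is_term M t \<Longrightarrow> is_formula M (c_less M s t)"
  "is_term M s \<Longrightarrow> is_set_term M A \<Longrightarrow> is_formula M (c_mem M s A)"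
  "is_formula M p \<Longrightarrow> is_formula M (c_neg M p)"
  "is_formula M p \<Longrightarrow> is_formula M q \<Longrightarrow> is_formula M (c_conj M p q)"
  "is_formula M p \<Longrightarrow> is_formula M (c_alln M v p)"
  "is_formula M p \<Longrightarrow> is_formula M (c_alls M v p)"
  by (subst is_formula_iff, blast)+

definition is_variable :: "'a \<Rightarrow> bool" where "is_variable z \<longleftrightarrow> (\<exists>v. z = c_var M v \<or> z = c_svar M v)"

lemma is_variable_simps [simp]: "is_variable (c_var M v)" "is_variable (c_svar M v)" by (auto simp: is_variable_def)

lemma free_in_iff: "free_in M z x \<longleftrightarrow> x = z \<or>
   (\<exists>f\<in>binary_ops M. \<exists>a b. x = f a b \<and> (free_in M z a \<or> free_in M z b)) \<or>
   (\<exists>p. free_in M z p \<and> x = c_neg M p) \<or>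
   (\<exists>v p. free_in M z p \<and> x = c_alln M v p \<and> z \<noteq> c_var M v) \<or>
   (\<exists>v p. free_in M z p \<and> x = c_alls M v p \<and> z \<noteq> c_svar M v)"
  unfolding free_in_def bex_binary_ops by (subst derivable_iff, intro finitary_intros) (simp only: Bex_def mem_Collect_eq)

lemma free_in_simps:
  assumes "is_variable z"
  shows "free_in M z (c_var M v) \<longleftrightarrow> z = c_var M v"
  "free_in M z (c_svar M v) \<longleftrightarrow> z = c_svar M v"
  "\<not> free_in M z (c_zero M)" "\<not> free_in M z (c_one M)" "\<not> free_in M z (c_num M n)"
  "\<not> free_in M z (c_X M)" "\<not> free_in M z (c_set M n)"
  "free_in M z (c_plus M a b) \<longleftrightarrow> free_in M z a \<or> free_in M z b"
  "free_in M z (c_times M a b) \<longleftrightarrow> free_in M z a \<or> free_in M z b"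
  "free_in M z (c_eq M a b) \<longleftrightarrow> free_in M z a \<or> free_in M z b"
  "free_in M z (c_less M a b) \<longleftrightarrow> free_in M z a \<or> free_in M z b"
  "free_in M z (c_mem M a b) \<longleftrightarrow> free_in M z a \<or> free_in M z b"
  "free_in M z (c_conj M a b) \<longleftrightarrow> free_in M z a \<or> free_in M z b"
  "free_in M z (c_neg M a) \<longleftrightarrow> free_in M z a"
  "free_in M z (c_alln M v a) \<longleftrightarrow> free_in M z a \<and> z \<noteq> c_var M v"
  "free_in M z (c_alls M v a) \<longleftrightarrow> free_in M z a \<and> z \<noteq> c_svar M v"
  using assms unfolding is_variable_def
  by (elim exE disjE; subst free_in_iff; auto simp: bex_binary_ops c_defs)+

text \<open>Determinacy and totality of substitution are read off from the equations below, constructor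
  by constructor.\<close>

lemma subst_iff: "subst M z c p q \<longleftrightarrow>
   p = z \<and> q = c \<or>
   p \<noteq> z \<and> q = p \<and>
         ((\<exists>n. p = c_var M n \<or> p = c_num M n \<or> p = c_svar M n \<or> p = c_set M n) \<or>
          p = c_zero M \<or> p = c_one M \<or> p = c_X M) \<or>
   (\<exists>f\<in>binary_ops M. \<exists>a b a' b'. p = f a b \<and> q = f a' b' \<and> subst M z c a a' \<and> subst M z c b b') \<or>
   (\<exists>a a'. p = c_neg M a \<and> q = c_neg M a' \<and> subst M z c a a') \<or>
   (\<exists>v a. (p = c_alln M v a \<and> z = c_var M v \<or> p = c_alls M v a \<and> z = c_svar M v) \<and> q = p) \<or>
   (\<exists>v a a'. p = c_alln M v a \<and> z \<noteq> c_var M v \<and> q = c_alln M v a' \<and> subst M z c a a') \<or>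
   (\<exists>v a a'. p = c_alls M v a \<and> z \<noteq> c_svar M v \<and> q = c_alls M v a' \<and> subst M z c a a')"
  unfolding subst_def bex_binary_ops by (subst derivable_iff, intro finitary_intros) simp

lemma subst_atoms:
  assumes "is_variable z"
  shows "subst M z c (c_var M v) r \<longleftrightarrow> r = (if c_var M v = z then c else c_var M v)"
  "subst M z c (c_svar M v) r \<longleftrightarrow> r = (if c_svar M v = z then c else c_svar M v)"
  "subst M z c (c_num M n) r \<longleftrightarrow> r = c_num M n"
  "subst M z c (c_set M n) r \<longleftrightarrow> r = c_set M n"
  "subst M z c (c_zero M) r \<longleftrightarrow> r = c_zero M"
  "subst M z c (c_one M) r \<longleftrightarrow> r = c_one M"
  "subst M z c (c_X M) r \<longleftrightarrow> r = c_X M"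
  using assms unfolding is_variable_def
  by (elim exE disjE; subst subst_iff; auto simp: bex_binary_ops c_defs)+

lemma subst_binary:
  assumes "is_variable z"
  shows
  "subst M z c (c_plus M a b) r \<longleftrightarrow> (\<exists>a' b'. r = c_plus M a' b' \<and> subst M z c a a' \<and> subst M z c b b')"
  "subst M z c (c_times M a b) r \<longleftrightarrow> (\<exists>a' b'. r = c_times M a' b' \<and> subst M z c a a' \<and> subst M z c b b')"
  "subst M z c (c_eq M a b) r \<longleftrightarrow> (\<exists>a' b'. r = c_eq M a' b' \<and> subst M z c a a' \<and> subst M z c b b')"
  "subst M z c (c_less M a b) r \<longleftrightarrow> (\<exists>a' b'. r = c_less M a' b' \<and> subst M z c a a' \<and> subst M z c b b')"
  "subst M z c (c_mem M a b) r \<longleftrightarrow> (\<exists>a' b'. r = c_mem M a' b' \<and> subst M z c a a' \<and> subst M z c b b')"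
  "subst M z c (c_conj M a b) r \<longleftrightarrow> (\<exists>a' b'. r = c_conj M a' b' \<and> subst M z c a a' \<and> subst M z c b b')"
  using assms unfolding is_variable_def
  by (elim exE disjE; subst subst_iff; auto simp: bex_binary_ops c_defs)+

lemma subst_unary:
  assumes "is_variable z"
  shows
  "subst M z c (c_neg M a) r \<longleftrightarrow> (\<exists>a'. r = c_neg M a' \<and> subst M z c a a')"
  "subst M z c (c_alln M v a) r \<longleftrightarrow> (if z = c_var M v then r = c_alln M v a else (\<exists>a'. r = c_alln M v a' \<and> subst M z c a a'))"
  "subst M z c (c_alls M v a) r \<longleftrightarrow> (if z = c_svar M v then r = c_alls M v a else (\<exists>a'. r = c_alls M v a' \<and> subst M z c a a'))"
  using assms unfolding is_variable_def
  by (elim exE disjE; subst subst_iff; auto simp: bex_binary_ops c_defs)+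

lemmas subst_simps = subst_atoms subst_binary subst_unary

lemma term_val_iff: "term_val M t n \<longleftrightarrow>
   t = c_zero M \<and> n = \<zero> \<or> t = c_one M \<and> n = \<one> \<or> t = c_num M n \<or>
   (\<exists>a b i j. term_val M a i \<and> term_val M b j \<and>
          (t = c_plus M a b \<and> n = i \<oplus> j \<or> t = c_times M a b \<and> n = i \<otimes> j))"
  unfolding term_val_def by (subst derivable_iff, intro finitary_intros) simp

lemma term_val_simps:
  "term_val M (c_zero M) n \<longleftrightarrow> n = \<zero>"
  "term_val M (c_one M) n \<longleftrightarrow> n = \<one>"
  "term_val M (c_num M m) n \<longleftrightarrow> n = m"
  "term_val M (c_plus M a b) n \<longleftrightarrow> (\<exists>i j. term_val M a i \<and> term_val M b j \<and> n = i \<oplus> j)"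
  "term_val M (c_times M a b) n \<longleftrightarrow> (\<exists>i j. term_val M a i \<and> term_val M b j \<and> n = i \<otimes> j)"
  by (subst term_val_iff; auto simp: c_defs)+

definition chain_clause :: "('a \<Rightarrow> 'a \<Rightarrow> bool) \<Rightarrow> 'a \<Rightarrow> 'a set \<Rightarrow> 'a \<Rightarrow> bool" where
  "chain_clause R a F x \<longleftrightarrow> x = pr M \<zero> a \<or> (\<exists>i p q. x = pr M (i \<oplus> \<one>) q \<and> pr M i p \<in> F \<and> R p q)"

lemma chain_alt: "chain M R a b \<longleftrightarrow> (\<exists>l. derivable M (chain_clause R a) (pr M l b))"
  unfolding chain_def chain_clause_def ..

lemma chain_clause_iff: "derivable M (chain_clause R a) x \<longleftrightarrow>
   x = pr M \<zero> a \<or> (\<exists>i p q. x = pr M (i \<oplus> \<one>) q \<and> derivable M (chain_clause R a) (pr M i p) \<and> R p q)"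
  by (subst derivable_iff, unfold chain_clause_def, intro finitary_intros, simp)

lemma chain_refl: "chain M R a a"
  unfolding chain_alt by (subst chain_clause_iff) blast

lemma chain_step: assumes "chain M R a b" "R b c" shows "chain M R a c"
proof -
  obtain l where "derivable M (chain_clause R a) (pr M l b)" using assms(1) unfolding chain_alt by blast
  then have "derivable M (chain_clause R a) (pr M (l \<oplus> \<one>) c)"
    using assms(2) by (subst chain_clause_iff) blast
  then show ?thesis unfolding chain_alt by blast
qed

text \<open>Induction on the length of the chain, carried out inside one certificate, which is a set of \<open>M\<close>
  whatever the relation \<open>R\<close> is.\<close>

lemma chain_induct:
  assumes "chain M R a b" "definable (\<lambda>e S. P (e 0))" "P a" "\<And>p q. P p \<Longrightarrow> R p q \<Longrightarrow> P q"
  shows "P b"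
proof -
  obtain l where "derivable M (chain_clause R a) (pr M l b)" using assms(1) unfolding chain_alt by blast
  then obtain F where F: "coded_finite F" "pr M l b \<in> F" "\<And>x. x \<in> F \<Longrightarrow> chain_clause R a F x"
    unfolding derivable_fin by blast
  have "\<forall>q. pr M l q \<in> F \<longrightarrow> P q"
  proof (rule arithmetical_induct[where P="\<lambda>l. \<forall>q. pr M l q \<in> F \<longrightarrow> P q"])
    show "definable (\<lambda>e S. \<forall>q. pr M (e 0) q \<in> F \<longrightarrow> P q)" by (intro definableI assms(2) coded_finite_sets F(1))
    show "\<forall>q. pr M \<zero> q \<in> F \<longrightarrow> P q"
      using F(3) assms(3) unfolding chain_clause_def by fastforce
    show "\<forall>q. pr M (l \<oplus> \<one>) q \<in> F \<longrightarrow> P q" if "\<forall>q. pr M l q \<in> F \<longrightarrow> P q" for l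
      using F(3) assms(4) that unfolding chain_clause_def by fastforce
  qed
  then show ?thesis using F(2) by blast
qed

section \<open>Instances of subformulas\<close>

lemma immediate_subformula_intros:
  "immediate_subformula M (c_neg M q) q" "immediate_subformula M (c_conj M q r) q"
  "immediate_subformula M (c_conj M q r) r" "immediate_subformula M (c_alln M v q) q"
  "immediate_subformula M (c_alls M v q) q"
  unfolding immediate_subformula_def by blast+

text \<open>Substitution commutes with the formation of formulas. When the substituted variable is bound by the
  outermost quantifier, the instance is unchanged, hence the alternative \<open>t = q\<close>.\<close>

lemma parameter_instance_subformula:
  assumes "parameter_instance M p s" "immediate_subformula M s t"
  shows "\<exists>q. immediate_subformula M p q \<and> (t = q \<or> parameter_instance M q t)"
proof -
  have "\<exists>z c. is_variable z \<and> subst M z c p s \<and> (\<exists>v n. z = c_var M v \<and> c = c_num M n \<or> z = c_svar M v \<and> c = c_set M n)"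
    using assms(1) unfolding parameter_instance_def by (elim exE disjE) (blast intro: is_variable_simps)+
  then obtain z c where zc: "is_variable z" "subst M z c p s" and
    zc': "\<exists>v n. z = c_var M v \<and> c = c_num M n \<or> z = c_svar M v \<and> c = c_set M n" by blast
  have pi: "parameter_instance M a b" if "subst M z c a b" for a b
    using that zc' unfolding parameter_instance_def by blast
  from zc(2) have "p = z \<and> s = c \<or>
   p \<noteq> z \<and> s = p \<or>
   (\<exists>f\<in>binary_ops M. \<exists>a b a' b'. p = f a b \<and> s = f a' b' \<and> subst M z c a a' \<and> subst M z c b b') \<or>
   (\<exists>a a'. p = c_neg M a \<and> s = c_neg M a' \<and> subst M z c a a') \<or>
   s = p \<or>
   (\<exists>v a a'. p = c_alln M v a \<and> s = c_alln M v a' \<and> subst M z c a a') \<or>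
   (\<exists>v a a'. p = c_alls M v a \<and> s = c_alls M v a' \<and> subst M z c a a')"
    by (subst (asm) subst_iff) blast
  then show ?thesis
    using assms(2) zc' pi unfolding bex_binary_ops immediate_subformula_def c_defs
    by (elim disjE exE conjE) (simp_all, blast+)
qed

text \<open>Thus the set \<open>Sub p\<close>, defined by forming subformulas first and instances afterwards, is closed under
  subformulas and instances in any order.\<close>

lemma chain_instance_subformula:
  assumes "chain M (parameter_instance M) q s" "immediate_subformula M s t"
  shows "\<exists>r. immediate_subformula M q r \<and> chain M (parameter_instance M) r t"
proof -
  have "\<forall>t. immediate_subformula M s t \<longrightarrow> (\<exists>r. immediate_subformula M q r \<and> chain M (parameter_instance M) r t)" (is "?R s")
    using assms(1)
  proof (rule chain_induct[where P="?R"])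
    show "definable (\<lambda>e S. ?R (e 0))"
      by (intro definableI)
    show "?R q"
      using chain_refl by blast
    show "?R s'"
      if "?R s"
        "parameter_instance M s s'" for s s'
      using that parameter_instance_subformula chain_step by metis
  qed
  then show ?thesis using assms(2) by blast
qed

lemma is_closed_iff: "is_closed M a \<longleftrightarrow> (\<forall>z. is_variable z \<longrightarrow> \<not> free_in M z a)"
  unfolding is_closed_def is_variable_def by blast

text \<open>Since the substituted expression is closed, no free variables are gained and the substituted one is
  lost.\<close>

lemma subst_free:
  assumes c: "is_variable z" "\<And>z'. is_variable z' \<Longrightarrow> \<not> free_in M z' c"
    and s: "subst M z c p r" "is_variable z'" "free_in M z' r"
  shows "free_in M z' p \<and> z' \<noteq> z"
proof -
  have "\<forall>r z'. subst M z c p r \<longrightarrow> is_variable z' \<longrightarrow> free_in M z' r \<longrightarrow> free_in M z' p \<and> z' \<noteq> z" (is "?R p")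
  proof (rule arithmetical_less_induct[where P="?R"])
    show "definable (\<lambda>e S. ?R (e 0))"
      unfolding is_variable_def by (intro definableI)
    fix p assume IH: "\<And>y. y \<prec> p \<Longrightarrow> ?R y"
    show "?R p"
    proof (intro allI impI)
      fix r z' assume s: "subst M z c p r" and z': "is_variable z'" and f: "free_in M z' r"
      have I: "y \<prec> p \<Longrightarrow> subst M z c y y' \<Longrightarrow> free_in M z' y' \<Longrightarrow> free_in M z' y \<and> z' \<noteq> z" for y y'
        using IH z' by blast
      have lt: "a \<prec> f a b \<and> b \<prec> f a b \<and> (free_in M z' (f a b) \<longleftrightarrow> free_in M z' a \<or> free_in M z' b)"
        if "f \<in> binary_ops M" for f a b
        using that z' unfolding binary_ops_def by (auto simp: free_in_simps) (auto simp: c_defs)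
      have lt1: "a \<prec> c_neg M a" "a \<prec> c_alln M v a" "a \<prec> c_alls M v a" for a v
        by (simp_all add: c_defs)
      from s[unfolded subst_iff[of z c p r]] show "free_in M z' p \<and> z' \<noteq> z"
      proof (elim disjE exE conjE bexE)
        assume "r = c" then show ?thesis using c f z' by blast
      next
        fix f a b a' b' assume "f \<in> binary_ops M" "p = f a b" "r = f a' b'" "subst M z c a a'" "subst M z c b b'"
        then show ?thesis using lt I \<open>free_in M z' r\<close> by metis
      next
        fix a a' assume "p = c_neg M a" "r = c_neg M a'" "subst M z c a a'"
        then show ?thesis using lt1 I f z' by (metis free_in_simps(14))
      next
        fix v a a' assume "p = c_alln M v a" "r = c_alln M v a'" "subst M z c a a'"
        then show ?thesis using lt1 I f z' by (metis free_in_simps(15))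
      next
        fix v a a' assume "p = c_alls M v a" "r = c_alls M v a'" "subst M z c a a'"
        then show ?thesis using lt1 I f z' by (metis free_in_simps(16))
      qed (use f z' in \<open>auto simp: free_in_simps\<close>)
    qed
  qed
  then show ?thesis using s by blast
qed

lemma is_closed_inst:
  assumes "is_variable z" "\<And>z'. is_variable z' \<Longrightarrow> \<not> free_in M z' c"
    "\<And>z'. is_variable z' \<Longrightarrow> free_in M z' q \<Longrightarrow> z' = z" "subst M z c q r"
  shows "is_closed M r"
  unfolding is_closed_iff using subst_free[OF assms(1,2,4)] assms(3) by blast

lemma Sub_refl: "is_closed M p \<Longrightarrow> p \<in> Sub M p"
  unfolding Sub_def using chain_refl by blast

lemma Sub_closed: "s \<in> Sub M p \<Longrightarrow> is_closed M s" unfolding Sub_def by blast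

lemma Sub_immediate:
  assumes "s \<in> Sub M p" "immediate_subformula M s t" "is_closed M t"
  shows "t \<in> Sub M p"
proof -
  obtain q where q: "chain M (immediate_subformula M) p q" "chain M (parameter_instance M) q s"
    using assms(1) unfolding Sub_def by blast
  obtain r where "immediate_subformula M q r" "chain M (parameter_instance M) r t"
    using chain_instance_subformula[OF q(2) assms(2)] by blast
  then show ?thesis unfolding Sub_def using chain_step[OF q(1)] assms(3) by blast
qed

lemma Sub_instance:
  assumes "s \<in> Sub M p" "immediate_subformula M s t" "parameter_instance M t u" "is_closed M u"
  shows "u \<in> Sub M p"
proof -
  obtain q where q: "chain M (immediate_subformula M) p q" "chain M (parameter_instance M) q s"
    using assms(1) unfolding Sub_def by blast
  obtain r where "immediate_subformula M q r" "chain M (parameter_instance M) r t"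
    using chain_instance_subformula[OF q(2) assms(2)] by blast
  then show ?thesis unfolding Sub_def using chain_step[OF q(1)] chain_step[of "parameter_instance M" r t u] assms(3,4) by blast
qed

lemma Sub_neg: "c_neg M q \<in> Sub M p \<Longrightarrow> q \<in> Sub M p"
  by (rule Sub_immediate[OF _ immediate_subformula_intros(1)])
    (auto dest!: Sub_closed simp: is_closed_iff free_in_simps)

lemma Sub_conj: assumes "c_conj M q r \<in> Sub M p" shows "q \<in> Sub M p" "r \<in> Sub M p"
proof -
  have "is_closed M q" "is_closed M r"
    using Sub_closed[OF assms] by (auto simp: is_closed_iff free_in_simps)
  then show "q \<in> Sub M p" "r \<in> Sub M p"
    using Sub_immediate[OF assms] immediate_subformula_intros by blast+
qed

lemma Sub_alln: assumes "c_alln M v q \<in> Sub M p" "subst M (c_var M v) (c_num M n) q r" shows "r \<in> Sub M p"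
proof (rule Sub_instance[OF assms(1) immediate_subformula_intros(4)])
  show "parameter_instance M q r" using assms(2) unfolding parameter_instance_def by blast
  show "is_closed M r"
    by (rule is_closed_inst[OF _ _ _ assms(2)])
      (use Sub_closed[OF assms(1)] in \<open>auto simp: is_closed_iff free_in_simps\<close>)
qed

lemma Sub_alls: assumes "c_alls M v q \<in> Sub M p" "subst M (c_svar M v) (c_set M n) q r" shows "r \<in> Sub M p"
proof (rule Sub_instance[OF assms(1) immediate_subformula_intros(5)])
  show "parameter_instance M q r" using assms(2) unfolding parameter_instance_def by blast
  show "is_closed M r"
    by (rule is_closed_inst[OF _ _ _ assms(2)])
      (use Sub_closed[OF assms(1)] in \<open>auto simp: is_closed_iff free_in_simps\<close>)
qed

section \<open>Valuations of formulas of standard depth\<close>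

definition atomic :: "'a \<Rightarrow> bool" where
  "atomic s \<longleftrightarrow> (\<exists>a b. s = c_eq M a b \<or> s = c_less M a b \<or> s = c_mem M a b)"

text \<open>The depth is a number of the metatheory, while subexpressions that are terms are arbitrary codes.
  Thus a code of bounded depth may be nonstandard.\<close>

primrec depth_le :: "nat \<Rightarrow> 'a \<Rightarrow> bool" where
  "depth_le 0 s \<longleftrightarrow> atomic s"
| "depth_le (Suc d) s \<longleftrightarrow> atomic s \<or> (\<exists>q. s = c_neg M q \<and> depth_le d q) \<or>
     (\<exists>q r. s = c_conj M q r \<and> depth_le d q \<and> depth_le d r) \<or>
     (\<exists>v q. (s = c_alln M v q \<or> s = c_alls M v q) \<and> depth_le d q)"

definition atomic_truth :: "'a set \<Rightarrow> 'a set \<Rightarrow> 'a \<Rightarrow> bool" where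
  "atomic_truth W X s \<longleftrightarrow>
     (\<exists>a b. s = c_eq M a b \<and> (\<exists>i j. term_val M a i \<and> term_val M b j \<and> i = j)) \<or>
     (\<exists>a b. s = c_less M a b \<and> (\<exists>i j. term_val M a i \<and> term_val M b j \<and> i \<prec> j)) \<or>
     (\<exists>t A. s = c_mem M t A \<and> (\<exists>i. term_val M t i \<and> in_set_term M W X i A))"

text \<open>Truth in the model coded by \<open>W\<close>. The recursion is on the depth in the metatheory, and therefore yields
  an arithmetical formula for every depth, although truth in the model is not arithmetical.\<close>

primrec truth :: "'a set \<Rightarrow> 'a set \<Rightarrow> nat \<Rightarrow> 'a \<Rightarrow> bool" where
  "truth W X 0 s \<longleftrightarrow> atomic_truth W X s"
| "truth W X (Suc d) s \<longleftrightarrow> atomic_truth W X s \<or>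
     (\<exists>q. s = c_neg M q \<and> \<not> truth W X d q) \<or>
     (\<exists>q r. s = c_conj M q r \<and> truth W X d q \<and> truth W X d r) \<or>
     (\<exists>v q. s = c_alln M v q \<and> (\<forall>n r. subst M (c_var M v) (c_num M n) q r \<longrightarrow> truth W X d r)) \<or>
     (\<exists>v q. s = c_alls M v q \<and> (\<forall>n r. subst M (c_svar M v) (c_set M n) q r \<longrightarrow> truth W X d r))"

lemma definable_depth_le [definableI]: "polynomial t \<Longrightarrow> definable (\<lambda>e S. depth_le d (t e))"
proof (induction d arbitrary: t)
  case 0
  show ?case by (rule definable_inst[OF _ 0], unfold depth_le.simps atomic_def) (intro definableI)
next
  case (Suc d)
  show ?case by (rule definable_inst[OF _ Suc.prems], unfold depth_le.simps atomic_def) (intro definableI Suc.IH)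
qed

lemma definable_truth [definableI]: "W \<in> sets M \<Longrightarrow> X \<in> sets M \<Longrightarrow> polynomial t \<Longrightarrow> definable (\<lambda>e S. truth W X d (t e))"
proof (induction d arbitrary: t)
  case 0
  show ?case
    by (rule definable_inst[OF _ 0(3)], unfold truth.simps atomic_truth_def in_set_term_def section_of_def) (intro definableI 0)
next
  case (Suc d)
  show ?case
    by (rule definable_inst[OF _ Suc.prems(3)], unfold truth.simps atomic_truth_def in_set_term_def section_of_def)
      (intro definableI Suc.IH Suc.prems(1,2))
qed

lemma depth_le_shapes:
  "depth_le (Suc d) (c_neg M q) \<longleftrightarrow> depth_le d q"
  "depth_le (Suc d) (c_conj M q r) \<longleftrightarrow> depth_le d q \<and> depth_le d r"
  "depth_le (Suc d) (c_alln M v q) \<longleftrightarrow> depth_le d q"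
  "depth_le (Suc d) (c_alls M v q) \<longleftrightarrow> depth_le d q"
  "\<not> depth_le 0 (c_neg M q)" "\<not> depth_le 0 (c_conj M q r)" "\<not> depth_le 0 (c_alln M v q)" "\<not> depth_le 0 (c_alls M v q)"
  "depth_le d (c_eq M a b)" "depth_le d (c_less M a b)" "depth_le d (c_mem M a b)"
  by (cases d; auto simp: atomic_def c_defs)+

lemma depth_le_atomic: "atomic s \<Longrightarrow> depth_le d s"
  by (cases d) simp_all

lemma depth_le_cases [consumes 1, case_names atomic neg conj alln alls]:
  assumes "depth_le d s"
  obtains "atomic s"
  | d' q where "d = Suc d'" "s = c_neg M q" "depth_le d' q"
  | d' q r where "d = Suc d'" "s = c_conj M q r" "depth_le d' q" "depth_le d' r"
  | d' v q where "d = Suc d'" "s = c_alln M v q" "depth_le d' q"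
  | d' v q where "d = Suc d'" "s = c_alls M v q" "depth_le d' q"
  using assms by (cases d) auto

lemma depth_le_mono: "depth_le d s \<Longrightarrow> depth_le (Suc d) s"
proof (induction d arbitrary: s)
  case 0
  then show ?case by simp
next
  case (Suc d)
  from Suc.prems show ?case
    by (cases rule: depth_le_cases) (auto simp: depth_le_shapes simp del: depth_le.simps intro: Suc.IH depth_le_atomic)
qed

lemma depth_le_mono': assumes "depth_le d s" "d \<le> d'" shows "depth_le d' s"
  using assms(2,1) by (induction rule: dec_induct) (simp_all only: depth_le_mono)

lemma depth_le_immediate: "depth_le d p \<Longrightarrow> immediate_subformula M p q \<Longrightarrow> depth_le d q"
  by (cases d) (auto simp: immediate_subformula_def depth_le_shapes simp del: depth_le.simps intro: depth_le_mono)

lemma atomic_subst: "atomic p \<Longrightarrow> is_variable z \<Longrightarrow> subst M z c p q \<Longrightarrow> atomic q"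
  unfolding atomic_def by (elim exE disjE) (simp_all only: subst_simps, blast+)

lemma depth_le_subst: "depth_le d p \<Longrightarrow> is_variable z \<Longrightarrow> subst M z c p q \<Longrightarrow> depth_le d q"
proof (induction d arbitrary: p q)
  case 0
  then show ?case using atomic_subst by simp
next
  case (Suc d)
  from Suc.prems(1) show ?case
  proof (cases rule: depth_le_cases)
    case atomic then show ?thesis using Suc.prems(2,3) atomic_subst depth_le_atomic by blast
  next
    case (neg d' q)
    then show ?thesis using Suc.prems(2,3) Suc.IH by (auto simp: subst_simps depth_le_shapes simp del: depth_le.simps)
  next
    case (conj d' q)
    then show ?thesis using Suc.prems(2,3) Suc.IH by (auto simp: subst_simps depth_le_shapes simp del: depth_le.simps)
  next
    case (alln d' v q)
    then show ?thesis using Suc.prems(2,3) Suc.IH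
      by (auto simp: subst_simps depth_le_shapes simp del: depth_le.simps split: if_splits)
  next
    case (alls d' v q)
    then show ?thesis using Suc.prems(2,3) Suc.IH
      by (auto simp: subst_simps depth_le_shapes simp del: depth_le.simps split: if_splits)
  qed
qed

lemma depth_le_Sub: assumes "depth_le d p" "s \<in> Sub M p" shows "depth_le d s"
proof -
  obtain q where q: "chain M (immediate_subformula M) p q" "chain M (parameter_instance M) q s"
    using assms(2) unfolding Sub_def by blast
  have "depth_le d q"
    using q(1) by (rule chain_induct[where P="depth_le d"]) (intro definableI, fact, blast intro: depth_le_immediate)
  then show ?thesis
    using chain_induct[OF q(2), of "depth_le d"] depth_le_subst definable_depth_le[OF polynomial_var]
    unfolding parameter_instance_def by (metis is_variable_simps)
qed

lemma truth_shapes: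
  "truth W X d (c_eq M a b) \<longleftrightarrow> (\<exists>i j. term_val M a i \<and> term_val M b j \<and> i = j)"
  "truth W X d (c_less M a b) \<longleftrightarrow> (\<exists>i j. term_val M a i \<and> term_val M b j \<and> i \<prec> j)"
  "truth W X d (c_mem M a A) \<longleftrightarrow> (\<exists>i. term_val M a i \<and> in_set_term M W X i A)"
  "truth W X (Suc d) (c_neg M q) \<longleftrightarrow> \<not> truth W X d q"
  "truth W X (Suc d) (c_conj M q r) \<longleftrightarrow> truth W X d q \<and> truth W X d r"
  "truth W X (Suc d) (c_alln M v q) \<longleftrightarrow> (\<forall>n r. subst M (c_var M v) (c_num M n) q r \<longrightarrow> truth W X d r)"
  "truth W X (Suc d) (c_alls M v q) \<longleftrightarrow> (\<forall>n r. subst M (c_svar M v) (c_set M n) q r \<longrightarrow> truth W X d r)"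
  unfolding in_set_term_def by (cases d; simp add: atomic_truth_def in_set_term_def c_defs)+

text \<open>The recursion of \<open>truth\<close> lowers the depth at every step; stability turns its equations into clauses
  for one and the same predicate, as a valuation requires.\<close>

lemma truth_stable: "depth_le d s \<Longrightarrow> truth W X (Suc d) s \<longleftrightarrow> truth W X d s"
proof (induction d arbitrary: s)
  case 0
  then show ?case by (auto simp: atomic_def truth_shapes simp del: truth.simps)
next
  case (Suc d)
  from Suc.prems(1) show ?case
  proof (cases rule: depth_le_cases)
    case atomic
    then show ?thesis by (auto simp: atomic_def truth_shapes simp del: truth.simps)
  next
    case (neg d' q)
    then show ?thesis using Suc.IH by (simp only: truth_shapes nat.inject)
  next
    case (conj d' q)
    then show ?thesis using Suc.IH by (simp only: truth_shapes nat.inject)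
  next
    case (alln d' v q)
    then have q: "depth_le d q" by simp
    show ?thesis unfolding alln(2) truth_shapes(6) using Suc.IH depth_le_subst[OF q is_variable_simps(1)] by blast
  next
    case (alls d' v q)
    then have q: "depth_le d q" by simp
    show ?thesis unfolding alls(2) truth_shapes(7) using Suc.IH depth_le_subst[OF q is_variable_simps(2)] by blast
  qed
qed

text \<open>All members of \<open>Sub p\<close> have depth at most \<open>D\<close>, so that the definable predicate \<open>truth W X D\<close> decides
  all of them.\<close>

lemma valuation_exists:
  assumes "W \<in> sets M" "X \<in> sets M" "depth_le D p"
  shows "\<exists>f\<in>sets M. valuation M W X p f"
proof
  define f where "f = {x. \<exists>s. s \<in> Sub M p \<and> (x = pr M s \<one> \<and> truth W X D s \<or> x = pr M s \<zero> \<and> \<not> truth W X D s)}"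
  show "f \<in> sets M" unfolding f_def by (rule arithmetical_comprehension) (intro definableI assms)
  have f1: "pr M s \<one> \<in> f \<longleftrightarrow> truth W X D s" and f0: "pr M s \<zero> \<in> f \<longleftrightarrow> \<not> truth W X D s" if "s \<in> Sub M p" for s
    using that unfolding f_def by auto
  have dS: "depth_le D s" if "s \<in> Sub M p" for s using depth_le_Sub assms(3) that by blast
  have neg: "truth W X D (c_neg M q) \<longleftrightarrow> \<not> truth W X D q" if "c_neg M q \<in> Sub M p" for q
  proof (cases D)
    case 0 then show ?thesis using dS[OF that] by (simp add: depth_le_shapes del: depth_le.simps)
  next
    case (Suc d)
    then have "depth_le d q" using dS[OF that] by (simp add: depth_le_shapes del: depth_le.simps)
    then show ?thesis unfolding Suc truth_shapes(4) by (simp only: truth_stable)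
  qed
  have conj: "truth W X D (c_conj M q r) \<longleftrightarrow> truth W X D q \<and> truth W X D r" if "c_conj M q r \<in> Sub M p" for q r
  proof (cases D)
    case 0 then show ?thesis using dS[OF that] by (simp add: depth_le_shapes del: depth_le.simps)
  next
    case (Suc d)
    then have "depth_le d q" "depth_le d r" using dS[OF that] by (simp_all add: depth_le_shapes del: depth_le.simps)
    then show ?thesis unfolding Suc truth_shapes(5) by (simp only: truth_stable)
  qed
  have alln: "truth W X D (c_alln M v q) \<longleftrightarrow> (\<forall>n r. subst M (c_var M v) (c_num M n) q r \<longrightarrow> truth W X D r)"
    if "c_alln M v q \<in> Sub M p" for v q
  proof (cases D)
    case 0 then show ?thesis using dS[OF that] by (simp add: depth_le_shapes del: depth_le.simps)
  next
    case (Suc d)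
    then have "depth_le d q" using dS[OF that] by (simp add: depth_le_shapes del: depth_le.simps)
    then show ?thesis unfolding Suc truth_shapes(6) using depth_le_subst[OF _ is_variable_simps(1)] truth_stable by blast
  qed
  have alls: "truth W X D (c_alls M v q) \<longleftrightarrow> (\<forall>n r. subst M (c_svar M v) (c_set M n) q r \<longrightarrow> truth W X D r)"
    if "c_alls M v q \<in> Sub M p" for v q
  proof (cases D)
    case 0 then show ?thesis using dS[OF that] by (simp add: depth_le_shapes del: depth_le.simps)
  next
    case (Suc d)
    then have "depth_le d q" using dS[OF that] by (simp add: depth_le_shapes del: depth_le.simps)
    then show ?thesis unfolding Suc truth_shapes(7) using depth_le_subst[OF _ is_variable_simps(2)] truth_stable by blast
  qed
  have "val_function M p f" unfolding val_function_def
    using f1 f0 unfolding f_def by blast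
  then show "valuation M W X p f" unfolding valuation_def
  proof (intro conjI allI impI)
    fix q assume "c_neg M q \<in> Sub M p"
    then show "pr M (c_neg M q) \<one> \<in> f \<longleftrightarrow> pr M q \<zero> \<in> f"
      using Sub_neg f1 f0 neg by blast
  next
    fix q r assume "c_conj M q r \<in> Sub M p"
    then show "pr M (c_conj M q r) \<one> \<in> f \<longleftrightarrow> pr M q \<one> \<in> f \<and> pr M r \<one> \<in> f"
      using Sub_conj f1 conj by blast
  next
    fix v q assume a: "c_alln M v q \<in> Sub M p"
    show "pr M (c_alln M v q) \<one> \<in> f \<longleftrightarrow> (\<forall>n r. subst M (c_var M v) (c_num M n) q r \<longrightarrow> pr M r \<one> \<in> f)"
      using Sub_alln[OF a] f1 alln[OF a] a by blast
  next
    fix v q assume a: "c_alls M v q \<in> Sub M p"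
    show "pr M (c_alls M v q) \<one> \<in> f \<longleftrightarrow> (\<forall>n r. subst M (c_svar M v) (c_set M n) q r \<longrightarrow> pr M r \<one> \<in> f)"
      using Sub_alls[OF a] f1 alls[OF a] a by blast
  qed (simp_all only: f1 truth_shapes)
qed

section \<open>Numerals\<close>

text \<open>The numeral of \<open>a\<close> is the term \<open>(\<dots>(0 + 1) + \<dots>) + 1\<close>. For nonstandard \<open>a\<close> it has nonstandard
  length, so it is defined by certificates in \<open>M\<close>.\<close>

definition is_numeral_clause :: "'a set \<Rightarrow> 'a \<Rightarrow> bool" where
  "is_numeral_clause F x \<longleftrightarrow> x = pr M \<zero> (c_zero M) \<or>
     (\<exists>b t. x = pr M (b \<oplus> \<one>) (c_plus M t (c_one M)) \<and> pr M b t \<in> F)"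

definition is_numeral :: "'a \<Rightarrow> 'a \<Rightarrow> bool" where
  "is_numeral a y \<longleftrightarrow> derivable M is_numeral_clause (pr M a y)"

lemma definable_is_numeral [definableI]: "polynomial s \<Longrightarrow> polynomial t \<Longrightarrow> definable (\<lambda>e S. is_numeral (s e) (t e))"
  by (rule definable_inst2[where P=is_numeral], unfold is_numeral_def is_numeral_clause_def) (intro definableI | assumption)+

lemma is_numeral_iff: "is_numeral a y \<longleftrightarrow> a = \<zero> \<and> y = c_zero M \<or> (\<exists>b t. a = b \<oplus> \<one> \<and> y = c_plus M t (c_one M) \<and> is_numeral b t)"
proof -
  have "is_numeral a y \<longleftrightarrow> is_numeral_clause (Collect (derivable M is_numeral_clause)) (pr M a y)"
    unfolding is_numeral_def by (rule derivable_iff, unfold is_numeral_clause_def, intro finitary_intros)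
  then show ?thesis unfolding is_numeral_clause_def[of "Collect _"] is_numeral_def by auto
qed

lemma is_numeral_simps: "is_numeral \<zero> y \<longleftrightarrow> y = c_zero M"
  "is_numeral (b \<oplus> \<one>) y \<longleftrightarrow> (\<exists>t. y = c_plus M t (c_one M) \<and> is_numeral b t)"
  by (subst is_numeral_iff; auto)+

lemma is_numeral_ex1: "\<exists>y. \<forall>z. is_numeral a z \<longleftrightarrow> z = y"
proof (rule arithmetical_induct[where P="\<lambda>a. \<exists>y. \<forall>z. is_numeral a z \<longleftrightarrow> z = y"])
  show "definable (\<lambda>e S. \<exists>y. \<forall>z. is_numeral (e 0) z \<longleftrightarrow> z = y)" by (intro definableI)
qed (auto simp: is_numeral_simps)

definition numeral_code :: "'a \<Rightarrow> 'a" where "numeral_code a = (THE y. is_numeral a y)"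

lemma is_numeral_numeral_code: "is_numeral a y \<longleftrightarrow> y = numeral_code a"
proof -
  obtain y0 where "\<forall>z. is_numeral a z \<longleftrightarrow> z = y0" using is_numeral_ex1 by blast
  then have "numeral_code a = y0" unfolding numeral_code_def by (intro the_equality) auto
  then show ?thesis using \<open>\<forall>z. is_numeral a z \<longleftrightarrow> z = y0\<close> by simp
qed

lemma numeral_code_simps: "numeral_code \<zero> = c_zero M" "numeral_code (b \<oplus> \<one>) = c_plus M (numeral_code b) (c_one M)"
  using is_numeral_simps(1)[of "numeral_code \<zero>"] is_numeral_simps(2)[of b "numeral_code (b \<oplus> \<one>)"] unfolding is_numeral_numeral_code by auto

text \<open>Induction on \<open>a\<close> for properties of its numeral; the premise of definability mentions the numeral as a
  second argument, because the function \<open>numeral_code\<close> is not a polynomial.\<close>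

lemma numeral_code_induct:
  assumes "definable (\<lambda>e S. P (e 0) (e (Suc 0)))" "P \<zero> (c_zero M)"
    "\<And>a. P a (numeral_code a) \<Longrightarrow> P (a \<oplus> \<one>) (c_plus M (numeral_code a) (c_one M))"
  shows "P a (numeral_code a)"
proof -
  have "\<forall>y. is_numeral a y \<longrightarrow> P a y"
  proof (rule arithmetical_induct[where P="\<lambda>a. \<forall>y. is_numeral a y \<longrightarrow> P a y"])
    show "definable (\<lambda>e S. \<forall>y. is_numeral (e 0) y \<longrightarrow> P (e 0) y)" by (intro definableI definable_inst2[OF assms(1)])
  qed (use assms(2,3) in \<open>auto simp: is_numeral_numeral_code numeral_code_simps\<close>)
  then show ?thesis unfolding is_numeral_numeral_code by blast
qed

lemma is_term_numeral_code: "is_term M (numeral_code a)"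
  by (rule numeral_code_induct[where P="\<lambda>a y. is_term M y"]) (intro definableI | simp)+

lemma free_in_numeral_code: "is_variable z \<Longrightarrow> \<not> free_in M z (numeral_code a)"
  by (rule numeral_code_induct[where P="\<lambda>a y. \<not> free_in M z y"]) (intro definableI | simp add: free_in_simps)+

text \<open>Closed terms, in the form in which they are used: substitution leaves them unchanged.\<close>

definition inert :: "'a \<Rightarrow> bool" where
  "inert t \<longleftrightarrow> (\<forall>z c r. is_variable z \<longrightarrow> (subst M z c t r \<longleftrightarrow> r = t))"

lemma inert_numeral_code: "inert (numeral_code a)" unfolding inert_def
proof (intro allI impI)
  fix z c r assume z: "is_variable z"
  have "\<forall>r. subst M z c (numeral_code a) r \<longleftrightarrow> r = numeral_code a"
    by (rule numeral_code_induct[where P="\<lambda>a y. \<forall>r. subst M z c y r \<longleftrightarrow> r = y"]) (intro definableI | simp add: subst_simps z)+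
  then show "subst M z c (numeral_code a) r \<longleftrightarrow> r = numeral_code a" by blast
qed

lemma inert_num: "inert (c_num M n)" unfolding inert_def by (simp add: subst_simps)

lemma term_val_numeral_code: "term_val M (numeral_code a) y \<longleftrightarrow> y = a"
proof -
  have "\<forall>y. term_val M (numeral_code a) y \<longleftrightarrow> y = a"
    by (rule numeral_code_induct[where P="\<lambda>a t. \<forall>y. term_val M t y \<longleftrightarrow> y = a"]) (intro definableI | simp add: term_val_simps)+
  then show ?thesis by blast
qed

section \<open>Codes of standard formulas\<close>

primrec code_tm :: "(nat \<Rightarrow> 'a) \<Rightarrow> tm \<Rightarrow> 'a" where
  "code_tm h (NVar n) = h n"
| "code_tm h Zero = c_zero M"
| "code_tm h One = c_one M"
| "code_tm h (Plus s t) = c_plus M (code_tm h s) (code_tm h t)"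
| "code_tm h (Times s t) = c_times M (code_tm h s) (code_tm h t)"

text \<open>The term for the pairing function.\<close>

definition c_pr :: "'a \<Rightarrow> 'a \<Rightarrow> 'a" where
  "c_pr s t = c_plus M (c_times M (c_plus M s t) (c_plus M s t)) s"

text \<open>The code of an arithmetical formula in which variable \<open>j\<close> is replaced by the term code \<open>h j\<close> and the
  set variable \<open>V\<close> by \<open>u\<close>. All other set variables are parameters: \<open>t \<in> U\<close> becomes \<open>(t, U) \<in> X\<close>, where \<open>X\<close>
  is the constant of the language. A quantifier restores the coded variable for the variable that it
  binds. The value for set quantifiers is arbitrary.\<close>

primrec code_fm :: "nat \<Rightarrow> 'a \<Rightarrow> fm \<Rightarrow> (nat \<Rightarrow> 'a) \<Rightarrow> 'a" where
  "code_fm V u (Eq s t) = (\<lambda>h. c_eq M (code_tm h s) (code_tm h t))"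
| "code_fm V u (Less s t) = (\<lambda>h. c_less M (code_tm h s) (code_tm h t))"
| "code_fm V u (Mem t U) = (\<lambda>h. if U = V then c_mem M (code_tm h t) u
      else c_mem M (c_pr (code_tm h t) (numeral_code (num M U))) (c_X M))"
| "code_fm V u (Neg p) = (\<lambda>h. c_neg M (code_fm V u p h))"
| "code_fm V u (Conj p q) = (\<lambda>h. c_conj M (code_fm V u p h) (code_fm V u q h))"
| "code_fm V u (AllN i p) = (\<lambda>h. c_alln M (num M i) (code_fm V u p (h(i := c_var M (num M i)))))"
| "code_fm V u (AllS U p) = (\<lambda>h. \<zero>)"

lemma code_fm_simps [simp]:
  "code_fm V u (Eq s t) h = c_eq M (code_tm h s) (code_tm h t)"
  "code_fm V u (Less s t) h = c_less M (code_tm h s) (code_tm h t)"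
  "code_fm V u (Mem t U) h = (if U = V then c_mem M (code_tm h t) u
      else c_mem M (c_pr (code_tm h t) (numeral_code (num M U))) (c_X M))"
  "code_fm V u (Neg p) h = c_neg M (code_fm V u p h)"
  "code_fm V u (Conj p q) h = c_conj M (code_fm V u p h) (code_fm V u q h)"
  "code_fm V u (AllN i p) h = c_alln M (num M i) (code_fm V u p (h(i := c_var M (num M i))))"
  by simp_all

declare code_fm.simps [simp del]

lemma c_var_simps [simp]: "c_var M v = c_var M w \<longleftrightarrow> v = w" "c_var M v \<noteq> c_svar M w" "c_svar M w \<noteq> c_var M v"
  by (auto simp: c_defs)

lemma is_term_code_tm: "(\<And>j. is_term M (h j)) \<Longrightarrow> is_term M (code_tm h t)"
  by (induction t) simp_all

lemma is_formula_code_fm: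
  "arithmetical p \<Longrightarrow> is_set_term M u \<Longrightarrow> (\<And>j. is_term M (h j)) \<Longrightarrow> is_formula M (code_fm V u p h)"
proof (induction p arbitrary: h)
  case (AllN i p)
  then show ?case by (auto intro!: is_formula_intros)
qed (auto intro!: is_formula_intros is_term_code_tm is_term_intros is_term_numeral_code simp: c_pr_def is_set_term_def)

lemma free_in_code_tm: "is_variable z \<Longrightarrow> free_in M z (code_tm h t) \<Longrightarrow> \<exists>j. free_in M z (h j)"
  by (induction t) (auto simp: free_in_simps)

lemma free_in_code_fm:
  "arithmetical p \<Longrightarrow> is_variable z \<Longrightarrow> free_in M z (code_fm V u p h) \<Longrightarrow> free_in M z u \<or> (\<exists>j. free_in M z (h j))"
proof (induction p arbitrary: h)
  case (AllN i p)
  then have "z \<noteq> c_var M (num M i)" "free_in M z (code_fm V u p (h(i := c_var M (num M i))))"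
    by (auto simp: free_in_simps)
  then have "free_in M z u \<or> (\<exists>j. free_in M z ((h(i := c_var M (num M i))) j))"
    using AllN.prems by (intro AllN.IH) (simp_all del: fun_upd_apply)
  then show ?case using \<open>z \<noteq> c_var M (num M i)\<close> AllN.prems(2)
    by (auto simp: free_in_simps split: if_splits)
next
  case (Mem t U)
  then show ?case by (auto simp: free_in_simps c_pr_def free_in_numeral_code dest: free_in_code_tm split: if_splits)
qed (auto simp: free_in_simps dest: free_in_code_tm)

lemma depth_le_code_fm: "arithmetical p \<Longrightarrow> \<exists>d. \<forall>h. depth_le d (code_fm V u p h)"
proof (induction p)
  case (Neg p)
  then obtain d where "\<forall>h. depth_le d (code_fm V u p h)" by auto
  then show ?case by (intro exI[of _ "Suc d"]) (simp add: depth_le_shapes del: depth_le.simps)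
next
  case (Conj p q)
  then obtain d d' where "\<forall>h. depth_le d (code_fm V u p h)" "\<forall>h. depth_le d' (code_fm V u q h)" by auto
  then have "\<forall>h. depth_le (max d d') (code_fm V u p h)" "\<forall>h. depth_le (max d d') (code_fm V u q h)"
    using depth_le_mono' by (meson max.cobounded1 max.cobounded2)+
  then show ?case by (intro exI[of _ "Suc (max d d')"]) (simp add: depth_le_shapes del: depth_le.simps)
next
  case (AllN i p)
  then obtain d where "\<forall>h. depth_le d (code_fm V u p h)" by auto
  then show ?case by (intro exI[of _ "Suc d"]) (simp add: depth_le_shapes del: depth_le.simps)
qed (auto simp: depth_le_shapes simp del: depth_le.simps)

lemma polynomial_code_tm: "(\<And>j. polynomial (\<lambda>e. h e j)) \<Longrightarrow> polynomial (\<lambda>e. code_tm (h e) t)"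
  by (induction t) (simp_all add: definableI)

lemma polynomial_code_fm: "(\<And>j. polynomial (\<lambda>e. h e j)) \<Longrightarrow> polynomial (\<lambda>e. code_fm V u p (h e))"
proof (induction p arbitrary: h)
  case (AllN i p)
  have "polynomial (\<lambda>e. code_fm V u p ((h e)(i := c_var M (num M i))))"
  proof (rule AllN.IH)
    show "polynomial (\<lambda>e. ((h e)(i := c_var M (num M i))) j)" for j
      using AllN.prems by (cases "j = i") (simp_all add: polynomial_const)
  qed
  then show ?case by (simp add: definableI)
next
  case (Mem t U)
  then show ?case by (cases "U = V") (simp_all add: c_pr_def definableI polynomial_code_tm)
qed (simp_all add: definableI polynomial_code_tm code_fm.simps(7))

lemma subst_code_tm:
  "is_variable z \<Longrightarrow> (\<And>j r. subst M z c (h j) r \<longleftrightarrow> r = h' j) \<Longrightarrow> subst M z c (code_tm h t) r \<longleftrightarrow> r = code_tm h' t"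
  by (induction t arbitrary: r) (simp_all add: subst_simps)

text \<open>Substituting in the code of a formula amounts to substituting in the codes \<open>h j\<close> and \<open>u\<close> that have been put
  for its variables. The conditions on \<open>h'\<close> and \<open>u'\<close> say that the substitution of a number variable affects this variable
  only; they are needed because the occurrences bound by a quantifier for this variable stay unchanged.\<close>

lemma subst_code_fm:
  assumes "arithmetical p" and z: "is_variable z"
    and "\<And>j r. subst M z c (h j) r \<longleftrightarrow> r = h' j"
    and "\<And>i j. z = c_var M (num M i) \<Longrightarrow> j \<noteq> i \<Longrightarrow> h' j = h j"
    and u: "\<And>r. subst M z c u r \<longleftrightarrow> r = u'" "\<And>v. z = c_var M v \<Longrightarrow> u' = u"
  shows "subst M z c (code_fm V u p h) r \<longleftrightarrow> r = code_fm V u' p h'"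
  using assms(1,3,4)
proof (induction p arbitrary: h h' r)
  have num: "subst M z c (numeral_code a) r \<longleftrightarrow> r = numeral_code a" for a r
    using inert_numeral_code z unfolding inert_def by blast
  {
    case (Eq s t) then show ?case by (simp add: subst_simps subst_code_tm z)
  next
    case (Less s t) then show ?case by (simp add: subst_simps subst_code_tm z)
  next
    case (Mem t U) then show ?case by (simp add: subst_simps subst_code_tm z u(1) num c_pr_def)
  next
    case (Neg p) then show ?case by (simp add: subst_simps z)
  next
    case (Conj p q) then show ?case by (simp add: subst_simps z)
  next
    case (AllN i p)
    let ?v = "c_var M (num M i)"
    show ?case
    proof (cases "z = ?v")
      case True
      then have "h'(i := ?v) = h(i := ?v)" using AllN.prems(3) by auto
      then show ?thesis using True u(2) by (simp add: subst_simps del: fun_upd_apply)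
    next
      case False
      have "subst M z c (code_fm V u p (h(i := ?v))) r \<longleftrightarrow> r = code_fm V u' p (h'(i := ?v))" for r
        by (rule AllN.IH) (use AllN.prems False z in \<open>auto simp: subst_simps\<close>)
      then show ?thesis using False z by (simp add: subst_simps del: fun_upd_apply)
    qed
  next
    case (AllS U p) then show ?case by simp
  }
qed

lemma term_val_code_tm: "(\<And>j y. term_val M (h j) y \<longleftrightarrow> y = e j) \<Longrightarrow> term_val M (code_tm h t) y \<longleftrightarrow> y = tval M e t"
  by (induction t arbitrary: y) (simp_all add: term_val_simps)

lemma valuationD:
  assumes "valuation M W X P f"
  shows "s \<in> Sub M P \<Longrightarrow> pr M s \<zero> \<in> f \<longleftrightarrow> pr M s \<one> \<notin> f"
    "c_eq M s t \<in> Sub M P \<Longrightarrow> pr M (c_eq M s t) \<one> \<in> f \<longleftrightarrow> (\<exists>i j. term_val M s i \<and> term_val M t j \<and> i = j)"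
    "c_less M s t \<in> Sub M P \<Longrightarrow> pr M (c_less M s t) \<one> \<in> f \<longleftrightarrow> (\<exists>i j. term_val M s i \<and> term_val M t j \<and> i \<prec> j)"
    "c_mem M t A \<in> Sub M P \<Longrightarrow> pr M (c_mem M t A) \<one> \<in> f \<longleftrightarrow> (\<exists>i. term_val M t i \<and> in_set_term M W X i A)"
    "c_neg M q \<in> Sub M P \<Longrightarrow> pr M (c_neg M q) \<one> \<in> f \<longleftrightarrow> pr M q \<zero> \<in> f"
    "c_conj M q r \<in> Sub M P \<Longrightarrow> pr M (c_conj M q r) \<one> \<in> f \<longleftrightarrow> pr M q \<one> \<in> f \<and> pr M r \<one> \<in> f"
    "c_alln M v q \<in> Sub M P \<Longrightarrow> pr M (c_alln M v q) \<one> \<in> f \<longleftrightarrow>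
        (\<forall>n r. subst M (c_var M v) (c_num M n) q r \<longrightarrow> pr M r \<one> \<in> f)"
    "c_alls M v q \<in> Sub M P \<Longrightarrow> pr M (c_alls M v q) \<one> \<in> f \<longleftrightarrow>
        (\<forall>n r. subst M (c_svar M v) (c_set M n) q r \<longrightarrow> pr M r \<one> \<in> f)"
proof -
  note c1 = assms[unfolded valuation_def] note c2 = c1[THEN conjunct2] note c3 = c2[THEN conjunct2]
  note c4 = c3[THEN conjunct2] note c5 = c4[THEN conjunct2] note c6 = c5[THEN conjunct2]
  note c7 = c6[THEN conjunct2] note c8 = c7[THEN conjunct2]
  show "s \<in> Sub M P \<Longrightarrow> pr M s \<zero> \<in> f \<longleftrightarrow> pr M s \<one> \<notin> f"
    using c1[THEN conjunct1] unfolding val_function_def by blast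
  show "c_eq M s t \<in> Sub M P \<Longrightarrow> pr M (c_eq M s t) \<one> \<in> f \<longleftrightarrow> (\<exists>i j. term_val M s i \<and> term_val M t j \<and> i = j)"
    by (rule c2[THEN conjunct1, THEN spec, THEN spec, THEN mp])
  show "c_less M s t \<in> Sub M P \<Longrightarrow> pr M (c_less M s t) \<one> \<in> f \<longleftrightarrow> (\<exists>i j. term_val M s i \<and> term_val M t j \<and> i \<prec> j)"
    by (rule c3[THEN conjunct1, THEN spec, THEN spec, THEN mp])
  show "c_mem M t A \<in> Sub M P \<Longrightarrow> pr M (c_mem M t A) \<one> \<in> f \<longleftrightarrow> (\<exists>i. term_val M t i \<and> in_set_term M W X i A)"
    by (rule c4[THEN conjunct1, THEN spec, THEN spec, THEN mp])
  show "c_neg M q \<in> Sub M P \<Longrightarrow> pr M (c_neg M q) \<one> \<in> f \<longleftrightarrow> pr M q \<zero> \<in> f"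
    by (rule c5[THEN conjunct1, THEN spec, THEN mp])
  show "c_conj M q r \<in> Sub M P \<Longrightarrow> pr M (c_conj M q r) \<one> \<in> f \<longleftrightarrow> pr M q \<one> \<in> f \<and> pr M r \<one> \<in> f"
    by (rule c6[THEN conjunct1, THEN spec, THEN spec, THEN mp])
  show "c_alln M v q \<in> Sub M P \<Longrightarrow> pr M (c_alln M v q) \<one> \<in> f \<longleftrightarrow>
        (\<forall>n r. subst M (c_var M v) (c_num M n) q r \<longrightarrow> pr M r \<one> \<in> f)"
    by (rule c7[THEN conjunct1, THEN spec, THEN spec, THEN mp])
  show "c_alls M v q \<in> Sub M P \<Longrightarrow> pr M (c_alls M v q) \<one> \<in> f \<longleftrightarrow>
        (\<forall>n r. subst M (c_svar M v) (c_set M n) q r \<longrightarrow> pr M r \<one> \<in> f)"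
    by (rule c8[THEN spec, THEN spec, THEN mp])
qed

text \<open>Arithmetical formulas are absolute: the coded model has the same numbers as \<open>M\<close>, so a
  valuation must agree with satisfaction in \<open>M\<close> when \<open>V\<close> is interpreted by a section. The induction is
  on the formula in the metatheory, and the hypothesis on \<open>h\<close> says that only terms with the intended values have been
  put for the variables.\<close>

lemma valuation_code_fm:
  assumes val: "valuation M W X P f"
  shows "arithmetical p \<Longrightarrow> (\<And>j y. term_val M (h j) y \<longleftrightarrow> y = e j) \<Longrightarrow> (\<And>j. inert (h j)) \<Longrightarrow>
    (\<And>U x. U \<in> fvS p \<Longrightarrow> U \<noteq> V \<Longrightarrow> pr M x (num M U) \<in> X \<longleftrightarrow> x \<in> E U) \<Longrightarrow>
    code_fm V (c_set M k) p h \<in> Sub M P \<Longrightarrow>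
    pr M (code_fm V (c_set M k) p h) \<one> \<in> f \<longleftrightarrow> sat M e (E(V := section_of M W k)) p"
proof (induction p arbitrary: h e)
  case (Eq s t)
  have "pr M (c_eq M (code_tm h s) (code_tm h t)) \<one> \<in> f \<longleftrightarrow> (\<exists>i j. term_val M (code_tm h s) i \<and> term_val M (code_tm h t) j \<and> i = j)"
    by (rule valuationD(2)[OF val]) (use Eq.prems(5) in simp)
  then show ?case using term_val_code_tm[of h e, OF Eq.prems(2)] by simp
next
  case (Less s t)
  have "pr M (c_less M (code_tm h s) (code_tm h t)) \<one> \<in> f \<longleftrightarrow> (\<exists>i j. term_val M (code_tm h s) i \<and> term_val M (code_tm h t) j \<and> i \<prec> j)"
    by (rule valuationD(3)[OF val]) (use Less.prems(5) in simp)
  then show ?case using term_val_code_tm[of h e, OF Less.prems(2)] by simp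
next
  case (Mem t U)
  have tree_clause: "c_mem M s A \<in> Sub M P \<Longrightarrow> pr M (c_mem M s A) \<one> \<in> f \<longleftrightarrow> (\<exists>i. term_val M s i \<and> in_set_term M W X i A)" for s A
    by (rule valuationD(4)[OF val])
  note tv = term_val_code_tm[of h e, OF Mem.prems(2)]
  have X: "in_set_term M W X i (c_X M) \<longleftrightarrow> i \<in> X" "in_set_term M W X i (c_set M k) \<longleftrightarrow> i \<in> section_of M W k" for i
    unfolding in_set_term_def by (auto simp: c_defs)
  show ?case
  proof (cases "U = V")
    case True
    then show ?thesis using tree_clause[of "code_tm h t" "c_set M k"] Mem.prems(5) tv X by simp
  next
    case False
    have "term_val M (c_pr (code_tm h t) (numeral_code (num M U))) y \<longleftrightarrow> y = pr M (tval M e t) (num M U)" for y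
      unfolding c_pr_def pr_def by (simp add: term_val_simps tv term_val_numeral_code)
    then show ?thesis using tree_clause[of "c_pr (code_tm h t) (numeral_code (num M U))" "c_X M"] Mem.prems(4,5) False X by simp
  qed
next
  case (Neg p)
  have S: "c_neg M (code_fm V (c_set M k) p h) \<in> Sub M P" using Neg.prems(5) by simp
  have "pr M (c_neg M (code_fm V (c_set M k) p h)) \<one> \<in> f \<longleftrightarrow> pr M (code_fm V (c_set M k) p h) \<zero> \<in> f"
    by (rule valuationD(5)[OF val S])
  also have "\<dots> \<longleftrightarrow> pr M (code_fm V (c_set M k) p h) \<one> \<notin> f"
    by (rule valuationD(1)[OF val Sub_neg[OF S]])
  also have "\<dots> \<longleftrightarrow> \<not> sat M e (E(V := section_of M W k)) p"
    using Neg.IH[of h e] Neg.prems Sub_neg[OF S] by (simp del: fun_upd_apply)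
  finally show ?case by (simp del: fun_upd_apply)
next
  case (Conj p q)
  have S: "c_conj M (code_fm V (c_set M k) p h) (code_fm V (c_set M k) q h) \<in> Sub M P" using Conj.prems(5) by simp
  have "pr M (c_conj M (code_fm V (c_set M k) p h) (code_fm V (c_set M k) q h)) \<one> \<in> f \<longleftrightarrow>
     pr M (code_fm V (c_set M k) p h) \<one> \<in> f \<and> pr M (code_fm V (c_set M k) q h) \<one> \<in> f"
    by (rule valuationD(6)[OF val S])
  then show ?case
    using Conj.IH(1)[of h e] Conj.IH(2)[of h e] Conj.prems Sub_conj[OF S] by (simp del: fun_upd_apply)
next
  case (AllN i p)
  let ?h = "h(i := c_var M (num M i))"
  have S: "c_alln M (num M i) (code_fm V (c_set M k) p ?h) \<in> Sub M P" using AllN.prems(5) by (simp del: fun_upd_apply)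
  have sub: "subst M (c_var M (num M i)) (c_num M n) (code_fm V (c_set M k) p ?h) r \<longleftrightarrow> r = code_fm V (c_set M k) p (h(i := c_num M n))" for n r
    by (rule subst_code_fm) (use AllN.prems(1,3) in \<open>auto simp: inert_def subst_simps\<close>)
  have "pr M (c_alln M (num M i) (code_fm V (c_set M k) p ?h)) \<one> \<in> f \<longleftrightarrow>
     (\<forall>n. pr M (code_fm V (c_set M k) p (h(i := c_num M n))) \<one> \<in> f)"
    using valuationD(7)[OF val S] unfolding sub by blast
  moreover have "pr M (code_fm V (c_set M k) p (h(i := c_num M n))) \<one> \<in> f \<longleftrightarrow> sat M (e(i := n)) (E(V := section_of M W k)) p" for n
  proof (rule AllN.IH)
    show "arithmetical p" using AllN.prems(1) by simp
    show "term_val M ((h(i := c_num M n)) j) y \<longleftrightarrow> y = (e(i := n)) j" for j y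
      using AllN.prems(2) by (simp add: term_val_simps)
    show "inert ((h(i := c_num M n)) j)" for j using AllN.prems(3) inert_num by simp
    show "code_fm V (c_set M k) p (h(i := c_num M n)) \<in> Sub M P" using Sub_alln[OF S] sub by blast
  qed (use AllN.prems(4) in simp)
  ultimately show ?case by (simp del: fun_upd_apply)
next
  case (AllS U p) then show ?case by simp
qed

section \<open>From truth sets to \<open>\<Pi>\<^sup>1\<^sub>1\<close> comprehension\<close>

text \<open>By \<open>valuation_code_fm\<close> every valuation gives the sentence the value
  of \<open>q\<close> with \<open>V\<close> ranging over the sections of \<open>W\<close>. One direction uses that sections are sets of \<open>M\<close>,
  the other that each set of \<open>M\<close> is a section of the code of some ideal that contains \<open>X\<close>.\<close>

lemma code_entailed:
  assumes q: "arithmetical q" and X: "X \<in> sets M"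
    and XE: "\<And>U x. U \<in> fvS q \<Longrightarrow> pr M x (num M U) \<in> X \<longleftrightarrow> x \<in> E U"
  shows "computably_entailed M X (c_alls M \<zero> (code_fm V (c_svar M \<zero>) q (\<lambda>j. numeral_code (e j)))) \<longleftrightarrow>
     (\<forall>A\<in>sets M. sat M e (E(V := A)) q)"
proof -
  let ?h = "\<lambda>j. numeral_code (e j)"
  let ?q = "code_fm V (c_svar M \<zero>) q ?h"
  let ?p = "c_alls M \<zero> ?q"
  have form: "is_formula M ?p"
    by (intro is_formula_intros is_formula_code_fm q is_term_numeral_code) (auto simp: is_set_term_def)
  have closed: "is_closed M ?p" unfolding is_closed_iff
  proof (intro allI impI notI)
    fix z assume z: "is_variable z" "free_in M z ?p"
    then have "free_in M z ?q" "z \<noteq> c_svar M \<zero>" by (simp_all add: free_in_simps)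
    then have "free_in M z (c_svar M \<zero>) \<or> (\<exists>j. free_in M z (numeral_code (e j)))"
      using free_in_code_fm[OF q z(1)] by blast
    then show False using \<open>z \<noteq> c_svar M \<zero>\<close> free_in_numeral_code[OF z(1)] free_in_simps(2)[OF z(1)] by blast
  qed
  have sub: "subst M (c_svar M \<zero>) (c_set M k) ?q r \<longleftrightarrow> r = code_fm V (c_set M k) q ?h" for k r
    by (rule subst_code_fm[OF q]) (use inert_numeral_code in \<open>auto simp: inert_def subst_simps\<close>)
  have key: "pr M ?p \<one> \<in> f \<longleftrightarrow> (\<forall>k. sat M e (E(V := section_of M W k)) q)" if val: "valuation M W X ?p f" for W f
  proof -
    have S: "?p \<in> Sub M ?p" by (rule Sub_refl[OF closed])
    have "pr M ?p \<one> \<in> f \<longleftrightarrow> (\<forall>k. pr M (code_fm V (c_set M k) q ?h) \<one> \<in> f)"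
      using valuationD(8)[OF val S] unfolding sub by blast
    moreover have "pr M (code_fm V (c_set M k) q ?h) \<one> \<in> f \<longleftrightarrow> sat M e (E(V := section_of M W k)) q" for k
      by (rule valuation_code_fm[OF val q]) (use term_val_numeral_code inert_numeral_code XE Sub_alls[OF S] sub in blast)+
    ultimately show ?thesis by simp
  qed
  obtain d where d: "depth_le d ?p"
    using depth_le_code_fm[OF q, of V "c_svar M \<zero>"] depth_le_shapes(4) by blast
  show ?thesis
  proof
    assume R: "\<forall>A\<in>sets M. sat M e (E(V := A)) q"
    show "computably_entailed M X ?p"
      unfolding computably_entailed_def is_sentence_def using form closed key R section_sets by blast
  next
    assume L: "computably_entailed M X ?p"
    show "\<forall>A\<in>sets M. sat M e (E(V := A)) q"
    proof
      fix A assume A: "A \<in> sets M"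
      obtain W k where W: "W \<in> sets M" "turing_ideal M W X" "section_of M W k = A"
        using ideal_exists[OF X A] by blast
      obtain f where f: "f \<in> sets M" "valuation M W X ?p f"
        using valuation_exists[OF W(1) X d] by blast
      have "pr M ?p \<one> \<in> f" using L W f unfolding computably_entailed_def by blast
      then show "sat M e (E(V := A)) q" using key[OF f(2)] W(3) by blast
    qed
  qed
qed

text \<open>The code of the sentence is a polynomial in the code \<open>y\<close> of the numeral, so the set to be defined is
  \<open>{x. \<exists>y. is_numeral x y \<and> code y \<in> C}\<close>. The set parameters \<open>E U\<close> of the formula are the sections of \<open>X\<close>.\<close>

lemma Pi11_CA_if_truth_sets:
  assumes "truth_sets_exist M" shows "M \<Turnstile> Pi11_CA"
  unfolding models_def
proof (intro ballI allI impI)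
  fix p and e :: "nat \<Rightarrow> 'a" and E :: "nat \<Rightarrow> 'a set"
  assume "p \<in> Pi11_CA" and E: "\<forall>X. E X \<in> sets M"
  then obtain Y n V q where p: "p = ExS Y (AllN n (Iff (Mem (NVar n) Y) (AllS V q)))" and
    q: "arithmetical q" and Y: "Y \<notin> fvS (AllS V q)"
    unfolding Pi11_CA_def comprehension_def Pi11_def by blast
  define X where "X = {z. \<exists>U\<in>fvS q. \<exists>x. z = pr M x (num M U) \<and> x \<in> E U}"
  have X: "X \<in> sets M" unfolding X_def
    by (rule arithmetical_comprehension, rule definable_finite_ex) (simp, intro definableI E[rule_format])
  have XE: "pr M x (num M U) \<in> X \<longleftrightarrow> x \<in> E U" if "U \<in> fvS q" for U x
    unfolding X_def using that by auto
  obtain C where C: "C \<in> sets M" "\<And>p. p \<in> C \<longleftrightarrow> computably_entailed M X p"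
    using assms X unfolding truth_sets_exist_def by blast
  define code where "code y = c_alls M \<zero> (code_fm V (c_svar M \<zero>) q (\<lambda>j. if j = n then y else numeral_code (e j)))" for y
  define B where "B = {x. \<exists>y. is_numeral x y \<and> code y \<in> C}"
  have "polynomial (\<lambda>e'. code (e' 0))" unfolding code_def
  proof (intro definableI polynomial_code_fm)
    show "polynomial (\<lambda>e'. if j = n then e' 0 else numeral_code (e j))" for j
      by (cases "j = n") (simp_all add: definableI)
  qed
  then have B: "B \<in> sets M" unfolding B_def by (intro arithmetical_comprehension definableI C(1))
  have "x \<in> B \<longleftrightarrow> sat M (e(n := x)) (E(Y := B)) (AllS V q)" for x
  proof -
    have "(\<lambda>j. if j = n then numeral_code x else numeral_code (e j)) = (\<lambda>j. numeral_code ((e(n := x)) j))" by auto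
    then have "x \<in> B \<longleftrightarrow> (\<forall>A\<in>sets M. sat M (e(n := x)) (E(V := A)) q)"
      unfolding B_def mem_Collect_eq is_numeral_numeral_code using code_entailed[OF q X XE, of V "e(n := x)"] C(2)
      by (simp add: code_def)
    also have "\<dots> \<longleftrightarrow> sat M (e(n := x)) E (AllS V q)" by simp
    also have "\<dots> \<longleftrightarrow> sat M (e(n := x)) (E(Y := B)) (AllS V q)"
      by (rule sat_cong_sets) (use Y in auto)
    finally show ?thesis .
  qed
  then show "sat M e E p" unfolding p sat_comprehension using B by blast
qed

end

theorem corollary7p11:
  fixes M :: "'a L2_structure"
  assumes "sets M \<noteq> {}" and "M \<Turnstile> ACA0"
  shows "M \<Turnstile> Pi11_CA \<longleftrightarrow> truth_sets_exist M"
proof -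
  interpret aca0 M using assms by unfold_locales
  show ?thesis
  proof
    assume "M \<Turnstile> Pi11_CA"
    then show "truth_sets_exist M"
      unfolding truth_sets_exist_def using computably_entailed_set by (metis mem_Collect_eq)
  next
    assume "truth_sets_exist M"
    then show "M \<Turnstile> Pi11_CA" by (rule Pi11_CA_if_truth_sets)
  qed
qed

end
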